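(* Consider a stable G/Mn/1 queue with inter-arrival time CDF $G$ (LST $G^*$) and service rates $\mu_n>0$, $n\ge 1$. Let $R_n$ and $R_n^*$ be the CDF and LST of the steady-state residual inter-arrival time at a departure instance, conditioned on the departure leaving behind $n$ customers. Then for every $n\ge 0$, $$R^*_n(s) = (1 - G^*(\mu_{n+1}))\,D^*_{\mu_{n+1},G}(s)+G^*(\mu_{n+1})\,D^*_{\mu_{n+1},R_{n+1}}(s).$$
   Context: G/Mn/1 queue: a single-server queue with customers arriving one by one; inter-arrival times are i.i.d. with CDF $G$, LST $G^*(s)=\int_0^\infty e^{-sx}\,dG(x)$ and mean $1/\lambda$. The service rate depends on the queue length: given that there are $n\ge1$ customers in the system at time $t$, the number of service completions in $[t,t+\Delta]$ is independent of the past, the probability of a single service completion in this interval is $\mu_n\Delta+o(\Delta)$, and the probability of two or more is $o(\Delta)$. The system is assumed stable; steady-state probabilities and distributions are long-run averages (over departures, for quantities at departure instances). The residual inter-arrival time at a departure instance is the time from that instance until the next arrival; $R_n$ is its steady-state CDF given that there are $n$ customers in the system just after the departure. For $\alpha>0$ and a CDF $F$ of a nonnegative random variable $X$ with $P(X\in(0,\infty))>0$, let $Y_\alpha$ be exponential with rate $\alpha$, independent of $X$. Then $D_{\alpha,F}$ denotes the CDF, and $D^*_{\alpha,F}$ the LST, of the random variable $X-Y_\alpha$ conditioned on $X\ge Y_\alpha$. *)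

theory Defs
  imports "HOL-Probability.Probability" "HOL-Library.Landau_Symbols"
begin

text \<open>
  Laws of real random variables are represented by measures on \<open>borel\<close>; the distribution
  function of a law \<open>F\<close> is \<open>cdf F\<close>.
\<close>

definition lst :: "real measure \<Rightarrow> complex \<Rightarrow> complex" where
  "lst F s = (LINT x:{0..}|F. exp (- (s * complex_of_real x)))"

text \<open>The law of \<open>X - Y\<close> given \<open>Y \<le> X\<close>, with \<open>X\<close> of law \<open>F\<close> and \<open>Y\<close> exponential with rate \<open>a\<close>,
  independent of \<open>X\<close>.\<close>

definition exp_overshoot :: "real \<Rightarrow> real measure \<Rightarrow> real measure" where
  "exp_overshoot a F =
     distr (uniform_measure (F \<Otimes>\<^sub>M density lborel (exponential_density a)) {(x, y). y \<le> x})
       borel (\<lambda>(x, y). x - y)"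

text \<open>
  A queue is described by the number \<open>N0\<close> of customers present at time 0, before any arrival,
  the arrival epochs \<open>T 0 \<le> T 1 \<le> \<dots>\<close>, and the counting process \<open>Dep\<close>, where \<open>Dep t\<close> is the number
  of service completions in \<open>(0, t]\<close>.
\<close>

definition arrivals :: "(nat \<Rightarrow> 'w \<Rightarrow> real) \<Rightarrow> real \<Rightarrow> 'w \<Rightarrow> nat" where
  "arrivals T t w = card {k. T k w \<le> t}"

definition queue_length ::
  "('w \<Rightarrow> nat) \<Rightarrow> (nat \<Rightarrow> 'w \<Rightarrow> real) \<Rightarrow> (real \<Rightarrow> 'w \<Rightarrow> nat) \<Rightarrow> real \<Rightarrow> 'w \<Rightarrow> nat" where
  "queue_length N0 T Dep t w = N0 w + arrivals T t w - Dep t w"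

text \<open>
  The past of the service process at time \<open>t\<close>. It contains the whole arrival stream, which
  expresses that services are independent of the arrivals apart from their dependence on the
  queue length.
\<close>

definition past ::
  "'w measure \<Rightarrow> ('w \<Rightarrow> nat) \<Rightarrow> (nat \<Rightarrow> 'w \<Rightarrow> real) \<Rightarrow> (real \<Rightarrow> 'w \<Rightarrow> nat) \<Rightarrow> real \<Rightarrow> 'w set set" where
  "past M N0 T Dep t = sigma_sets (space M)
     ({N0 -` {i} \<inter> space M | i. True}
      \<union> {T k -` S \<inter> space M | k S. S \<in> sets borel}
      \<union> {Dep u -` {i} \<inter> space M | u i. 0 \<le> u \<and> u \<le> t})"

text \<open>
  The initial state \<open>(N0, T 0)\<close> is arbitrary; the inter-arrival times are
  \<open>T (Suc k) - T k\<close>.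

  In \<open>service_rates\<close>, \<open>q n h\<close> is the law of the number of service completions in a time window
  of length \<open>h\<close> at the start of which there are \<open>n\<close> customers. Windows containing arrivals are
  excluded: an arrival changes the service rate, so that the number of completions in such a
  window depends on more than \<open>n\<close> and \<open>h\<close>. As \<open>service_rates\<close> only looks at fixed times, it does
  not by itself exclude completions exactly at the random arrival epochs; this is done by
  \<open>no_coincidence\<close>.
\<close>

locale GMn1_queue = prob_space M
  for M :: "'w measure" +
  fixes G :: "real measure" and lam :: real and mu :: "nat \<Rightarrow> real"
    and N0 :: "'w \<Rightarrow> nat" and T :: "nat \<Rightarrow> 'w \<Rightarrow> real" and Dep :: "real \<Rightarrow> 'w \<Rightarrow> nat"
  assumes G_distribution: "real_distribution G"
    and G_nonneg: "AE x in G. 0 \<le> x"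
    and lam_pos: "0 < lam"
    and G_integrable: "integrable G (\<lambda>x. x)"
    and G_mean: "(LINT x|G. x) = 1 / lam"
    and mu_pos: "\<And>n. 1 \<le> n \<Longrightarrow> 0 < mu n"
    and N0_measurable: "N0 \<in> measurable M (count_space UNIV)"
    and T_measurable: "\<And>k. T k \<in> borel_measurable M"
    and Dep_measurable: "\<And>t. 0 \<le> t \<Longrightarrow> Dep t \<in> measurable M (count_space UNIV)"
    and first_arrival: "AE w in M. 0 \<le> T 0 w"
    and interarrival_law: "\<And>k. distr M borel (\<lambda>w. T (Suc k) w - T k w) = G"
    and interarrival_indep: "indep_vars (\<lambda>_. borel) (\<lambda>k w. T (Suc k) w - T k w) UNIV"
    and initial_indep:
      "indep_set
         {(\<lambda>w. (N0 w, T 0 w)) -` S \<inter> space M | S. S \<in> sets (count_space UNIV \<Otimes>\<^sub>M borel)}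
         {(\<lambda>w k. T (Suc k) w - T k w) -` S \<inter> space M | S. S \<in> sets (Pi\<^sub>M UNIV (\<lambda>_. borel))}"
    and Dep_0: "\<And>w. w \<in> space M \<Longrightarrow> Dep 0 w = 0"
    and Dep_mono: "\<And>w t u. w \<in> space M \<Longrightarrow> 0 \<le> t \<Longrightarrow> t \<le> u \<Longrightarrow> Dep t w \<le> Dep u w"
    and Dep_right_continuous:
      "\<And>w t. w \<in> space M \<Longrightarrow> 0 \<le> t \<Longrightarrow> continuous (at_right t) (\<lambda>u. Dep u w)"
    and Dep_le: "AE w in M. \<forall>t\<ge>0. Dep t w \<le> N0 w + arrivals T t w"
    and no_coincidence:
      "AE w in M. \<forall>k. 0 < T k w \<longrightarrow> continuous (at_left (T k w)) (\<lambda>u. Dep u w)"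
    and service_rates:
      "\<exists>q :: nat \<Rightarrow> real \<Rightarrow> nat pmf.
         (\<forall>n\<ge>1. \<forall>t\<ge>0. \<forall>h>0. \<forall>B\<in>past M N0 T Dep t.
            B \<subseteq> {w \<in> space M. queue_length N0 T Dep t w = n
                              \<and> (\<forall>k. \<not> (t < T k w \<and> T k w \<le> t + h))} \<longrightarrow>
            (\<forall>i. prob (B \<inter> {w \<in> space M. Dep (t + h) w - Dep t w = i})
                  = prob B * pmf (q n h) i))
       \<and> (\<forall>n\<ge>1. (\<lambda>h. pmf (q n h) 1 - mu n * h) \<in> o[at_right 0](\<lambda>h. h))
       \<and> (\<forall>n\<ge>1. (\<lambda>h. measure_pmf.prob (q n h) {2..}) \<in> o[at_right 0](\<lambda>h. h))"

text \<open>Stability: the long-run fractions of time with \<open>n\<close> customers in the system form a probability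
  distribution.\<close>

definition stable_queue ::
  "'w measure \<Rightarrow> ('w \<Rightarrow> nat) \<Rightarrow> (nat \<Rightarrow> 'w \<Rightarrow> real) \<Rightarrow> (real \<Rightarrow> 'w \<Rightarrow> nat) \<Rightarrow> bool" where
  "stable_queue M N0 T Dep \<longleftrightarrow>
     (\<exists>p :: nat \<Rightarrow> real. (\<forall>n. 0 \<le> p n) \<and> p sums 1 \<and>
       (\<forall>n. AE w in M.
          ((\<lambda>t. measure lborel {u \<in> {0..t}. queue_length N0 T Dep u w = n} / t) \<longlongrightarrow> p n) at_top))"

definition departure_epoch :: "(real \<Rightarrow> 'w \<Rightarrow> nat) \<Rightarrow> nat \<Rightarrow> 'w \<Rightarrow> real" where
  "departure_epoch Dep j w = Inf {t. 0 \<le> t \<and> Suc j \<le> Dep t w}"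

definition left_behind ::
  "('w \<Rightarrow> nat) \<Rightarrow> (nat \<Rightarrow> 'w \<Rightarrow> real) \<Rightarrow> (real \<Rightarrow> 'w \<Rightarrow> nat) \<Rightarrow> nat \<Rightarrow> 'w \<Rightarrow> nat" where
  "left_behind N0 T Dep j w = queue_length N0 T Dep (departure_epoch Dep j w) w"

definition residual_interarrival ::
  "(nat \<Rightarrow> 'w \<Rightarrow> real) \<Rightarrow> (real \<Rightarrow> 'w \<Rightarrow> nat) \<Rightarrow> nat \<Rightarrow> 'w \<Rightarrow> real" where
  "residual_interarrival T Dep j w =
     Inf {T k w | k. departure_epoch Dep j w < T k w} - departure_epoch Dep j w"

text \<open>\<open>F\<close> is the steady-state law of the residual inter-arrival time at departures leaving \<open>n\<close>
  customers behind: its distribution function is the almost sure long-run fraction over such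
  departures.\<close>

definition steady_residual_law ::
  "'w measure \<Rightarrow> ('w \<Rightarrow> nat) \<Rightarrow> (nat \<Rightarrow> 'w \<Rightarrow> real) \<Rightarrow> (real \<Rightarrow> 'w \<Rightarrow> nat)
     \<Rightarrow> nat \<Rightarrow> real measure \<Rightarrow> bool" where
  "steady_residual_law M N0 T Dep n F \<longleftrightarrow>
     real_distribution F \<and>
     (\<forall>x. AE w in M.
        (\<lambda>m. real (card {j. j < m \<and> left_behind N0 T Dep j w = n
                             \<and> residual_interarrival T Dep j w \<le> x})
             / real (card {j. j < m \<and> left_behind N0 T Dep j w = n})) \<longlonglongrightarrow> cdf F x)"

end

theory Submission
  imports Defs
begin

text \<open>
  Up to a time \<open>t\<close>, consider the departures that leave \<open>n\<close> customers behind, the arrivals that find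
  \<open>n\<close> customers, and the time spent with \<open>n + 1\<close> customers. Let \<open>\<rho>\<close> be the time until the next arrival.
  Between events \<open>exp (- s * \<rho>)\<close> grows at rate \<open>s\<close>. Comparing its values when the state \<open>n + 1\<close> is
  entered and left gives, on every path and up to a bounded error (\<open>state_balance\<close>),

    \<open>s * (integral of exp (- s * \<rho>) over the time in state n + 1)
      = (sum of exp (- s * \<rho>) over departures leaving n) + (number of arrivals finding n + 1)
        - (sum of exp (- s * \<rho>) over arrivals finding n)
        - (sum of exp (- s * \<rho>) over departures leaving n + 1)\<close>.

  Two laws of large numbers evaluate these terms. In state \<open>n + 1\<close> departures occur at rate
  \<open>mu (n + 1)\<close> whatever the value of \<open>\<rho>\<close>, so the integral is \<open>1 / mu (n + 1)\<close> times the first sum on the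
  right (\<open>departure_martingale\<close>). The inter-arrival time that starts at an arrival is independent of the number of
  customers found, so the sum over arrivals is their number times \<open>lst G s\<close> (\<open>arrival_martingale\<close>). As
  many arrivals find \<open>n\<close> as departures leave \<open>n\<close> (\<open>level_crossing\<close>). After division by \<open>t\<close>, with
  \<open>d n = mu (n + 1) * p (n + 1)\<close> and \<open>p\<close> the stationary distribution of the queue length,
  this becomes \<open>balance_equation\<close>:

    \<open>s / mu (n + 1) * d n * lst (R n) s
      = d n * lst (R n) s + d (n + 1) - d n * lst G s - d (n + 1) * lst (R (n + 1)) s\<close>.

  For \<open>s = mu (n + 1)\<close> the transform of \<open>R n\<close> cancels and \<open>d (n + 1) / d n\<close> is found. The overshoot over an
  exponential time of rate \<open>a\<close> has the transform
  \<open>a * (lst F s - lst F a) / ((a - s) * (1 - lst F a))\<close> (\<open>lst_exp_overshoot\<close>), and with the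
  value of \<open>d (n + 1) / d n\<close> the balance equation turns into the theorem.

  It remains to see that every \<open>d n\<close> is positive. Stability gives this for one \<open>n\<close>
  (\<open>some_throughput_pos\<close>): otherwise the system would be empty almost always, although customers keep arriving at a positive
  rate. The balance equation itself carries positivity to the neighbouring levels
  (\<open>throughput_up\<close>, \<open>throughput_down\<close>).

  The laws of large numbers are variance estimates at the times \<open>t = m\<^sup>2\<close>, where they are summable
  (\<open>AE_tendsto_0_squares\<close>). Services are described by the law of the completions in a window free of arrivals,
  given the past and all arrivals. For departures, \<open>[0, t]\<close> is therefore divided into windows of length
  \<open>1 / R\<close>, the number of departures is compared with its conditional expectation, and Fatou's lemma
  is applied as \<open>R \<rightarrow> \<infinity>\<close>. For arrivals, it has to be shown that departures do not
  anticipate later arrivals although they are conditioned on all of them (\<open>blind_step\<close>,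
  \<open>gap_blind_pair\<close>): between two arrivals their law involves only the time between these arrivals and
  the number of customers.
\<close>

section \<open>Sample paths of the queue\<close>

text \<open>Arrival and departure counts are handled through one-sided constancy: a monotone function with
  values in the natural numbers is constant just to the left of any point, and a right-continuous
  one just to the right. This replaces any enumeration of the events of a path.\<close>

lemma mono_nat_constant_left:
  fixes f :: "real \<Rightarrow> nat"
  assumes mono: "\<And>u v. 0 \<le> u \<Longrightarrow> u \<le> v \<Longrightarrow> f u \<le> f v" and t: "0 < t"
  obtains v where "0 \<le> v" "v < t" "\<And>u. v \<le> u \<Longrightarrow> u < t \<Longrightarrow> f u = f v"
proof -
  have "f ` {0..<t} \<subseteq> {..f t}"
    using mono by auto
  then have fin: "finite (f ` {0..<t})"
    using finite_subset by blast
  moreover have "f ` {0..<t} \<noteq> {}"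
    using t by auto
  ultimately have "Max (f ` {0..<t}) \<in> f ` {0..<t}"
    by (rule Max_in)
  then obtain v where v: "0 \<le> v" "v < t" "Max (f ` {0..<t}) = f v"
    by auto
  have "f u = f v" if "v \<le> u" "u < t" for u
  proof (rule antisym)
    have "f u \<in> f ` {0..<t}"
      using that v by auto
    then show "f u \<le> f v"
      using Max_ge[OF fin] v(3) by metis
  qed (use mono v that in auto)
  then show ?thesis
    using that v by blast
qed

lemma right_continuous_nat:
  fixes f :: "real \<Rightarrow> nat"
  assumes "continuous (at_right x) f"
  obtains v where "x < v" "\<And>u. x \<le> u \<Longrightarrow> u < v \<Longrightarrow> f u = f x"
proof -
  have "(f \<longlongrightarrow> f x) (at_right x)"
    using assms by (simp add: continuous_within)
  then have "\<forall>\<^sub>F u in at_right x. f u = f x"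
    by (simp add: tendsto_discrete)
  then obtain b where b: "x < b" "\<And>u. x < u \<Longrightarrow> u < b \<Longrightarrow> f u = f x"
    unfolding eventually_at_right_field by auto
  show ?thesis
    by (rule that[OF b(1)]) (use b(2) in \<open>metis order_le_less\<close>)
qed

text \<open>The time from \<open>t\<close> to the next arrival: as the arrivals are numbered from \<open>0\<close>, the number of
  arrivals up to \<open>t\<close> is the index of the next one.\<close>

definition residual :: "(nat \<Rightarrow> 'w \<Rightarrow> real) \<Rightarrow> real \<Rightarrow> 'w \<Rightarrow> real" where
  "residual T t w = T (arrivals T t w) w - t"

text \<open>In a batch of simultaneous arrivals the customers are counted as arriving one after the other, so
  arrival \<open>k\<close> finds everybody with a smaller index. Services never end at an arrival epoch, hence
  \<open>Dep (T k w) w\<close> is also the number of departures strictly before that epoch.\<close>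

definition seen_by :: "('w \<Rightarrow> nat) \<Rightarrow> (nat \<Rightarrow> 'w \<Rightarrow> real) \<Rightarrow> (real \<Rightarrow> 'w \<Rightarrow> nat) \<Rightarrow> nat \<Rightarrow> 'w \<Rightarrow> nat" where
  "seen_by N0 T Dep k w = N0 w + k - Dep (T k w) w"

text \<open>The deterministic properties shared by almost all sample paths \<open>w\<close>. That departures occur one
  at a time is separated into \<open>simple_queue_path\<close>, because it is derived from the service rates by
  an argument on paths that do not have this property.\<close>

locale queue_path =
  fixes N0 :: "'w \<Rightarrow> nat" and T :: "nat \<Rightarrow> 'w \<Rightarrow> real" and Dep :: "real \<Rightarrow> 'w \<Rightarrow> nat" and w :: 'w
  assumes T_nonneg0: "0 \<le> T 0 w"
    and T_step: "\<And>k. T k w \<le> T (Suc k) w"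
    and T_unbounded: "filterlim (\<lambda>k. T k w) at_top sequentially"
    and D_0: "Dep 0 w = 0"
    and D_mono: "\<And>t u. 0 \<le> t \<Longrightarrow> t \<le> u \<Longrightarrow> Dep t w \<le> Dep u w"
    and D_right: "\<And>t. 0 \<le> t \<Longrightarrow> continuous (at_right t) (\<lambda>u. Dep u w)"
    and D_le: "\<And>t. 0 \<le> t \<Longrightarrow> Dep t w \<le> N0 w + arrivals T t w"
    and D_left_arrival: "\<And>k. 0 < T k w \<Longrightarrow> continuous (at_left (T k w)) (\<lambda>u. Dep u w)"
begin

lemma T_mono: "i \<le> j \<Longrightarrow> T i w \<le> T j w"
  using T_step by (rule lift_Suc_mono_le)

lemma T_nonneg: "0 \<le> T k w"
  using T_mono[of 0 k] T_nonneg0 by simp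

lemma T_le_iff: "T k w \<le> t \<longleftrightarrow> k < arrivals T t w"
proof -
  let ?S = "{k. T k w \<le> t}"
  obtain K where K: "\<And>k. K \<le> k \<Longrightarrow> t + 1 \<le> T k w"
    using T_unbounded unfolding filterlim_at_top eventually_sequentially by blast
  have "?S \<subseteq> {..<K}"
  proof
    fix k assume "k \<in> ?S"
    then have "\<not> K \<le> k" using K[of k] by auto
    then show "k \<in> {..<K}" by simp
  qed
  then have fin: "finite ?S"
    using finite_subset by blast
  define n where "n = (LEAST k. t < T k w)"
  have ex: "t < T n w"
    unfolding n_def by (rule LeastI[of _ K]) (use K[of K] in simp)
  have "?S = {..<n}"
  proof (intro equalityI subsetI)
    fix k assume "k \<in> ?S"
    then have "\<not> n \<le> k" using T_mono[of n k] ex by auto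
    then show "k \<in> {..<n}" by simp
  next
    fix k assume "k \<in> {..<n}"
    then show "k \<in> ?S" unfolding n_def using not_less_Least by fastforce
  qed
  then show ?thesis
    unfolding arrivals_def by auto
qed

lemma less_T_iff: "t < T k w \<longleftrightarrow> arrivals T t w \<le> k"
  using T_le_iff[of k t] by linarith

lemma arrivals_mono: "t \<le> u \<Longrightarrow> arrivals T t w \<le> arrivals T u w"
  using less_T_iff[of u "arrivals T u w"] less_T_iff[of t "arrivals T u w"] by simp

lemma residual_pos: "0 < residual T t w"
  using less_T_iff[of t "arrivals T t w"] by (simp add: residual_def)

lemma arrivals_eq_between:
  assumes "t \<le> u" "u < T (arrivals T t w) w"
  shows "arrivals T u w = arrivals T t w"
  using assms(2) arrivals_mono[OF assms(1)] by (simp add: less_T_iff)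

lemma D_const_right:
  assumes "0 \<le> t"
  obtains v where "t < v" "\<And>u. t \<le> u \<Longrightarrow> u < v \<Longrightarrow> Dep u w = Dep t w"
  using right_continuous_nat[OF D_right[OF assms]] by blast

lemma D_const_left:
  assumes "0 < t"
  obtains v where "0 \<le> v" "v < t" "\<And>u. v \<le> u \<Longrightarrow> u < t \<Longrightarrow> Dep u w = Dep v w"
  using mono_nat_constant_left[of "\<lambda>u. Dep u w" t] D_mono assms by blast

lemma D_arrival_left:
  assumes "0 < T k w"
  obtains v where "0 \<le> v" "v < T k w" "\<And>u. v \<le> u \<Longrightarrow> u \<le> T k w \<Longrightarrow> Dep u w = Dep v w"
proof -
  obtain v where v: "0 \<le> v" "v < T k w" "\<And>u. v \<le> u \<Longrightarrow> u < T k w \<Longrightarrow> Dep u w = Dep v w"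
    using D_const_left[OF assms] by metis
  have "((\<lambda>u. Dep u w) \<longlongrightarrow> Dep (T k w) w) (at_left (T k w))"
    using D_left_arrival[OF assms] by (simp add: continuous_within)
  then have "\<forall>\<^sub>F u in at_left (T k w). Dep u w = Dep (T k w) w"
    by (simp add: tendsto_discrete)
  then obtain b where b: "b < T k w" "\<And>u. b < u \<Longrightarrow> u < T k w \<Longrightarrow> Dep u w = Dep (T k w) w"
    unfolding eventually_at_left_field by auto
  let ?u = "(max b v + T k w) / 2"
  have "b < ?u" "?u < T k w" "v \<le> ?u" using b v by (auto simp: max_def)
  then have "Dep (T k w) w = Dep v w" using b(2) v(3) by metis
  then show ?thesis using that v by (metis order_le_less)
qed

text \<open>By right-continuity the infimum in \<open>departure_epoch\<close> is attained.\<close>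

lemma epoch_set:
  assumes "Suc j \<le> Dep t w" "0 \<le> t"
  shows epoch_pos: "0 < departure_epoch Dep j w"
    and epoch_reached: "Suc j \<le> Dep (departure_epoch Dep j w) w"
    and epoch_le: "departure_epoch Dep j w \<le> t"
proof -
  let ?S = "{t. 0 \<le> t \<and> Suc j \<le> Dep t w}" and ?d = "departure_epoch Dep j w"
  have tS: "t \<in> ?S" using assms by simp
  have bdd: "bdd_below ?S" by (rule bdd_belowI[of _ 0]) auto
  show le: "?d \<le> t"
    unfolding departure_epoch_def by (rule cInf_lower[OF tS bdd])
  have d0: "0 \<le> ?d"
    unfolding departure_epoch_def by (rule cInf_greatest) (use tS in auto)
  show reached: "Suc j \<le> Dep ?d w"
  proof (rule ccontr)
    assume neg: "\<not> ?thesis"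
    obtain v where v: "?d < v" "\<And>u. ?d \<le> u \<Longrightarrow> u < v \<Longrightarrow> Dep u w = Dep ?d w"
      using D_const_right[OF d0] by metis
    then obtain u where "u \<in> ?S" "u < v"
      using cInf_lessD[of ?S v] tS unfolding departure_epoch_def by blast
    then show False
      using v(2)[of u] neg cInf_lower[OF _ bdd, of u] unfolding departure_epoch_def by auto
  qed
  show "0 < ?d"
    using reached D_0 d0 by (metis Suc_n_not_le_n le0 le_antisym order_le_less not_less_eq_eq)
qed

lemma epoch_le_iff:
  assumes "0 \<le> u" "Suc j \<le> Dep t w" "0 \<le> t"
  shows "departure_epoch Dep j w \<le> u \<longleftrightarrow> Suc j \<le> Dep u w"
  using epoch_pos[OF assms(2,3)] epoch_reached[OF assms(2,3)] epoch_le[of j u] assms(1)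
    D_mono[of "departure_epoch Dep j w" u]
  by fastforce

text \<open>A departure is a jump of \<open>Dep\<close>, and \<open>Dep\<close> is left-continuous at arrival epochs.\<close>

lemma epoch_not_arrival:
  assumes "Suc j \<le> Dep t w" "0 \<le> t"
  shows "T k w \<noteq> departure_epoch Dep j w"
proof
  let ?d = "departure_epoch Dep j w"
  assume eq: "T k w = ?d"
  then obtain v where v: "0 \<le> v" "v < ?d" "\<And>u. v \<le> u \<Longrightarrow> u \<le> ?d \<Longrightarrow> Dep u w = Dep v w"
    using D_arrival_left[of k] epoch_pos[OF assms] by metis
  then have "Dep v w = Dep ?d w" by (intro v(3)[of ?d, symmetric]) (use v(2) in auto)
  then show False using epoch_le_iff[OF v(1) assms] epoch_reached[OF assms] v(2) by simp
qed

lemma residual_interarrival_eq: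
  assumes "Suc j \<le> Dep t w" "0 \<le> t"
  shows "residual_interarrival T Dep j w = residual T (departure_epoch Dep j w) w"
proof -
  let ?d = "departure_epoch Dep j w"
  have "Inf {T k w | k. ?d < T k w} = T (arrivals T ?d w) w"
    by (rule cInf_eq_minimum) (use less_T_iff T_mono in auto)
  then show ?thesis by (simp add: residual_interarrival_def residual_def)
qed

end

locale simple_queue_path = queue_path +
  assumes unit_jumps: "\<And>j t. 0 \<le> t \<Longrightarrow> Suc (Suc j) \<le> Dep t w \<Longrightarrow>
    departure_epoch Dep j w < departure_epoch Dep (Suc j) w"
begin

lemma Dep_epoch:
  assumes "Suc j \<le> Dep t w" "0 \<le> t"
  shows "Dep (departure_epoch Dep j w) w = Suc j"
proof (rule antisym)
  let ?d = "departure_epoch Dep j w"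
  show "Dep ?d w \<le> Suc j"
  proof (rule ccontr)
    assume "\<not> ?thesis"
    then have "Suc (Suc j) \<le> Dep ?d w" by simp
    then show False
      using unit_jumps[of ?d j] epoch_le[of "Suc j" ?d] epoch_pos[OF assms] by simp
  qed
qed (use epoch_reached[OF assms] in simp)

lemma one_departure_left:
  assumes "0 \<le> v" "v < t" "\<And>u. v \<le> u \<Longrightarrow> u < t \<Longrightarrow> Dep u w = Dep v w" "Dep t w \<noteq> Dep v w"
  shows "Dep t w = Suc (Dep v w)" "departure_epoch Dep (Dep v w) w = t"
proof -
  let ?j = "Dep v w"
  have j: "Suc ?j \<le> Dep t w" using D_mono[of v t] assms(1,2,4) by simp
  have t0: "0 \<le> t" using assms(1,2) by simp
  let ?d = "departure_epoch Dep ?j w"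
  have "?d \<le> t" using epoch_le[OF j t0] .
  moreover have "\<not> ?d < t"
  proof
    assume "?d < t"
    then have "Dep (max ?d v) w = ?j" by (intro assms(3)) (use assms(2) in auto)
    moreover have "Suc ?j \<le> Dep (max ?d v) w"
      using epoch_le_iff[of "max ?d v" ?j t] j t0 assms(1) by simp
    ultimately show False by simp
  qed
  ultimately show "?d = t" by simp
  then show "Dep t w = Suc ?j" using Dep_epoch[OF j t0] by simp
qed

end

section \<open>Balance along a path\<close>

lemma measurable_mono_nat:
  fixes f :: "real \<Rightarrow> nat"
  assumes "mono f"
  shows "f \<in> borel \<rightarrow>\<^sub>M count_space UNIV"
proof -
  have "mono (\<lambda>u. real (f u))"
    using assms by (simp add: mono_def)
  then have [measurable]: "(\<lambda>u. real (f u)) \<in> borel_measurable borel"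
    by (rule borel_measurable_mono)
  have "f -` {n} \<inter> space borel \<in> sets borel" for n
  proof -
    have "f -` {n} \<inter> space borel = {u \<in> space borel. real (f u) = real n}" by auto
    also have "\<dots> \<in> sets borel" by measurable
    finally show ?thesis .
  qed
  then show ?thesis
    by (auto simp: measurable_count_space_eq2_countable)
qed

context queue_path
begin

lemma arrivals_time_measurable: "(\<lambda>u. arrivals T u w) \<in> borel \<rightarrow>\<^sub>M count_space UNIV"
  by (rule measurable_mono_nat) (simp add: mono_def arrivals_mono)

lemma queue_length_time_measurable:
  "(\<lambda>u. N0 w + arrivals T u w - Dep (max 0 u) w) \<in> borel \<rightarrow>\<^sub>M count_space UNIV"
proof -
  have [measurable]: "(\<lambda>u. Dep (max 0 u) w) \<in> borel \<rightarrow>\<^sub>M count_space UNIV"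
    by (rule measurable_mono_nat) (auto simp: mono_def intro!: D_mono)
  note arrivals_time_measurable[measurable]
  show ?thesis by measurable
qed

lemma path_integrable:
  fixes f :: "nat \<Rightarrow> real \<Rightarrow> 'b::euclidean_space"
  assumes f: "\<And>q. f q \<in> borel_measurable borel"
    and bd: "\<And>q r. 0 \<le> r \<Longrightarrow> norm (f q r) \<le> B" and a: "0 \<le> a"
  shows "(\<lambda>u. f (queue_length N0 T Dep u w) (residual T u w)) integrable_on {a..b}"
proof -
  let ?Q = "\<lambda>u. N0 w + arrivals T u w - Dep (max 0 u) w"
  note A[measurable] = arrivals_time_measurable and Q[measurable] = queue_length_time_measurable
  have [measurable]: "(\<lambda>u. T (arrivals T u w) w) \<in> borel_measurable borel"
    by (rule measurable_compose_countable[OF _ A]) simp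
  have [measurable]: "(\<lambda>u. residual T u w) \<in> borel_measurable borel"
    unfolding residual_def by measurable
  have [measurable]: "(\<lambda>u. f (?Q u) (residual T u w)) \<in> borel_measurable borel"
    by (rule measurable_compose_countable[OF _ Q]) (use f in measurable)
  have "set_integrable lborel {a..b} (\<lambda>u. f (?Q u) (residual T u w))"
    unfolding set_integrable_def
    by (rule integrableI_bounded_set_indicator[where B=B])
       (use bd residual_pos in \<open>auto simp: less_imp_le emeasure_lborel_Icc_eq\<close>)
  then have "(\<lambda>u. f (?Q u) (residual T u w)) integrable_on {a..b}"
    by (rule set_borel_integral_eq_integral)
  then show ?thesis
    by (rule integrable_eq) (use a in \<open>auto simp: queue_length_def\<close>)
qed

lemma arrivals_const_left:
  assumes "0 < t"
  obtains v where "0 \<le> v" "v < t" "\<And>u. v \<le> u \<Longrightarrow> u < t \<Longrightarrow> arrivals T u w = arrivals T v w"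
  using mono_nat_constant_left[of "\<lambda>u. arrivals T u w" t] arrivals_mono assms by blast

end

text \<open>A function of the queue length, discounted over the residual inter-arrival time. Between events the
  queue length is constant and the residual decreases at unit rate, so that this quantity is
  multiplied by \<open>exp (s * u)\<close> in time \<open>u\<close>; this is what turns time integrals into transforms.\<close>

definition flow :: "(nat \<Rightarrow> complex) \<Rightarrow> complex \<Rightarrow> nat \<Rightarrow> real \<Rightarrow> complex" where
  "flow \<phi> s q r = \<phi> q * exp (- (s * complex_of_real r))"

lemma norm_exp_LST_le: "0 \<le> Re s \<Longrightarrow> 0 \<le> r \<Longrightarrow> norm (exp (- (s * complex_of_real r))) \<le> 1"
  by (simp add: norm_exp_eq_Re)

lemma flow_measurable[measurable]: "flow \<phi> s q \<in> borel_measurable borel"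
  unfolding flow_def by measurable

lemma norm_flow_le: "0 \<le> Re s \<Longrightarrow> (\<And>q. norm (\<phi> q) \<le> 1) \<Longrightarrow> 0 \<le> r \<Longrightarrow> norm (flow \<phi> s q r) \<le> 1"
  unfolding flow_def norm_mult
  by (rule mult_le_one) (auto intro: norm_exp_LST_le)

lemma flow_integral:
  assumes "a \<le> b"
  shows "((\<lambda>u. s * flow \<phi> s q (c - u)) has_integral flow \<phi> s q (c - b) - flow \<phi> s q (c - a)) {a..b}"
proof (rule fundamental_theorem_of_calculus[OF assms])
  fix x
  have "((\<lambda>z. \<phi> q * exp (- (s * (complex_of_real c - z)))) has_field_derivative
      s * (\<phi> q * exp (- (s * (complex_of_real c - complex_of_real x))))) (at (complex_of_real x))"
    by (auto intro!: derivative_eq_intros)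
  then have "((\<lambda>x. \<phi> q * exp (- (s * (complex_of_real c - complex_of_real x)))) has_vector_derivative
      s * (\<phi> q * exp (- (s * (complex_of_real c - complex_of_real x))))) (at x within {a..b})"
    by (rule has_vector_derivative_real_field)
  then show "((\<lambda>u. flow \<phi> s q (c - u)) has_vector_derivative s * flow \<phi> s q (c - x)) (at x within {a..b})"
    by (simp add: flow_def)
qed

context simple_queue_path
begin

text \<open>The change of \<open>flow\<close> over \<open>[0, t]\<close> is the sum of its jumps plus the integral of its drift.
  The difference of both sides is locally constant in \<open>t\<close>, hence constant on the half-line.
  The jumps at a batch of arrivals telescope, because the inter-arrival times inside the batch
  are zero.\<close>

lemma path_balance:
  assumes s: "0 \<le> Re s" and \<phi>: "\<And>q. norm (\<phi> q) \<le> 1" and t: "0 \<le> t"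
  shows "flow \<phi> s (queue_length N0 T Dep t w) (residual T t w) - flow \<phi> s (N0 w) (T 0 w)
    = (\<Sum>j<Dep t w. flow \<phi> s (left_behind N0 T Dep j w) (residual_interarrival T Dep j w)
         - flow \<phi> s (Suc (left_behind N0 T Dep j w)) (residual_interarrival T Dep j w))
    + (\<Sum>k<arrivals T t w. flow \<phi> s (Suc (seen_by N0 T Dep k w)) (T (Suc k) w - T k w)
         - flow \<phi> s (seen_by N0 T Dep k w) 0)
    + s * integral {0..t} (\<lambda>u. flow \<phi> s (queue_length N0 T Dep u w) (residual T u w))"
proof -
  let ?\<Phi> = "flow \<phi> s" and ?Q = "\<lambda>u. queue_length N0 T Dep u w" and ?A = "\<lambda>u. arrivals T u w"
  define f where "f u = ?\<Phi> (?Q u) (residual T u w)" for u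
  define JD where "JD n = (\<Sum>j<n. ?\<Phi> (left_behind N0 T Dep j w) (residual_interarrival T Dep j w)
         - ?\<Phi> (Suc (left_behind N0 T Dep j w)) (residual_interarrival T Dep j w))" for n
  define JA where "JA n = (\<Sum>k<n. ?\<Phi> (Suc (seen_by N0 T Dep k w)) (T (Suc k) w - T k w)
         - ?\<Phi> (seen_by N0 T Dep k w) 0)" for n
  define F where "F t = f t - JD (Dep t w) - JA (?A t) - s * integral {0..t} f" for t
  have int: "f integrable_on {a..b}" if "0 \<le> a" for a b
    unfolding f_def by (rule path_integrable[where B=1]) (use s \<phi> that norm_flow_le in auto)
  have free: "s * integral {0..b} f - s * integral {0..a} f = ?\<Phi> (?Q a) (T (?A a) w - b) - f a"
    if ab: "0 \<le> a" "a \<le> b" and D: "\<And>u. a \<le> u \<Longrightarrow> u < b \<Longrightarrow> Dep u w = Dep a w"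
      and A: "\<And>u. a \<le> u \<Longrightarrow> u < b \<Longrightarrow> ?A u = ?A a" for a b
  proof -
    have comb: "integral {0..a} f + integral {a..b} f = integral {0..b} f"
      by (rule Henstock_Kurzweil_Integration.integral_combine) (use ab int in auto)
    have "s * integral {a..b} f = integral {a..b} (\<lambda>u. s * f u)"
      by simp
    also have "\<dots> = integral {a..b} (\<lambda>u. s * ?\<Phi> (?Q a) (T (?A a) w - u))"
    proof (rule integral_spike[where S="{b}"])
      fix u assume u: "u \<in> {a..b} - {b}"
      then have "Dep u w = Dep a w" "?A u = ?A a" using D[of u] A[of u] by auto
      then show "s * ?\<Phi> (?Q a) (T (?A a) w - u) = s * f u"
        by (simp add: f_def residual_def queue_length_def)
    qed simp
    also have "\<dots> = ?\<Phi> (?Q a) (T (?A a) w - b) - ?\<Phi> (?Q a) (T (?A a) w - a)"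
      by (rule integral_unique[OF flow_integral[OF ab(2)]])
    also have "\<dots> = ?\<Phi> (?Q a) (T (?A a) w - b) - f a"
      by (simp add: f_def residual_def)
    finally show ?thesis
      unfolding comb[symmetric] distrib_left by simp
  qed
  have batch: "JA (?A u) - JA m = f u - ?\<Phi> (N0 w + m - Dep u w) (T m w - u)"
    if "0 \<le> u" and m: "m \<le> ?A u" and Tm: "\<And>k. m \<le> k \<Longrightarrow> k < ?A u \<Longrightarrow> T k w = u"
      and D: "Dep u w \<le> N0 w + m" for u m
  proof -
    \<comment> \<open>The state when \<open>k\<close> customers have arrived; its residual is the time until the next one arrives.\<close>
    define e where "e k = ?\<Phi> (N0 w + k - Dep u w) (T k w - u)" for k
    have "JA (?A u) - JA m = (\<Sum>k\<in>{m..<?A u}. ?\<Phi> (Suc (seen_by N0 T Dep k w)) (T (Suc k) w - T k w)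
         - ?\<Phi> (seen_by N0 T Dep k w) 0)"
      unfolding JA_def using sum_diff_nat_ivl[of 0 m "?A u"] m by (simp add: lessThan_atLeast0)
    also have "\<dots> = (\<Sum>k\<in>{m..<?A u}. e (Suc k) - e k)"
    proof (rule sum.cong[OF refl])
      fix k assume "k \<in> {m..<?A u}"
      then have k: "m \<le> k" "k < ?A u" by auto
      then have "T k w = u" by (rule Tm)
      then show "?\<Phi> (Suc (seen_by N0 T Dep k w)) (T (Suc k) w - T k w) - ?\<Phi> (seen_by N0 T Dep k w) 0 = e (Suc k) - e k"
        using D k by (simp add: e_def seen_by_def Suc_diff_le)
    qed
    also have "\<dots> = e (?A u) - e m"
      by (rule sum_Suc_diff'[OF m])
    finally show ?thesis
      by (simp add: e_def f_def queue_length_def residual_def)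
  qed
  have right: "\<exists>v>t. \<forall>u\<in>{t..<v}. F u = F t" if t: "0 \<le> t" for t
  proof -
    obtain v where v: "t < v" "\<And>u. t \<le> u \<Longrightarrow> u < v \<Longrightarrow> Dep u w = Dep t w"
      using D_const_right[OF t] by metis
    let ?v = "min v (T (?A t) w)"
    have "F u = F t" if u: "u \<in> {t..<?v}" for u
    proof -
      have D: "Dep x w = Dep t w" if "t \<le> x" "x \<le> u" for x
        using v(2)[of x] that u by auto
      have A: "?A x = ?A t" if "t \<le> x" "x \<le> u" for x
        using arrivals_eq_between[of t x] that u by auto
      have "f u = ?\<Phi> (?Q t) (T (?A t) w - u)"
        using D[of u] A[of u] u by (simp add: f_def queue_length_def residual_def)
      moreover have "s * integral {0..u} f - s * integral {0..t} f = ?\<Phi> (?Q t) (T (?A t) w - u) - f t"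
        by (rule free) (use u t in \<open>auto intro!: D A\<close>)
      ultimately show ?thesis
        using D[of u] A[of u] u unfolding F_def by (simp add: algebra_simps)
    qed
    moreover have "t < ?v" using v(1) residual_pos[of t] by (simp add: residual_def)
    ultimately show ?thesis by blast
  qed
  have left: "\<exists>v<t. 0 \<le> v \<and> (\<forall>u\<in>{v..<t}. F u = F t)" if t: "0 < t" for t
  proof -
    obtain v1 where v1: "0 \<le> v1" "v1 < t" "\<And>u. v1 \<le> u \<Longrightarrow> u < t \<Longrightarrow> Dep u w = Dep v1 w"
      using D_const_left[OF t] by metis
    obtain v2 where v2: "0 \<le> v2" "v2 < t" "\<And>u. v2 \<le> u \<Longrightarrow> u < t \<Longrightarrow> ?A u = ?A v2"
      using arrivals_const_left[OF t] by metis
    let ?v = "max v1 v2"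
    have "F u = F t" if u: "u \<in> {?v..<t}" for u
    proof -
      have u0: "0 \<le> u" "u < t" using u v1 by auto
      have D: "Dep x w = Dep u w" if "u \<le> x" "x < t" for x
        using v1(3)[of x] v1(3)[of u] that u by auto
      have A: "?A x = ?A u" if "u \<le> x" "x < t" for x
        using v2(3)[of x] v2(3)[of u] that u by auto
      let ?P = "?\<Phi> (?Q u) (T (?A u) w - t)"
      have P: "s * integral {0..t} f - s * integral {0..u} f = ?P - f u"
        by (rule free) (use u0 in \<open>auto intro!: D A\<close>)
      have "f t - ?P = (JD (Dep t w) - JD (Dep u w)) + (JA (?A t) - JA (?A u))"
      proof (cases "?A t = ?A u")
        case A_eq: True
        show ?thesis
        proof (cases "Dep t w = Dep u w")
          case True
          then show ?thesis using A_eq by (simp add: f_def queue_length_def residual_def)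
        next
          case False
          have Dt: "Dep t w = Suc (Dep u w)" and ep: "departure_epoch Dep (Dep u w) w = t"
            using one_departure_left[OF u0 D False] by auto
          have "JD (Dep t w) - JD (Dep u w) = ?\<Phi> (?Q t) (residual T t w) - ?\<Phi> (Suc (?Q t)) (residual T t w)"
            using residual_interarrival_eq[of "Dep u w" t] Dt t
            by (simp add: JD_def ep left_behind_def)
          moreover have "Suc (?Q t) = ?Q u"
            using D_le[of t] t Dt A_eq by (simp add: queue_length_def)
          ultimately show ?thesis
            using A_eq by (simp add: f_def residual_def)
        qed
      next
        case False
        then have lt: "?A u < ?A t" using arrivals_mono[of u t] u0 by simp
        have Tk: "T k w = t" if k: "?A u \<le> k" "k < ?A t" for k
        proof (rule antisym)
          show "T k w \<le> t" using k T_le_iff by simp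
          show "t \<le> T k w"
          proof (rule ccontr)
            assume neg: "\<not> t \<le> T k w"
            have "u < T k w" using k less_T_iff by simp
            then have "?A (T k w) = ?A u" by (intro A) (use neg in auto)
            then show False using T_le_iff[of k "T k w"] k by simp
          qed
        qed
        then have tA: "T (?A u) w = t" using lt by simp
        have DA: "Dep t w = Dep u w"
        proof -
          obtain v where v: "v < t" "\<And>x. v \<le> x \<Longrightarrow> x \<le> t \<Longrightarrow> Dep x w = Dep v w"
            using D_arrival_left[of "?A u"] t unfolding tA by metis
          show ?thesis
            using D[of "max u v"] v(2)[of "max u v"] v(2)[of t] v(1) u0 by simp
        qed
        have "JA (?A t) - JA (?A u) = f t - ?\<Phi> (N0 w + ?A u - Dep t w) (T (?A u) w - t)"
          by (rule batch) (use t lt DA D_le[of u] u0 in \<open>auto intro!: Tk\<close>)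
        then show ?thesis
          using DA by (simp add: queue_length_def)
      qed
      then show ?thesis
        using P unfolding F_def by algebra
    qed
    moreover have "?v < t" "0 \<le> ?v" using v1 v2 by auto
    ultimately show ?thesis by blast
  qed
  have "F constant_on {0..}"
  proof (rule locally_constant_imp_constant)
    fix a :: real assume a: "a \<in> {0..}"
    obtain v where v: "v > a" "\<forall>u\<in>{a..<v}. F u = F a" using right[of a] a by auto
    obtain v' where v': "v' < a" "\<forall>u\<in>{v'..<a}. 0 \<le> u \<longrightarrow> F u = F a"
    proof (cases "a = 0")
      case True then show ?thesis using that[of "-1"] by auto
    next
      case False
      then show ?thesis using left[of a] a that by auto
    qed
    have near: "F u = F a" if "0 \<le> u" "v' < u" "u < v" for u
    proof (cases "u < a")
      case True
      then show ?thesis using v'(2) that by (intro v'(2)[rule_format]) auto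
    next
      case False
      then show ?thesis using that by (intro v(2)[rule_format]) auto
    qed
    show "\<exists>S. openin (top_of_set {0..}) S \<and> a \<in> S \<and> (\<forall>x\<in>S. F x = F a)"
    proof (intro exI conjI ballI)
      show "openin (top_of_set {0..}) ({0..} \<inter> {v'<..<v})" by (rule openin_open_Int) simp
      show "a \<in> {0..} \<inter> {v'<..<v}" using v(1) v'(1) a by simp
      show "F x = F a" if "x \<in> {0..} \<inter> {v'<..<v}" for x
        by (rule near) (use that in auto)
    qed
  qed (simp add: convex_connected)
  then have "F t = F 0"
    using t unfolding constant_on_def by (metis atLeast_iff order_refl)
  moreover have "F 0 = ?\<Phi> (N0 w) (T 0 w)"
  proof -
    have "JA (?A 0) - JA 0 = f 0 - ?\<Phi> (N0 w + 0 - Dep 0 w) (T 0 w - 0)"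
      by (rule batch) (use T_le_iff[of _ 0] T_nonneg D_0 in \<open>auto intro: antisym\<close>)
    then show ?thesis
      by (simp add: F_def D_0 JD_def JA_def)
  qed
  moreover have "integral {0..t} f = integral {0..t} (\<lambda>u. ?\<Phi> (?Q u) (residual T u w))"
    by (rule arg_cong[where f="integral _"]) (simp add: f_def fun_eq_iff)
  moreover have "f t = ?\<Phi> (?Q t) (residual T t w)"
    by (simp add: f_def)
  ultimately show ?thesis
    unfolding F_def JD_def[of "Dep t w"] JA_def[of "?A t"] by (simp only: diff_eq_eq add.commute add.assoc add.left_commute)
qed

end

text \<open>Three ways of sampling the state \<open>n\<close> up to time \<open>t\<close>: at the departures leaving \<open>n\<close> behind, at
  the arrivals finding \<open>n\<close> customers, and over time. The function \<open>g\<close> is evaluated at the time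
  that then remains until the next arrival.\<close>

definition departure_sum ::
  "('w \<Rightarrow> nat) \<Rightarrow> (nat \<Rightarrow> 'w \<Rightarrow> real) \<Rightarrow> (real \<Rightarrow> 'w \<Rightarrow> nat) \<Rightarrow> nat \<Rightarrow> (real \<Rightarrow> 'a::comm_monoid_add) \<Rightarrow> real \<Rightarrow> 'w \<Rightarrow> 'a" where
  "departure_sum N0 T Dep n g t w =
     (\<Sum>j<Dep t w. if left_behind N0 T Dep j w = n then g (residual_interarrival T Dep j w) else 0)"

definition arrival_sum ::
  "('w \<Rightarrow> nat) \<Rightarrow> (nat \<Rightarrow> 'w \<Rightarrow> real) \<Rightarrow> (real \<Rightarrow> 'w \<Rightarrow> nat) \<Rightarrow> nat \<Rightarrow> (real \<Rightarrow> 'a::comm_monoid_add) \<Rightarrow> real \<Rightarrow> 'w \<Rightarrow> 'a" where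
  "arrival_sum N0 T Dep n g t w =
     (\<Sum>k<arrivals T t w. if seen_by N0 T Dep k w = n then g (T (Suc k) w - T k w) else 0)"

definition state_integral ::
  "('w \<Rightarrow> nat) \<Rightarrow> (nat \<Rightarrow> 'w \<Rightarrow> real) \<Rightarrow> (real \<Rightarrow> 'w \<Rightarrow> nat) \<Rightarrow> nat \<Rightarrow> (real \<Rightarrow> 'a::real_normed_vector) \<Rightarrow> real \<Rightarrow> 'w \<Rightarrow> 'a" where
  "state_integral N0 T Dep n g t w =
     integral {0..t} (\<lambda>u. if queue_length N0 T Dep u w = n then g (residual T u w) else 0)"

abbreviation discount :: "complex \<Rightarrow> real \<Rightarrow> complex" where
  "discount s \<equiv> \<lambda>r. exp (- (s * complex_of_real r))"

context simple_queue_path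
begin

lemma boundary_bound:
  assumes "0 \<le> Re s" "\<And>q. norm (\<phi> q) \<le> 1"
  shows "norm (flow \<phi> s q (residual T t w) - flow \<phi> s q' (T 0 w)) \<le> 2"
  using norm_triangle_ineq4[of "flow \<phi> s q (residual T t w)" "flow \<phi> s q' (T 0 w)"]
    norm_flow_le[OF assms(1), of \<phi> "residual T t w" q] norm_flow_le[OF assms(1), of \<phi> "T 0 w" q']
    assms(2) residual_pos[of t] T_nonneg0 by simp

text \<open>\<open>path_balance\<close> without discounting for the indicator of more than \<open>n\<close> customers: up-crossings
  and down-crossings of a level alternate.\<close>

lemma level_crossing:
  assumes t: "0 \<le> t"
  shows "norm (arrival_sum N0 T Dep n (\<lambda>_. 1::complex) t w - departure_sum N0 T Dep n (\<lambda>_. 1) t w) \<le> 1"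
proof -
  let ?\<phi> = "\<lambda>q. of_bool (n < q) :: complex"
  have D: "(\<Sum>j<Dep t w. flow ?\<phi> 0 (left_behind N0 T Dep j w) (residual_interarrival T Dep j w)
         - flow ?\<phi> 0 (Suc (left_behind N0 T Dep j w)) (residual_interarrival T Dep j w))
      = - departure_sum N0 T Dep n (\<lambda>_. 1) t w"
    unfolding departure_sum_def sum_negf[symmetric] by (rule sum.cong) (auto simp: flow_def)
  have A: "(\<Sum>k<arrivals T t w. flow ?\<phi> 0 (Suc (seen_by N0 T Dep k w)) (T (Suc k) w - T k w)
         - flow ?\<phi> 0 (seen_by N0 T Dep k w) 0)
      = arrival_sum N0 T Dep n (\<lambda>_. 1) t w"
    unfolding arrival_sum_def by (rule sum.cong) (auto simp: flow_def)
  have "flow ?\<phi> 0 (queue_length N0 T Dep t w) (residual T t w) - flow ?\<phi> 0 (N0 w) (T 0 w)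
      = arrival_sum N0 T Dep n (\<lambda>_. 1) t w - departure_sum N0 T Dep n (\<lambda>_. 1) t w"
    using path_balance[of 0 ?\<phi> t] t unfolding A D by simp
  then show ?thesis
    by (auto simp: flow_def of_bool_def split: if_splits) (metis norm_minus_commute norm_one norm_zero diff_self zero_le_one diff_0 norm_minus_cancel order_refl)+
qed

text \<open>\<open>path_balance\<close> for the indicator of the state \<open>n + 1\<close>. The state is entered by departures
  leaving \<open>n + 1\<close> and by arrivals finding \<open>n\<close>; it is left by departures leaving \<open>n\<close> and by
  arrivals finding \<open>n + 1\<close>, at which the residual time is zero and the discount is one.\<close>

lemma state_balance:
  assumes s: "0 \<le> Re s" and t: "0 \<le> t"
  shows "norm (s * state_integral N0 T Dep (Suc n) (discount s) t w
      - (departure_sum N0 T Dep n (discount s) t w + arrival_sum N0 T Dep (Suc n) (\<lambda>_. 1) t w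
         - arrival_sum N0 T Dep n (discount s) t w - departure_sum N0 T Dep (Suc n) (discount s) t w)) \<le> 2"
    (is "norm (?I - ?R) \<le> _")
proof -
  let ?\<phi> = "\<lambda>q. of_bool (q = Suc n) :: complex"
  have I: "integral {0..t} (\<lambda>u. flow ?\<phi> s (queue_length N0 T Dep u w) (residual T u w))
      = state_integral N0 T Dep (Suc n) (discount s) t w"
    unfolding state_integral_def by (rule arg_cong[where f="integral _"]) (auto simp: flow_def)
  have D: "(\<Sum>j<Dep t w. flow ?\<phi> s (left_behind N0 T Dep j w) (residual_interarrival T Dep j w)
         - flow ?\<phi> s (Suc (left_behind N0 T Dep j w)) (residual_interarrival T Dep j w))
      = departure_sum N0 T Dep (Suc n) (discount s) t w - departure_sum N0 T Dep n (discount s) t w"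
    unfolding departure_sum_def sum_subtractf[symmetric] by (rule sum.cong) (auto simp: flow_def)
  have A: "(\<Sum>k<arrivals T t w. flow ?\<phi> s (Suc (seen_by N0 T Dep k w)) (T (Suc k) w - T k w)
         - flow ?\<phi> s (seen_by N0 T Dep k w) 0)
      = arrival_sum N0 T Dep n (discount s) t w - arrival_sum N0 T Dep (Suc n) (\<lambda>_. 1) t w"
    unfolding arrival_sum_def sum_subtractf[symmetric] by (rule sum.cong) (auto simp: flow_def)
  have "?I - ?R = flow ?\<phi> s (queue_length N0 T Dep t w) (residual T t w) - flow ?\<phi> s (N0 w) (T 0 w)"
    using path_balance[of s ?\<phi> t] s t unfolding I D A by simp
  then show ?thesis
    using boundary_bound[OF s, of ?\<phi>] by (simp add: of_bool_def)
qed

lemma empty_balance: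
  assumes s: "0 \<le> Re s" and t: "0 \<le> t"
  shows "norm (s * state_integral N0 T Dep 0 (discount s) t w
      - (arrival_sum N0 T Dep 0 (\<lambda>_. 1) t w - departure_sum N0 T Dep 0 (discount s) t w)) \<le> 2"
    (is "norm (?I - ?R) \<le> _")
proof -
  let ?\<phi> = "\<lambda>q. of_bool (q = 0) :: complex"
  have I: "integral {0..t} (\<lambda>u. flow ?\<phi> s (queue_length N0 T Dep u w) (residual T u w))
      = state_integral N0 T Dep 0 (discount s) t w"
    unfolding state_integral_def by (rule arg_cong[where f="integral _"]) (auto simp: flow_def)
  have D: "(\<Sum>j<Dep t w. flow ?\<phi> s (left_behind N0 T Dep j w) (residual_interarrival T Dep j w)
         - flow ?\<phi> s (Suc (left_behind N0 T Dep j w)) (residual_interarrival T Dep j w))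
      = departure_sum N0 T Dep 0 (discount s) t w"
    unfolding departure_sum_def by (rule sum.cong) (auto simp: flow_def)
  have A: "(\<Sum>k<arrivals T t w. flow ?\<phi> s (Suc (seen_by N0 T Dep k w)) (T (Suc k) w - T k w)
         - flow ?\<phi> s (seen_by N0 T Dep k w) 0)
      = - arrival_sum N0 T Dep 0 (\<lambda>_. 1) t w"
    unfolding arrival_sum_def sum_negf[symmetric] by (rule sum.cong) (auto simp: flow_def)
  have "?I - ?R = flow ?\<phi> s (queue_length N0 T Dep t w) (residual T t w) - flow ?\<phi> s (N0 w) (T 0 w)"
    using path_balance[of s ?\<phi> t] s t unfolding I D A by simp
  then show ?thesis
    using boundary_bound[OF s, of ?\<phi>] by (simp add: of_bool_def)
qed

text \<open>\<open>path_balance\<close> for the constant function: the arrival stream alone.\<close>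

lemma renewal_balance:
  assumes s: "0 \<le> Re s" and t: "0 \<le> t"
  shows "norm (s * integral {0..t} (\<lambda>u. discount s (residual T u w))
      - (\<Sum>k<arrivals T t w. 1 - discount s (T (Suc k) w - T k w))) \<le> 2"
    (is "norm (?I - ?R) \<le> _")
proof -
  let ?\<phi> = "\<lambda>q::nat. 1 :: complex"
  have "?I - ?R = flow ?\<phi> s (queue_length N0 T Dep t w) (residual T t w) - flow ?\<phi> s (N0 w) (T 0 w)"
    using path_balance[of s ?\<phi> t] s t by (simp add: flow_def sum_subtractf)
  then show ?thesis
    using boundary_bound[OF s, of ?\<phi>] by (simp add: of_bool_def)
qed

end

section \<open>Approximation on time grids\<close>

text \<open>The windows to which the service rates apply.\<close>

definition quiet :: "(nat \<Rightarrow> 'w \<Rightarrow> real) \<Rightarrow> real \<Rightarrow> real \<Rightarrow> 'w \<Rightarrow> bool" where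
  "quiet T t h w \<longleftrightarrow> (\<forall>k. \<not> (t < T k w \<and> T k w \<le> t + h))"

lemma grid_Suc: "real (Suc i) / real R = real i / real R + 1 / real R"
  by (simp add: add_divide_distrib add.commute)

context queue_path
begin

lemma quiet_iff: "0 \<le> h \<Longrightarrow> quiet T t h w \<longleftrightarrow> arrivals T (t + h) w = arrivals T t w"
  unfolding quiet_def T_le_iff less_T_iff using arrivals_mono[of t "t + h"]
  by (auto simp: not_less)

text \<open>The number \<open>n\<close> in the conclusion is the queue length just before the double departure. There is
  no event shortly before it and no arrival shortly after it, so on every fine grid the window
  containing it is quiet, starts with \<open>n\<close> customers, and contains at least two departures. Such
  windows are seen by the service rates.\<close>

lemma double_jump_windows:
  assumes t: "0 \<le> t" "Suc (Suc j) \<le> Dep t w"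
    and double: "\<not> departure_epoch Dep j w < departure_epoch Dep (Suc j) w"
  shows "\<exists>n\<ge>1. \<exists>m::nat. \<exists>R0. \<forall>R\<ge>R0. \<exists>i<m * R. quiet T (real i / real R) (1 / real R) w
    \<and> queue_length N0 T Dep (real i / real R) w = n
    \<and> 2 \<le> Dep (real (Suc i) / real R) w - Dep (real i / real R) w"
proof -
  let ?d = "departure_epoch Dep j w"
  have j: "Suc j \<le> Dep t w" using t by simp
  have d0: "0 < ?d" using epoch_pos[OF j t(1)] .
  have Dd: "Suc (Suc j) \<le> Dep ?d w"
    using epoch_reached[OF t(2,1)] D_mono[of "departure_epoch Dep (Suc j) w" ?d] epoch_pos[OF t(2,1)] double
    by linarith
  have Dbelow: "Dep u w \<le> j" if "0 \<le> u" "u < ?d" for u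
    using epoch_le_iff[OF that(1) j t(1)] that(2) by simp
  obtain v1 where v1: "0 \<le> v1" "v1 < ?d" "\<And>u. v1 \<le> u \<Longrightarrow> u < ?d \<Longrightarrow> Dep u w = Dep v1 w"
    using D_const_left[OF d0] by metis
  obtain v2 where v2: "0 \<le> v2" "v2 < ?d" "\<And>u. v2 \<le> u \<Longrightarrow> u < ?d \<Longrightarrow> arrivals T u w = arrivals T v2 w"
    using arrivals_const_left[OF d0] by metis
  have A2: "arrivals T ?d w = arrivals T v2 w"
  proof (rule ccontr)
    assume "\<not> ?thesis"
    then have lt: "arrivals T v2 w < arrivals T ?d w"
      using arrivals_mono[of v2 ?d] v2(1,2) by simp
    let ?k = "arrivals T v2 w"
    have "T ?k w \<le> ?d" using lt T_le_iff by simp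
    moreover have "T ?k w \<noteq> ?d" using epoch_not_arrival[OF j t(1)] .
    moreover have "v2 \<le> T ?k w" using less_T_iff[of v2 ?k] by simp
    ultimately have "arrivals T (T ?k w) w = ?k"
      by (intro v2(3)) auto
    then show False
      using T_le_iff[of ?k "T ?k w"] by simp
  qed
  define v where "v = max v1 v2"
  have v: "0 \<le> v" "v < ?d" using v1(1,2) v2(1,2) by (auto simp: v_def)
  have Dv: "Dep u w = Dep v w" if "v \<le> u" "u < ?d" for u
    by (rule trans[OF v1(3) v1(3)[symmetric]]) (use that v in \<open>auto simp: v_def\<close>)
  have Av: "arrivals T u w = arrivals T ?d w" if "v \<le> u" "u < ?d" for u
    unfolding A2 by (rule v2(3)) (use that in \<open>auto simp: v_def\<close>)
  define n where "n = queue_length N0 T Dep v w"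
  have n1: "1 \<le> n"
    using D_le[of ?d] Dbelow[OF v] Dd d0 Av[OF order_refl v(2)] unfolding n_def queue_length_def by simp
  define \<tau> where "\<tau> = T (arrivals T ?d w) w"
  have \<tau>: "?d < \<tau>" unfolding \<tau>_def less_T_iff by simp
  define e where "e = min (?d - v) (\<tau> - ?d)"
  have e: "0 < e" using v \<tau> by (simp add: e_def)
  obtain R0 :: nat where R0: "1 / e < real R0" using reals_Archimedean2 by blast
  have "\<exists>i<nat \<lceil>?d\<rceil> * R. quiet T (real i / real R) (1 / real R) w
    \<and> queue_length N0 T Dep (real i / real R) w = n
    \<and> 2 \<le> Dep (real (Suc i) / real R) w - Dep (real i / real R) w" if "R0 \<le> R" for R
  proof -
    have "0 < 1 / e" using e by simp
    then have Rpos: "0 < real R" and "1 / e < real R" using R0 that by linarith+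
    then have Re: "1 / real R < e" using e by (simp add: field_simps)
    have dR: "0 < ?d * R" using d0 Rpos by simp
    define i where "i = nat \<lceil>?d * R\<rceil> - 1"
    have "0 < \<lceil>?d * R\<rceil>" using dR by simp
    then have i_eq: "real i = of_int \<lceil>?d * R\<rceil> - 1" unfolding i_def by linarith
    then have i1: "real i < ?d * R" "?d * R \<le> real i + 1" by linarith+
    then have w1: "real i / R < ?d" "?d \<le> real (Suc i) / R" using Rpos by (auto simp: field_simps)
    have low: "v \<le> real i / R" and up: "real (Suc i) / R < \<tau>"
      using w1 Re unfolding grid_Suc e_def by linarith+
    have Aup: "arrivals T (real (Suc i) / R) w = arrivals T ?d w"
      by (rule arrivals_eq_between) (use w1 up in \<open>auto simp: \<tau>_def\<close>)
    have "real i < real (nat \<lceil>?d\<rceil>) * real R"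
      using i1(1) mult_right_mono[of ?d "real (nat \<lceil>?d\<rceil>)" "real R"] Rpos by linarith
    then have "real i < real (nat \<lceil>?d\<rceil> * R)" unfolding of_nat_mult .
    then have "i < nat \<lceil>?d\<rceil> * R" by (rule of_nat_less_imp_less)
    moreover have "quiet T (real i / R) (1 / R) w"
      using quiet_iff[of "1 / R" "real i / R"] Aup Av[OF low w1(1)] Rpos unfolding grid_Suc by simp
    moreover have "queue_length N0 T Dep (real i / R) w = n"
      using Av[OF low w1(1)] Av[OF order_refl v(2)] Dv[OF low w1(1)] by (simp add: n_def queue_length_def)
    moreover have "2 \<le> Dep (real (Suc i) / R) w - Dep (real i / R) w"
      using D_mono[OF less_imp_le[OF d0] w1(2)] Dd Dbelow[of "real i / R"] w1(1) Rpos by simp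
    ultimately show ?thesis by blast
  qed
  then show ?thesis using n1 by blast
qed

text \<open>A left Riemann sum for \<open>state_integral\<close>. A window without events contributes at most the
  oscillation of \<open>g\<close>; a window with an event may contribute its whole length, and the number of
  these is bounded by the number of events.\<close>

lemma riemann_state:
  fixes g :: "real \<Rightarrow> real"
  assumes g[measurable]: "g \<in> borel_measurable borel" and bd: "\<And>r. 0 \<le> r \<Longrightarrow> \<bar>g r\<bar> \<le> 1"
    and lip: "\<And>x y. 0 \<le> x \<Longrightarrow> 0 \<le> y \<Longrightarrow> \<bar>g x - g y\<bar> \<le> L * \<bar>x - y\<bar>" and R: "0 < R"
  shows "\<bar>state_integral N0 T Dep n g (real i / real R) w
    - (\<Sum>j<i. if quiet T (real j / real R) (1 / real R) w \<and> queue_length N0 T Dep (real j / real R) w = n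
               then g (residual T (real j / real R) w) else 0) / real R\<bar>
    \<le> real i * L / (real R)\<^sup>2 + 2 / real R * (real (Dep (real i / real R) w) + real (arrivals T (real i / real R) w))"
proof (induction i)
  case 0
  then show ?case by (simp add: state_integral_def)
next
  case (Suc i)
  let ?a = "real i / real R" and ?b = "real (Suc i) / real R"
  let ?f = "\<lambda>u. if queue_length N0 T Dep u w = n then g (residual T u w) else 0"
  let ?S = "\<lambda>i. \<Sum>j<i. if quiet T (real j / real R) (1 / real R) w \<and> queue_length N0 T Dep (real j / real R) w = n
               then g (residual T (real j / real R) w) else 0"
  let ?x = "if quiet T ?a (1 / real R) w \<and> queue_length N0 T Dep ?a w = n then g (residual T ?a w) else 0"
  let ?I = "integral {?a..?b} ?f"
  have ab: "0 \<le> ?a" "?a \<le> ?b" by (auto simp: divide_right_mono)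
  have len: "?b - ?a = 1 / real R" unfolding grid_Suc by simp
  have L0: "0 \<le> L" using lip[of 0 1] by simp
  have int: "?f integrable_on {c..d}" if "0 \<le> c" for c d
    by (rule path_integrable[where f="\<lambda>q r. if q = n then g r else 0" and B=1]) (use bd that in auto)
  have comb: "state_integral N0 T Dep n g ?b w = state_integral N0 T Dep n g ?a w + ?I"
    unfolding state_integral_def
    by (rule Henstock_Kurzweil_Integration.integral_combine[symmetric]) (use ab int in auto)
  have fbd: "\<bar>?f u\<bar> \<le> 1" for u using bd residual_pos[of u] by simp
  have D: "Dep ?a w \<le> Dep ?b w" using D_mono ab by simp
  have A: "arrivals T ?a w \<le> arrivals T ?b w" using arrivals_mono ab by simp
  have step: "\<bar>?I - ?x / real R\<bar> \<le> L / (real R)\<^sup>2 + 2 / real R * (real (Dep ?b w) - real (Dep ?a w) + (real (arrivals T ?b w) - real (arrivals T ?a w)))"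
  proof (cases "Dep ?b w = Dep ?a w \<and> arrivals T ?b w = arrivals T ?a w")
    case True
    have qt: "quiet T ?a (1 / real R) w"
      using quiet_iff[of "1 / real R" ?a] True unfolding grid_Suc by simp
    have near: "norm (?f u - ?x) \<le> L / real R" if u: "u \<in> cbox ?a ?b" for u
    proof -
      have u': "?a \<le> u" "u \<le> ?b" using u by auto
      have Du: "Dep u w = Dep ?a w"
        using D_mono[OF ab(1) u'(1)] D_mono[OF order_trans[OF ab(1) u'(1)] u'(2)] True by linarith
      have Au: "arrivals T u w = arrivals T ?a w" using arrivals_mono[of ?a u] arrivals_mono[of u ?b] u True by simp
      have "\<bar>g (residual T u w) - g (residual T ?a w)\<bar> \<le> L * \<bar>residual T u w - residual T ?a w\<bar>"
        by (rule lip) (use residual_pos in \<open>auto intro: less_imp_le\<close>)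
      also have "\<dots> \<le> L * (1 / real R)"
        by (rule mult_left_mono[OF _ L0]) (use u Au len in \<open>auto simp: residual_def\<close>)
      finally show ?thesis using Du Au qt L0 R by (auto simp: queue_length_def)
    qed
    have "?I - ?x / real R = integral (cbox ?a ?b) (\<lambda>u. ?f u - ?x)"
      using int[OF ab(1)] ab(2) len by (subst integral_diff) (auto simp: content_real)
    also have "norm \<dots> \<le> L / real R * measure lborel (cbox ?a ?b)"
      by (rule has_integral_bound[OF _ integrable_integral near])
         (use L0 int[OF ab(1)] in \<open>auto intro!: Henstock_Kurzweil_Integration.integrable_diff\<close>)
    finally show ?thesis
      using True ab len by (simp add: content_real power2_eq_square)
  next
    case False
    then have one: "1 \<le> real (Dep ?b w) - real (Dep ?a w) + (real (arrivals T ?b w) - real (arrivals T ?a w))"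
      using D A by linarith
    have "norm (integral (cbox ?a ?b) ?f) \<le> 1 * measure lborel (cbox ?a ?b)"
      by (rule has_integral_bound[OF _ integrable_integral]) (use fbd int[OF ab(1)] in auto)
    then have I1: "\<bar>?I\<bar> \<le> 1 / real R" using len ab by (simp add: content_real)
    have "\<bar>?x\<bar> \<le> 1" using bd residual_pos[of ?a] by simp
    then have "\<bar>?x / real R\<bar> \<le> 1 / real R" using R by (simp add: field_simps)
    then have "\<bar>?I - ?x / real R\<bar> \<le> 2 / real R * 1" using I1 by linarith
    also have "\<dots> \<le> 2 / real R * (real (Dep ?b w) - real (Dep ?a w) + (real (arrivals T ?b w) - real (arrivals T ?a w)))"
      by (rule mult_left_mono[OF one]) simp
    also have "\<dots> \<le> L / (real R)\<^sup>2 + \<dots>" using L0 by simp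
    finally show ?thesis .
  qed
  have "?S (Suc i) / real R = ?S i / real R + ?x / real R"
    by (simp add: add_divide_distrib)
  moreover have "real (Suc i) * L / (real R)\<^sup>2 = real i * L / (real R)\<^sup>2 + L / (real R)\<^sup>2"
    by (simp add: distrib_right add_divide_distrib)
  moreover have "2 / real R * (real (Dep ?b w) + real (arrivals T ?b w)) =
      2 / real R * (real (Dep ?a w) + real (arrivals T ?a w)) +
      2 / real R * (real (Dep ?b w) - real (Dep ?a w) + (real (arrivals T ?b w) - real (arrivals T ?a w)))"
    by (simp add: distrib_left[symmetric] algebra_simps)
  ultimately show ?case
    using Suc step comb by linarith
qed

end

context simple_queue_path
begin

text \<open>Finitely many events, at distinct times, have a positive minimal distance.\<close>

lemma fine_grid:
  obtains R0 where "0 < R0" "\<And>R i. R0 \<le> R \<Longrightarrow> i < m * R \<Longrightarrow>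
    Dep (real (Suc i) / real R) w = Dep (real i / real R) w \<or>
    Dep (real (Suc i) / real R) w = Suc (Dep (real i / real R) w) \<and> quiet T (real i / real R) (1 / real R) w"
proof -
  let ?t = "real m" and ?d = "\<lambda>j. departure_epoch Dep j w"
  let ?P = "(\<lambda>j. ?d (Suc j) - ?d j) ` {j. Suc (Suc j) \<le> Dep ?t w}"
  let ?P' = "(\<lambda>(k, j). \<bar>T k w - ?d j\<bar>) ` ({..<arrivals T ?t w} \<times> {..<Dep ?t w})"
  have "{j. Suc (Suc j) \<le> Dep ?t w} \<subseteq> {..<Dep ?t w}" by auto
  then have "finite {j. Suc (Suc j) \<le> Dep ?t w}" by (rule finite_subset) simp
  then have fin: "finite (insert 1 (?P \<union> ?P'))" by simp
  define e where "e = Min (insert 1 (?P \<union> ?P'))"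
  have "\<forall>x\<in>insert 1 (?P \<union> ?P'). 0 < x"
    using unit_jumps[of ?t] epoch_not_arrival[of _ ?t] by auto
  then have e0: "0 < e" unfolding e_def using fin by (subst Min_gr_iff) auto
  have e1: "e \<le> ?d (Suc j) - ?d j" if "Suc (Suc j) \<le> Dep ?t w" for j
    unfolding e_def by (rule Min_le[OF fin]) (use that in blast)
  have e2: "e \<le> \<bar>T k w - ?d j\<bar>" if "k < arrivals T ?t w" "j < Dep ?t w" for k j
    unfolding e_def by (rule Min_le[OF fin]) (use that in force)
  obtain R0 :: nat where R0: "1 / e < real R0" using reals_Archimedean2 by blast
  have "0 < 1 / e" using e0 by simp
  then have R0pos: "0 < R0" using R0 by (metis of_nat_0_less_iff order_less_trans)
  show ?thesis
  proof (rule that[OF R0pos])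
    fix R i assume R: "R0 \<le> R" and i: "i < m * R"
    have Rpos: "0 < real R" using R R0pos by simp
    have "1 / e < real R" using R R0 by linarith
    then have Re: "1 / real R < e" using e0 Rpos by (simp add: field_simps)
    let ?a = "real i / real R" and ?b = "real (Suc i) / real R"
    have "real (Suc i) \<le> real (m * R)" using i by linarith
    then have bt: "?b \<le> ?t" using Rpos by (simp add: field_simps)
    have ab: "0 \<le> ?a" "?a \<le> ?b" "0 \<le> ?b" by (auto simp: divide_right_mono)
    have len: "?b - ?a = 1 / real R" unfolding grid_Suc by simp
    let ?j = "Dep ?a w"
    have D: "?j \<le> Dep ?b w" "Dep ?b w \<le> Dep ?t w" using D_mono ab bt by auto
    have after: "?a < ?d k" if "?j \<le> k" "Suc k \<le> Dep ?b w" for k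
      using epoch_le_iff[OF ab(1) that(2) ab(3)] that(1) by simp
    have "\<not> Suc (Suc ?j) \<le> Dep ?b w"
    proof
      assume jj: "Suc (Suc ?j) \<le> Dep ?b w"
      then have "?d (Suc ?j) \<le> ?b" "?a < ?d ?j"
        using epoch_le[OF jj ab(3)] after[of ?j] by auto
      moreover have "e \<le> ?d (Suc ?j) - ?d ?j" by (rule e1) (use jj D in simp)
      ultimately show False using len Re by linarith
    qed
    moreover have "quiet T ?a (1 / real R) w" if j: "Suc ?j \<le> Dep ?b w"
      unfolding quiet_def
    proof (intro allI notI)
      fix k assume "?a < T k w \<and> T k w \<le> ?a + 1 / real R"
      then have k: "?a < T k w" "T k w \<le> ?b" unfolding grid_Suc by auto
      then have "k < arrivals T ?t w" using T_le_iff[of k ?t] bt by simp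
      then have "e \<le> \<bar>T k w - ?d ?j\<bar>" by (rule e2) (use j D in simp)
      moreover have "?d ?j \<le> ?b" "?a < ?d ?j" using epoch_le[OF j ab(3)] after[of ?j] j by auto
      ultimately show False using k len Re by linarith
    qed
    ultimately show "Dep ?b w = ?j \<or> Dep ?b w = Suc ?j \<and> quiet T ?a (1 / real R) w"
      using D(1) by linarith
  qed
qed

text \<open>On a fine grid, the departures leaving \<open>n\<close> are the quiet windows that start with \<open>n + 1\<close>
  customers and contain one departure; evaluating \<open>g\<close> at the start of the window costs one mesh
  width per departure.\<close>

lemma grid_departure_sum:
  fixes g :: "real \<Rightarrow> real"
  assumes lip: "\<And>x y. 0 \<le> x \<Longrightarrow> 0 \<le> y \<Longrightarrow> \<bar>g x - g y\<bar> \<le> L * \<bar>x - y\<bar>"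
  shows "\<exists>R0>0. \<forall>R\<ge>R0. \<bar>departure_sum N0 T Dep n g (real m) w
    - (\<Sum>i<m * R. if quiet T (real i / real R) (1 / real R) w \<and> queue_length N0 T Dep (real i / real R) w = Suc n
        \<and> Dep (real (Suc i) / real R) w - Dep (real i / real R) w = 1
        then g (residual T (real i / real R) w) else 0)\<bar>
    \<le> L / real R * real (Dep (real m) w)"
proof -
  obtain R0 where R0: "0 < R0" "\<And>R i. R0 \<le> R \<Longrightarrow> i < m * R \<Longrightarrow>
    Dep (real (Suc i) / real R) w = Dep (real i / real R) w \<or>
    Dep (real (Suc i) / real R) w = Suc (Dep (real i / real R) w) \<and> quiet T (real i / real R) (1 / real R) w"
    using fine_grid[of m] by blast
  have L0: "0 \<le> L" using lip[of 0 1] by simp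
  have "\<bar>departure_sum N0 T Dep n g (real m) w
    - (\<Sum>i<m * R. if quiet T (real i / real R) (1 / real R) w \<and> queue_length N0 T Dep (real i / real R) w = Suc n
        \<and> Dep (real (Suc i) / real R) w - Dep (real i / real R) w = 1
        then g (residual T (real i / real R) w) else 0)\<bar>
    \<le> L / real R * real (Dep (real m) w)" if R: "R0 \<le> R" for R
  proof -
    have Rpos: "0 < real R" using R R0 by simp
    define x where "x i = (if quiet T (real i / real R) (1 / real R) w \<and> queue_length N0 T Dep (real i / real R) w = Suc n
        \<and> Dep (real (Suc i) / real R) w - Dep (real i / real R) w = 1
        then g (residual T (real i / real R) w) else 0)" for i
    have "\<bar>departure_sum N0 T Dep n g (real i / real R) w - (\<Sum>i<i. x i)\<bar> \<le> L / real R * real (Dep (real i / real R) w)"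
      if "i \<le> m * R" for i
      using that
    proof (induction i)
      case 0
      then show ?case by (simp add: departure_sum_def D_0)
    next
      case (Suc i)
      let ?a = "real i / real R" and ?b = "real (Suc i) / real R"
      have ab: "0 \<le> ?a" "?a \<le> ?b" "0 \<le> ?b" by (auto simp: divide_right_mono)
      have len: "?b - ?a = 1 / real R" unfolding grid_Suc by simp
      have IH: "\<bar>departure_sum N0 T Dep n g ?a w - (\<Sum>i<i. x i)\<bar> \<le> L / real R * real (Dep ?a w)"
        using Suc by simp
      show ?case
      proof (cases "Dep ?b w = Dep ?a w")
        case True
        then have "x i = 0" by (simp add: x_def)
        moreover have "departure_sum N0 T Dep n g ?b w = departure_sum N0 T Dep n g ?a w"
          unfolding departure_sum_def True ..
        ultimately show ?thesis using IH True by simp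
      next
        case False
        let ?j = "Dep ?a w" let ?d = "departure_epoch Dep ?j w"
        have Db: "Dep ?b w = Suc ?j" and qt: "quiet T ?a (1 / real R) w"
          using R0(2)[OF R, of i] Suc.prems False by auto
        have j: "Suc ?j \<le> Dep ?b w" using Db by simp
        have d: "?a < ?d" "?d \<le> ?b" "Dep ?d w = Suc ?j"
          using epoch_le_iff[OF ab(1) j ab(3)] epoch_le[OF j ab(3)] Dep_epoch[OF j ab(3)] by auto
        have "arrivals T ?b w = arrivals T ?a w"
          using quiet_iff[of "1 / real R" ?a] qt unfolding grid_Suc by simp
        then have Ad: "arrivals T ?d w = arrivals T ?a w"
          using arrivals_mono[of ?a ?d] arrivals_mono[of ?d ?b] d by simp
        have lb: "left_behind N0 T Dep ?j w = n \<longleftrightarrow> queue_length N0 T Dep ?a w = Suc n"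
          using D_le[of ?d] d ab(1) Ad by (auto simp: left_behind_def queue_length_def)
        have res: "residual_interarrival T Dep ?j w = residual T ?a w - (?d - ?a)"
          using residual_interarrival_eq[OF j ab(3)] Ad by (simp add: residual_def)
        have "\<bar>g (residual_interarrival T Dep ?j w) - g (residual T ?a w)\<bar> \<le> L * \<bar>residual_interarrival T Dep ?j w - residual T ?a w\<bar>"
          by (rule lip) (use residual_pos residual_interarrival_eq[OF j ab(3)] in \<open>auto intro: less_imp_le\<close>)
        also have "\<dots> \<le> L * (1 / real R)"
          by (rule mult_left_mono[OF _ L0]) (use res d len in auto)
        finally have close: "\<bar>g (residual_interarrival T Dep ?j w) - g (residual T ?a w)\<bar> \<le> L / real R" by simp
        define y where "y = (if left_behind N0 T Dep ?j w = n then g (residual_interarrival T Dep ?j w) else 0)"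
        have "\<bar>y - x i\<bar> \<le> L / real R"
          using close lb qt Db L0 Rpos by (auto simp: y_def x_def)
        moreover have "departure_sum N0 T Dep n g ?b w = departure_sum N0 T Dep n g ?a w + y"
          unfolding departure_sum_def Db y_def by simp
        moreover have "L / real R * real (Dep ?b w) = L / real R * real (Dep ?a w) + L / real R"
          unfolding Db by (simp add: algebra_simps)
        ultimately show ?thesis using IH by simp
      qed
    qed
    from this[of "m * R"] show ?thesis using Rpos unfolding x_def by simp
  qed
  then show ?thesis using R0(1) by blast
qed

end

section \<open>Averages at square times\<close>

lemma measurable_natI:
  fixes f :: "'a \<Rightarrow> nat"
  shows "(\<And>i. f -` {i} \<inter> space M \<in> sets M) \<Longrightarrow> f \<in> M \<rightarrow>\<^sub>M count_space UNIV"
  by (subst measurable_count_space_eq2_countable) auto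

lemma measurable_finer:
  assumes f: "f \<in> A \<rightarrow>\<^sub>M N" and "sets A \<subseteq> sets B" "space A = space B"
  shows "f \<in> B \<rightarrow>\<^sub>M N"
proof (rule measurableI)
  fix S assume "S \<in> sets N"
  from measurable_sets[OF f this] show "f -` S \<inter> space B \<in> sets B"
    using assms(2,3) by auto
next
  fix x assume "x \<in> space B"
  then show "f x \<in> space N" using measurable_space[OF f] assms(3) by simp
qed

lemma (in prob_space) integrable_bounded:
  fixes f :: "'a \<Rightarrow> real"
  assumes "f \<in> borel_measurable M" "\<And>w. w \<in> space M \<Longrightarrow> \<bar>f w\<bar> \<le> B"
  shows "integrable M f"
  by (rule integrable_const_bound[of _ B]) (use assms in auto)

text \<open>Random times and random states are removed by conditioning on the values of a countable random
  variable \<open>X\<close>.\<close>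

lemma (in prob_space) expectation_cong_pieces:
  fixes f g :: "'a \<Rightarrow> real" and X :: "'a \<Rightarrow> nat"
  assumes X[measurable]: "X \<in> M \<rightarrow>\<^sub>M count_space UNIV" and f: "integrable M f" and g: "integrable M g"
    and eq: "\<And>n. expectation (\<lambda>w. if X w = n then f w else 0) = expectation (\<lambda>w. if X w = n then g w else 0)"
  shows "expectation f = expectation g"
proof -
  let ?A = "\<lambda>n. {w \<in> space M. X w = n}"
  have A: "?A n \<in> sets M" for n by measurable
  have "expectation u = (\<Sum>n. expectation (\<lambda>w. if X w = n then u w else 0))" if u: "integrable M u" for u :: "'a \<Rightarrow> real"
  proof -
    have un: "(\<Union>n. ?A n) = space M" by auto
    have "expectation u = (LINT w:(\<Union>n. ?A n)|M. u w)"
      unfolding un set_lebesgue_integral_def by (rule Bochner_Integration.integral_cong) auto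
    also have "\<dots> = (\<Sum>n. (LINT w:?A n|M. u w))"
    proof (rule lebesgue_integral_countable_add[OF A])
      show "set_integrable M (\<Union>n. ?A n) u"
        unfolding un set_integrable_def using u by (rule integrable_mult_indicator[OF sets.top])
    qed auto
    also have "(\<lambda>n. (LINT w:?A n|M. u w)) = (\<lambda>n. expectation (\<lambda>w. if X w = n then u w else 0))"
      unfolding set_lebesgue_integral_def by (intro ext Bochner_Integration.integral_cong) auto
    finally show ?thesis .
  qed
  then show ?thesis using f g eq by simp
qed

lemma (in prob_space) orthogonal_sum_square:
  fixes \<xi> :: "nat \<Rightarrow> 'a \<Rightarrow> real"
  assumes meas[measurable]: "\<And>i. \<xi> i \<in> borel_measurable M"
    and bd: "\<And>i w. w \<in> space M \<Longrightarrow> \<bar>\<xi> i w\<bar> \<le> B"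
    and orth: "\<And>i j. i < j \<Longrightarrow> j < K \<Longrightarrow> expectation (\<lambda>w. \<xi> i w * \<xi> j w) = 0"
  shows "expectation (\<lambda>w. (\<Sum>i<K. \<xi> i w)\<^sup>2) = (\<Sum>i<K. expectation (\<lambda>w. (\<xi> i w)\<^sup>2))"
  using orth
proof (induction K)
  case 0
  then show ?case by simp
next
  case (Suc K)
  have bd2: "\<bar>\<xi> i w * \<xi> j w\<bar> \<le> B * B" if "w \<in> space M" for i j w
    unfolding abs_mult using bd[OF that] by (intro mult_mono) (auto intro: order_trans[OF abs_ge_zero])
  have i2: "integrable M (\<lambda>w. \<xi> i w * \<xi> j w)" for i j
    by (rule integrable_bounded[where B="B * B"]) (use bd2 in auto)
  have bS: "\<bar>\<Sum>i<K. \<xi> i w\<bar> \<le> real K * B" if "w \<in> space M" for w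
    using sum_norm_le[of "{..<K}" "\<lambda>i. \<xi> i w" "\<lambda>_. B"] bd[OF that] by simp
  have iS: "integrable M (\<lambda>w. (\<Sum>i<K. \<xi> i w)\<^sup>2)"
  proof (rule integrable_bounded)
    show "\<bar>(\<Sum>i<K. \<xi> i w)\<^sup>2\<bar> \<le> (real K * B)\<^sup>2" if "w \<in> space M" for w
      using power_mono[OF bS[OF that] abs_ge_zero, of 2] by simp
  qed simp
  have "(\<lambda>w. (\<Sum>i<Suc K. \<xi> i w)\<^sup>2) = (\<lambda>w. (\<Sum>i<K. \<xi> i w)\<^sup>2 + (2 * (\<Sum>i<K. \<xi> i w * \<xi> K w) + (\<xi> K w)\<^sup>2))"
    by (simp add: fun_eq_iff power2_sum sum_distrib_right[symmetric])
  then have "expectation (\<lambda>w. (\<Sum>i<Suc K. \<xi> i w)\<^sup>2) =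
    expectation (\<lambda>w. (\<Sum>i<K. \<xi> i w)\<^sup>2) + (2 * (\<Sum>i<K. expectation (\<lambda>w. \<xi> i w * \<xi> K w)) + expectation (\<lambda>w. (\<xi> K w)\<^sup>2))"
    using iS i2 by (simp add: power2_eq_square[of "\<xi> K _"])
  then show ?case using Suc by simp
qed

text \<open>A strong law from second moments: at the times \<open>m\<^sup>2\<close> a variance bound of order \<open>m\<^sup>2\<close> makes the
  normalised squares summable in expectation. The variables \<open>Y m\<close> are given only as limits of
  approximations \<open>U m r\<close>, to which the variance bound applies; Fatou's lemma transfers it.\<close>

lemma AE_tendsto_0_squares:
  fixes U :: "nat \<Rightarrow> nat \<Rightarrow> 'a \<Rightarrow> real" and Y :: "nat \<Rightarrow> 'a \<Rightarrow> real"
  assumes meas[measurable]: "\<And>m r. U m r \<in> borel_measurable M"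
    and bd: "\<And>m. \<forall>\<^sub>F r in sequentially. (\<integral>\<^sup>+ w. ennreal ((U m r w)\<^sup>2) \<partial>M) \<le> ennreal (C * (real m)\<^sup>2)"
    and lim: "AE w in M. \<forall>m. (\<lambda>r. U m r w) \<longlonglongrightarrow> Y m w"
  shows "AE w in M. (\<lambda>m. Y m w / (real m)\<^sup>2) \<longlonglongrightarrow> 0"
proof -
  define V where "V m w = liminf (\<lambda>r. ennreal ((U m r w)\<^sup>2))" for m w
  have [measurable]: "V m \<in> borel_measurable M" for m
    unfolding V_def by measurable
  have V: "(\<integral>\<^sup>+ w. V m w \<partial>M) \<le> ennreal (C * (real m)\<^sup>2)" for m
  proof -
    have "(\<integral>\<^sup>+ w. V m w \<partial>M) \<le> liminf (\<lambda>r. \<integral>\<^sup>+ w. ennreal ((U m r w)\<^sup>2) \<partial>M)"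
      unfolding V_def by (rule nn_integral_liminf) measurable
    also have "\<dots> \<le> limsup (\<lambda>r. \<integral>\<^sup>+ w. ennreal ((U m r w)\<^sup>2) \<partial>M)"
      by (rule Liminf_le_Limsup) simp
    also have "\<dots> \<le> ennreal (C * (real m)\<^sup>2)"
      by (rule Limsup_bounded[OF bd])
    finally show ?thesis .
  qed
  have "(\<integral>\<^sup>+ w. (\<Sum>m. ennreal (1 / (real m)^4) * V m w) \<partial>M) = (\<Sum>m. ennreal (1 / (real m)^4) * (\<integral>\<^sup>+ w. V m w \<partial>M))"
    by (subst nn_integral_suminf) (auto simp: nn_integral_cmult)
  also have "\<dots> \<le> (\<Sum>m. ennreal (\<bar>C\<bar> * inverse ((real m)^2)))"
  proof (rule suminf_le)
    fix m
    have "ennreal (1 / (real m)^4) * (\<integral>\<^sup>+ w. V m w \<partial>M) \<le> ennreal (1 / (real m)^4) * ennreal (\<bar>C\<bar> * (real m)\<^sup>2)"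
      by (rule mult_left_mono[OF order_trans[OF V]]) (auto intro!: ennreal_leI mult_right_mono)
    also have "\<dots> = ennreal (1 / (real m)^4 * (\<bar>C\<bar> * (real m)\<^sup>2))"
      by (rule ennreal_mult[symmetric]) auto
    also have "1 / (real m)^4 * (\<bar>C\<bar> * (real m)\<^sup>2) = \<bar>C\<bar> * inverse ((real m)^2)"
      by (cases "m = 0") (auto simp: field_simps power2_eq_square power4_eq_xxxx)
    finally show "ennreal (1 / (real m)^4) * (\<integral>\<^sup>+ w. V m w \<partial>M) \<le> ennreal (\<bar>C\<bar> * inverse ((real m)^2))" .
  qed auto
  also have "\<dots> = ennreal (\<Sum>m. \<bar>C\<bar> * inverse ((real m)^2))"
    by (rule suminf_ennreal2) (auto intro!: summable_mult inverse_power_summable)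
  finally have "(\<integral>\<^sup>+ w. (\<Sum>m. ennreal (1 / (real m)^4) * V m w) \<partial>M) \<noteq> \<infinity>"
    by (auto simp: top_unique)
  then have "AE w in M. (\<Sum>m. ennreal (1 / (real m)^4) * V m w) \<noteq> \<infinity>"
    by (intro nn_integral_PInf_AE) auto
  then show ?thesis
    using lim
  proof eventually_elim
    case (elim w)
    have Vw: "V m w = ennreal ((Y m w)\<^sup>2)" for m
    proof -
      have "(\<lambda>r. ennreal ((U m r w)\<^sup>2)) \<longlonglongrightarrow> ennreal ((Y m w)\<^sup>2)"
        by (intro tendsto_ennrealI tendsto_power) (use elim in auto)
      then show ?thesis
        unfolding V_def by (intro lim_imp_Liminf) auto
    qed
    have "ennreal (1 / (real m)^4) * V m w = ennreal ((Y m w / (real m)\<^sup>2)\<^sup>2)" for m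
      unfolding Vw by (subst ennreal_mult[symmetric]) (auto simp: power_divide)
    then have "(\<Sum>m. ennreal ((Y m w / (real m)\<^sup>2)\<^sup>2)) \<noteq> \<top>"
      using elim by simp
    then have "summable (\<lambda>m. (Y m w / (real m)\<^sup>2)\<^sup>2)"
      by (rule summable_suminf_not_top[rotated]) auto
    then have "(\<lambda>m. (Y m w / (real m)\<^sup>2)\<^sup>2) \<longlonglongrightarrow> 0"
      by (rule summable_LIMSEQ_zero)
    then have "(\<lambda>m. sqrt ((Y m w / (real m)\<^sup>2)\<^sup>2)) \<longlonglongrightarrow> sqrt 0"
      by (rule tendsto_real_sqrt)
    then show ?case
      by (intro tendsto_rabs_zero_cancel[of "\<lambda>m. Y m w / (real m)\<^sup>2"]) (simp add: abs_div)
  qed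
qed

section \<open>The arrival stream\<close>

context GMn1_queue
begin

abbreviation "qlen \<equiv> queue_length N0 T Dep"
abbreviation "left \<equiv> left_behind N0 T Dep"
abbreviation "resid \<equiv> residual_interarrival T Dep"
abbreviation "seen \<equiv> seen_by N0 T Dep"
abbreviation "dep_sum n \<equiv> departure_sum N0 T Dep n"
abbreviation "arr_sum n \<equiv> arrival_sum N0 T Dep n"
abbreviation "occ_integral n \<equiv> state_integral N0 T Dep n"

text \<open>What is known after the first \<open>l + 1\<close> arrivals, services disregarded.\<close>

definition hist :: "nat \<Rightarrow> 'w measure" where
  "hist l = sigma (space M) ({N0 -` {i} \<inter> space M | i. True} \<union> {T k -` S \<inter> space M | k S. k \<le> l \<and> S \<in> sets borel})"

text \<open>The sigma-algebra \<open>past\<close> as a measurable space.\<close>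

definition Past :: "real \<Rightarrow> 'w measure" where
  "Past t = sigma (space M) (past M N0 T Dep t)"

lemma space_Past[simp]: "space (Past t) = space M" and space_hist[simp]: "space (hist l) = space M"
  by (auto simp: Past_def hist_def space_measure_of_conv)

lemma sets_Past: "sets (Past t) = past M N0 T Dep t"
  unfolding Past_def past_def
  by (subst sets_measure_of) (auto dest: sigma_sets_into_sp[rotated] intro!: sigma_sets_sigma_sets_eq)

lemma sets_hist: "sets (hist l) = sigma_sets (space M) ({N0 -` {i} \<inter> space M | i. True} \<union> {T k -` S \<inter> space M | k S. k \<le> l \<and> S \<in> sets borel})"
  unfolding hist_def by (rule sets_measure_of) auto

lemma N0_hist[measurable]: "N0 \<in> hist l \<rightarrow>\<^sub>M count_space UNIV"
proof (rule measurable_natI)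
  fix i
  have "N0 -` {i} \<inter> space M \<in> {N0 -` {i} \<inter> space M | i. True}" by (rule CollectI, rule exI[of _ i], rule conjI[OF refl TrueI])
  then show "N0 -` {i} \<inter> space (hist l) \<in> sets (hist l)"
    unfolding space_hist sets_hist by (intro sigma_sets.Basic UnI1)
qed

lemma T_hist:
  assumes "k \<le> l" shows "T k \<in> borel_measurable (hist l)"
proof (rule measurableI)
  fix S :: "real set" assume "S \<in> sets borel"
  then have "T k -` S \<inter> space M \<in> {T k -` S \<inter> space M | k S. k \<le> l \<and> S \<in> sets borel}"
    using assms by (intro CollectI exI[of _ k] exI[of _ S] conjI) (rule refl, assumption+)
  then show "T k -` S \<inter> space (hist l) \<in> sets (hist l)"
    unfolding space_hist sets_hist by (intro sigma_sets.Basic UnI2)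
qed simp

lemma N0_Past[measurable]: "N0 \<in> Past t \<rightarrow>\<^sub>M count_space UNIV"
proof (rule measurable_natI)
  fix i
  have "N0 -` {i} \<inter> space M \<in> {N0 -` {i} \<inter> space M | i. True}" by (rule CollectI, rule exI[of _ i], rule conjI[OF refl TrueI])
  then show "N0 -` {i} \<inter> space (Past t) \<in> sets (Past t)"
    unfolding space_Past sets_Past past_def by (intro sigma_sets.Basic UnI1)
qed

lemma T_Past[measurable]: "T k \<in> borel_measurable (Past t)"
proof (rule measurableI)
  fix S :: "real set" assume "S \<in> sets borel"
  then have "T k -` S \<inter> space M \<in> {T k -` S \<inter> space M | k S. S \<in> sets borel}"
    by (intro CollectI exI[of _ k] exI[of _ S] conjI) (rule refl)
  then show "T k -` S \<inter> space (Past t) \<in> sets (Past t)"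
    unfolding space_Past sets_Past past_def by (intro sigma_sets.Basic UnI1 UnI2)
qed simp

lemma Dep_Past:
  assumes "0 \<le> u" "u \<le> t" shows "Dep u \<in> Past t \<rightarrow>\<^sub>M count_space UNIV"
proof (rule measurable_natI)
  fix i
  have "Dep u -` {i} \<inter> space M \<in> {Dep u -` {i} \<inter> space M | u i. 0 \<le> u \<and> u \<le> t}"
    using assms by (intro CollectI exI[of _ u] exI[of _ i] conjI) (rule refl, assumption+)
  then show "Dep u -` {i} \<inter> space (Past t) \<in> sets (Past t)"
    unfolding space_Past sets_Past past_def by (intro sigma_sets.Basic UnI2)
qed

lemma hist_sub_Past: "sets (hist l) \<subseteq> sets (Past t)"
  unfolding sets_hist sets_Past past_def by (rule sigma_sets_mono') blast

lemma Past_sub: "0 \<le> t \<Longrightarrow> sets (Past t) \<subseteq> sets M"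
  unfolding sets_Past past_def using N0_measurable T_measurable Dep_measurable
  by (intro sets.sigma_sets_subset) (auto simp: measurable_sets)

lemma measurable_hist_Past: "f \<in> hist l \<rightarrow>\<^sub>M N \<Longrightarrow> f \<in> Past t \<rightarrow>\<^sub>M N"
  by (rule measurable_finer[OF _ hist_sub_Past]) auto

lemma measurable_Past_M: "f \<in> Past t \<rightarrow>\<^sub>M N \<Longrightarrow> 0 \<le> t \<Longrightarrow> f \<in> M \<rightarrow>\<^sub>M N"
  by (rule measurable_finer[OF _ Past_sub]) auto

lemma measurable_hist_M: "f \<in> hist l \<rightarrow>\<^sub>M N \<Longrightarrow> f \<in> M \<rightarrow>\<^sub>M N"
  by (rule measurable_Past_M[OF measurable_hist_Past order_refl])

lemma arrivals_Past[measurable]: "arrivals T u \<in> Past t \<rightarrow>\<^sub>M count_space UNIV"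
  unfolding arrivals_def by measurable

lemma queue_length_Past: "0 \<le> u \<Longrightarrow> u \<le> t \<Longrightarrow> qlen u \<in> Past t \<rightarrow>\<^sub>M count_space UNIV"
  using Dep_Past[of u t] unfolding queue_length_def by measurable

lemma residual_Past[measurable]: "residual T u \<in> borel_measurable (Past t)"
proof -
  have "(\<lambda>w. T (arrivals T u w) w) \<in> borel_measurable (Past t)"
    by (rule measurable_compose_countable[OF T_Past arrivals_Past])
  then show ?thesis
    unfolding residual_def by (rule borel_measurable_diff[OF _ borel_measurable_const])
qed

lemma quiet_Past[measurable]: "Measurable.pred (Past t) (quiet T u h)"
  unfolding quiet_def by measurable

lemmas N0_M[measurable] = measurable_Past_M[OF N0_Past order_refl]
  and T_M[measurable] = measurable_Past_M[OF T_Past order_refl]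
  and arrivals_M[measurable] = measurable_Past_M[OF arrivals_Past order_refl]
  and residual_M[measurable] = measurable_Past_M[OF residual_Past order_refl]
  and quiet_M[measurable] = measurable_Past_M[OF quiet_Past order_refl]

lemma T_sum: "T k w = T 0 w + (\<Sum>j<k. T (Suc j) w - T j w)"
  using sum_lessThan_telescope[of "\<lambda>j. T j w" k] by simp

definition gap :: "nat \<Rightarrow> 'w \<Rightarrow> real" where
  "gap k w = T (Suc k) w - T k w"

lemma gap_measurable[measurable]: "gap k \<in> borel_measurable M"
  unfolding gap_def by measurable

text \<open>\<open>hist l\<close> is generated by the initial state and the inter-arrival times before gap \<open>l\<close>. On products
  of an event of each kind, independence of gap \<open>l\<close> follows by first splitting off the initial state
  and then using the independence of the inter-arrival times; these products are stable under
  intersection.\<close>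

lemma gap_indep_hist: "indep_set (sets (hist l)) (sigma_sets (space M) {gap l -` S \<inter> space M | S. S \<in> sets borel})"
proof -
  let ?I = "\<lambda>w. (N0 w, T 0 w)" and ?r = "\<lambda>w. restrict (\<lambda>k. gap k w) {..<l}"
  define P where "P = {(?I -` S1 \<inter> space M) \<inter> (?r -` S2 \<inter> space M) | S1 S2.
    S1 \<in> sets (count_space UNIV \<Otimes>\<^sub>M borel) \<and> S2 \<in> sets (Pi\<^sub>M {..<l} (\<lambda>_. borel))}"
  define Q where "Q = {gap l -` S \<inter> space M | S. S \<in> sets borel}"
  have Im[measurable]: "?I \<in> M \<rightarrow>\<^sub>M (count_space UNIV \<Otimes>\<^sub>M borel)" by measurable
  have rm[measurable]: "?r \<in> M \<rightarrow>\<^sub>M Pi\<^sub>M {..<l} (\<lambda>_. borel)" by measurable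
  have iv: "indep_vars (\<lambda>_. borel) gap UNIV"
    using interarrival_indep unfolding gap_def[abs_def] .
  have ivr: "indep_var (Pi\<^sub>M {..<l} (\<lambda>_. borel)) ?r (Pi\<^sub>M {l} (\<lambda>_. borel)) (\<lambda>w. restrict (\<lambda>k. gap k w) {l})"
    by (rule indep_var_restrict[OF iv]) auto
  have PQ: "indep_set P Q"
    unfolding indep_sets2_eq
  proof (intro conjI ballI)
    show "P \<subseteq> events" "Q \<subseteq> events" unfolding P_def Q_def by auto
    fix a b assume "a \<in> P" "b \<in> Q"
    then obtain S1 S2 S where S: "S1 \<in> sets (count_space UNIV \<Otimes>\<^sub>M borel)" "S2 \<in> sets (Pi\<^sub>M {..<l} (\<lambda>_. borel))" "S \<in> sets borel"
      and a: "a = (?I -` S1 \<inter> space M) \<inter> (?r -` S2 \<inter> space M)" and b: "b = gap l -` S \<inter> space M"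
      unfolding P_def Q_def by blast
    let ?A1 = "?I -` S1 \<inter> space M" and ?A2 = "?r -` S2 \<inter> space M"
    let ?seq = "\<lambda>w k. T (Suc k) w - T k w"
    have r2: "(\<lambda>x. restrict x {..<l}) \<in> Pi\<^sub>M UNIV (\<lambda>_. borel) \<rightarrow>\<^sub>M Pi\<^sub>M {..<l} (\<lambda>_. borel :: real measure)"
      by (rule measurable_restrict_subset) simp
    have split: "prob (?A1 \<inter> (?seq -` Z \<inter> space M)) = prob ?A1 * prob (?seq -` Z \<inter> space M)"
      if "Z \<in> sets (Pi\<^sub>M UNIV (\<lambda>_. borel))" for Z
      by (rule indep_setD[OF initial_indep]) (use S that in blast)+
    define Z2 where "Z2 = (\<lambda>x. restrict x {..<l}) -` S2 \<inter> space (Pi\<^sub>M UNIV (\<lambda>_. borel :: real measure))"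
    have Z2: "Z2 \<in> sets (Pi\<^sub>M UNIV (\<lambda>_. borel))"
      unfolding Z2_def by (rule measurable_sets[OF r2 S(2)])
    have Z2s: "?seq -` Z2 \<inter> space M = ?A2"
      unfolding Z2_def by (auto simp: gap_def[abs_def] space_PiM)
    \<comment> \<open>The event of gap \<open>l\<close> and the events of the earlier gaps, as one event of the whole sequence.\<close>
    define Z3 where "Z3 = Z2 \<inter> ((\<lambda>x. x l) -` S \<inter> space (Pi\<^sub>M UNIV (\<lambda>_. borel :: real measure)))"
    have Z3: "Z3 \<in> sets (Pi\<^sub>M UNIV (\<lambda>_. borel))"
      unfolding Z3_def using Z2 S(3) by (intro sets.Int measurable_sets[OF measurable_component_singleton]) auto
    have Z3s: "?seq -` Z3 \<inter> space M = ?A2 \<inter> b"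
      using Z2s unfolding Z3_def b by (auto simp: gap_def[abs_def] space_PiM)
    have bS: "b = (\<lambda>w. restrict (\<lambda>k. gap k w) {l}) -` ((\<lambda>x. x l) -` S \<inter> space (Pi\<^sub>M {l} (\<lambda>_. borel :: real measure))) \<inter> space M"
      unfolding b by (auto simp: space_PiM)
    have "prob (?A2 \<inter> b) = prob ?A2 * prob b"
    proof (rule indep_setD)
      show "indep_set (sigma_sets (space M) {?r -` A \<inter> space M | A. A \<in> sets (Pi\<^sub>M {..<l} (\<lambda>_. borel))})
        (sigma_sets (space M) {(\<lambda>w. restrict (\<lambda>k. gap k w) {l}) -` A \<inter> space M | A. A \<in> sets (Pi\<^sub>M {l} (\<lambda>_. borel))})"
        using ivr unfolding indep_var_eq by blast
      show "?A2 \<in> sigma_sets (space M) {?r -` A \<inter> space M | A. A \<in> sets (Pi\<^sub>M {..<l} (\<lambda>_. borel))}"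
        using S by (intro sigma_sets.Basic) blast
      show "b \<in> sigma_sets (space M) {(\<lambda>w. restrict (\<lambda>k. gap k w) {l}) -` A \<inter> space M | A. A \<in> sets (Pi\<^sub>M {l} (\<lambda>_. borel))}"
        using measurable_sets[OF measurable_component_singleton[of l "{l}" "\<lambda>_. borel"] S(3)]
        by (intro sigma_sets.Basic) (use bS in blast)
    qed
    then have "prob (?A1 \<inter> (?A2 \<inter> b)) = prob ?A1 * prob ?A2 * prob b"
      using split[OF Z3] unfolding Z3s by simp
    moreover have "prob (?A1 \<inter> ?A2) = prob ?A1 * prob ?A2"
      using split[OF Z2] unfolding Z2s .
    ultimately show "prob (a \<inter> b) = prob a * prob b"
      unfolding a by (simp add: Int_assoc)
  qed
  have IP: "Int_stable P"
  proof (rule Int_stableI)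
    fix a b assume "a \<in> P" "b \<in> P"
    then obtain S1 S2 S1' S2' where
      S: "S1 \<in> sets (count_space UNIV \<Otimes>\<^sub>M borel)" "S2 \<in> sets (Pi\<^sub>M {..<l} (\<lambda>_. borel))"
         "S1' \<in> sets (count_space UNIV \<Otimes>\<^sub>M borel)" "S2' \<in> sets (Pi\<^sub>M {..<l} (\<lambda>_. borel))"
      and ab: "a = (?I -` S1 \<inter> space M) \<inter> (?r -` S2 \<inter> space M)" "b = (?I -` S1' \<inter> space M) \<inter> (?r -` S2' \<inter> space M)"
      unfolding P_def by blast
    have "a \<inter> b = (?I -` (S1 \<inter> S1') \<inter> space M) \<inter> (?r -` (S2 \<inter> S2') \<inter> space M)"
      unfolding ab by auto
    then show "a \<inter> b \<in> P" unfolding P_def using S by blast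
  qed
  have IQ: "Int_stable Q"
    unfolding Q_def by (rule Int_stableI) (auto, metis sets.Int vimage_Int Int_assoc Int_left_commute Int_absorb)
  have ind: "indep_set (sigma_sets (space M) P) (sigma_sets (space M) Q)"
    by (rule indep_set_sigma_sets[OF PQ IP IQ])
  let ?F = "sigma (space M) P"
  have Psub: "P \<subseteq> Pow (space M)" unfolding P_def by auto
  have [simp]: "space ?F = space M" by (simp add: space_measure_of_conv)
  have setsF: "sets ?F = sigma_sets (space M) P" by (rule sets_measure_of[OF Psub])
  have IF: "?I \<in> ?F \<rightarrow>\<^sub>M (count_space UNIV \<Otimes>\<^sub>M borel)"
  proof (rule measurableI)
    fix S assume S: "S \<in> sets (count_space UNIV \<Otimes>\<^sub>M borel :: (nat \<times> real) measure)"
    have "?I -` S \<inter> space M = (?I -` S \<inter> space M) \<inter> (?r -` space (Pi\<^sub>M {..<l} (\<lambda>_. borel)) \<inter> space M)"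
      by (auto simp: space_PiM)
    then have "?I -` S \<inter> space M \<in> P" unfolding P_def using S by blast
    then show "?I -` S \<inter> space ?F \<in> sets ?F" by (simp add: setsF)
  qed (auto simp: space_pair_measure)
  have rF: "?r \<in> ?F \<rightarrow>\<^sub>M Pi\<^sub>M {..<l} (\<lambda>_. borel)"
  proof (rule measurableI)
    fix S assume S: "S \<in> sets (Pi\<^sub>M {..<l} (\<lambda>_. borel :: real measure))"
    have "?r -` S \<inter> space M = (?I -` space (count_space UNIV \<Otimes>\<^sub>M borel) \<inter> space M) \<inter> (?r -` S \<inter> space M)"
      by (auto simp: space_pair_measure)
    then have "?r -` S \<inter> space M \<in> P" unfolding P_def using S by blast
    then show "?r -` S \<inter> space ?F \<in> sets ?F" by (simp add: setsF)
  qed (auto simp: space_PiM)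
  have NF: "N0 \<in> ?F \<rightarrow>\<^sub>M count_space UNIV" and T0F: "T 0 \<in> borel_measurable ?F"
    using measurable_compose[OF IF measurable_fst] measurable_compose[OF IF measurable_snd] by auto
  have gF: "gap k \<in> borel_measurable ?F" if "k < l" for k
    using measurable_compose[OF rF measurable_component_singleton[of k "{..<l}" "\<lambda>_. borel"]] that by simp
  have TF: "T k \<in> borel_measurable ?F" if "k \<le> l" for k
  proof -
    have "(\<lambda>w. T 0 w + (\<Sum>j<k. gap j w)) \<in> borel_measurable ?F"
      using T0F gF that by (intro borel_measurable_add borel_measurable_sum) auto
    then show ?thesis unfolding gap_def T_sum[symmetric] .
  qed
  have "sets (hist l) \<subseteq> sigma_sets (space M) P"
    unfolding sets_hist setsF[symmetric]
    using measurable_sets[OF NF] measurable_sets[OF TF]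
    by (intro sets.sigma_sets_subset') auto
  then show ?thesis
    using ind unfolding indep_sets2_eq Q_def by blast
qed

lemma gap_law: "distr M borel (gap k) = G"
  using interarrival_law[of k] unfolding gap_def[abs_def] .

lemma expectation_gap:
  fixes \<zeta> :: "'w \<Rightarrow> real" and f :: "real \<Rightarrow> real"
  assumes \<zeta>: "\<zeta> \<in> borel_measurable (hist l)" "\<And>w. \<bar>\<zeta> w\<bar> \<le> B"
    and f[measurable]: "f \<in> borel_measurable borel" and fb: "\<And>x. \<bar>f x\<bar> \<le> C"
  shows "expectation (\<lambda>w. \<zeta> w * f (gap l w)) = expectation \<zeta> * (LINT x|G. f x)"
proof -
  have [measurable]: "\<zeta> \<in> borel_measurable M" by (rule measurable_hist_M[OF \<zeta>(1)])
  have "indep_var borel \<zeta> borel (\<lambda>w. f (gap l w))"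
    unfolding indep_var_eq
  proof (intro conjI)
    have "sigma_sets (space M) {\<zeta> -` A \<inter> space M | A. A \<in> sets borel} \<subseteq> sets (hist l)"
      using measurable_sets[OF \<zeta>(1)] sets.top[of "hist l"] by (intro sets.sigma_sets_subset') auto
    moreover have "sigma_sets (space M) {(\<lambda>w. f (gap l w)) -` A \<inter> space M | A. A \<in> sets borel}
       \<subseteq> sigma_sets (space M) {gap l -` S \<inter> space M | S. S \<in> sets borel}"
    proof (rule sigma_sets_mono', safe)
      fix A :: "real set" assume A: "A \<in> sets borel"
      have "(\<lambda>w. f (gap l w)) -` A \<inter> space M = gap l -` (f -` A) \<inter> space M" by auto
      moreover have "f -` A \<in> sets borel" using measurable_sets[OF f A] by simp
      ultimately show "\<exists>S. (\<lambda>w. f (gap l w)) -` A \<inter> space M = gap l -` S \<inter> space M \<and> S \<in> sets borel" by blast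
    qed
    ultimately show "indep_set (sigma_sets (space M) {\<zeta> -` A \<inter> space M |A. A \<in> sets borel})
       (sigma_sets (space M) {(\<lambda>w. f (gap l w)) -` A \<inter> space M |A. A \<in> sets borel})"
      using gap_indep_hist[of l] unfolding indep_sets2_eq by blast
  qed auto
  then have "expectation (\<lambda>w. \<zeta> w * f (gap l w)) = expectation \<zeta> * expectation (\<lambda>w. f (gap l w))"
    by (rule indep_var_lebesgue_integral)
       (use \<zeta> fb in \<open>auto intro: integrable_bounded[where B=B] integrable_bounded[where B=C]\<close>)
  also have "expectation (\<lambda>w. f (gap l w)) = (LINT x|G. f x)"
    unfolding gap_law[of l, symmetric] by (rule integral_distr[symmetric]) auto
  finally show ?thesis .
qed

text \<open>The strong law for the inter-arrival times, for bounded functions and along the squares.\<close>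

lemma gap_average:
  fixes f :: "real \<Rightarrow> real"
  assumes f[measurable]: "f \<in> borel_measurable borel" and fb: "\<And>x. \<bar>f x\<bar> \<le> 1"
  shows "AE w in M. (\<lambda>m. (\<Sum>k<m\<^sup>2. f (gap k w) - (LINT x|G. f x)) / (real m)\<^sup>2) \<longlonglongrightarrow> 0"
proof -
  interpret G: real_distribution G by (rule G_distribution)
  let ?c = "LINT x|G. f x"
  define \<xi> where "\<xi> k w = f (gap k w) - ?c" for k w
  have c: "\<bar>?c\<bar> \<le> 1"
  proof -
    have "\<bar>?c\<bar> \<le> (LINT x|G. \<bar>f x\<bar>)" by (rule integral_abs_bound)
    also have "\<dots> \<le> (LINT x|G. 1)"
      using fb by (intro integral_mono G.integrable_bounded[where B=1]) auto
    finally show ?thesis using G.prob_space by simp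
  qed
  have [measurable]: "\<xi> k \<in> borel_measurable M" for k unfolding \<xi>_def by measurable
  have b: "\<bar>\<xi> k w\<bar> \<le> 2" for k w using fb[of "gap k w"] c unfolding \<xi>_def by linarith
  have orth: "expectation (\<lambda>w. \<xi> i w * \<xi> j w) = 0" if "i < j" for i j
  proof -
    have "\<xi> i \<in> borel_measurable (hist j)"
    proof -
      have "gap i \<in> borel_measurable (hist j)"
        unfolding gap_def using that by (intro borel_measurable_diff T_hist) auto
      from measurable_compose[OF this f] show ?thesis
        unfolding \<xi>_def by (rule borel_measurable_diff[OF _ borel_measurable_const])
    qed
    then have "expectation (\<lambda>w. \<xi> i w * (f (gap j w) - ?c)) = expectation (\<xi> i) * (LINT x|G. f x - ?c)"
    proof (rule expectation_gap[where f="\<lambda>x. f x - ?c" and C=2 and B=2])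
      show "\<bar>f x - ?c\<bar> \<le> 2" for x using fb[of x] c by linarith
    qed (use b in auto)
    also have "(LINT x|G. f x - ?c) = 0"
    proof -
      have "integrable G f" by (rule G.integrable_bounded[where B=1]) (use fb in auto)
      then show ?thesis using G.prob_space by simp
    qed
    finally show ?thesis by (simp add: \<xi>_def)
  qed
  have sq: "expectation (\<lambda>w. (\<Sum>k<K. \<xi> k w)\<^sup>2) \<le> 4 * real K" for K
  proof -
    have "expectation (\<lambda>w. (\<Sum>k<K. \<xi> k w)\<^sup>2) = (\<Sum>k<K. expectation (\<lambda>w. (\<xi> k w)\<^sup>2))"
      by (rule orthogonal_sum_square[where B=2]) (use b orth in auto)
    also have "\<dots> \<le> (\<Sum>k<K. 4)"
    proof (rule sum_mono)
      fix k
      have "(\<xi> k w)\<^sup>2 \<le> 4" for w using abs_le_square_iff[of "\<xi> k w" 2] b[of k w] by simp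
      then have "expectation (\<lambda>w. (\<xi> k w)\<^sup>2) \<le> expectation (\<lambda>w. 4)"
        by (intro integral_mono integrable_bounded[where B=4]) auto
      then show "expectation (\<lambda>w. (\<xi> k w)\<^sup>2) \<le> 4" by (simp add: prob_space)
    qed
    finally show ?thesis by simp
  qed
  have bS: "\<bar>\<Sum>k<K. \<xi> k w\<bar> \<le> real K * 2" for K w
    using sum_norm_le[of "{..<K}" "\<lambda>k. \<xi> k w" "\<lambda>_. 2"] b by simp
  have nn: "(\<integral>\<^sup>+ w. ennreal ((\<Sum>k<m\<^sup>2. \<xi> k w)\<^sup>2) \<partial>M) \<le> ennreal (4 * (real m)\<^sup>2)" for m
  proof -
    have "integrable M (\<lambda>w. (\<Sum>k<m\<^sup>2. \<xi> k w)\<^sup>2)"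
    proof (rule integrable_bounded)
      show "\<bar>(\<Sum>k<m\<^sup>2. \<xi> k w)\<^sup>2\<bar> \<le> (real (m\<^sup>2) * 2)\<^sup>2" for w
        using power_mono[OF bS[of w "m\<^sup>2"] abs_ge_zero, of 2] by simp
    qed simp
    then have "(\<integral>\<^sup>+ w. ennreal ((\<Sum>k<m\<^sup>2. \<xi> k w)\<^sup>2) \<partial>M) = ennreal (expectation (\<lambda>w. (\<Sum>k<m\<^sup>2. \<xi> k w)\<^sup>2))"
      by (rule nn_integral_eq_integral) simp
    also have "\<dots> \<le> ennreal (4 * (real m)\<^sup>2)"
      by (rule ennreal_leI) (use sq[of "m\<^sup>2"] in simp)
    finally show ?thesis .
  qed
  have "AE w in M. (\<lambda>m. (\<Sum>k<m\<^sup>2. \<xi> k w) / (real m)\<^sup>2) \<longlonglongrightarrow> 0"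
    by (rule AE_tendsto_0_squares[where U="\<lambda>m r w. \<Sum>k<m\<^sup>2. \<xi> k w" and C=4]) (use nn in auto)
  then show ?thesis unfolding \<xi>_def .
qed

end

section \<open>The service mechanism\<close>

context GMn1_queue
begin

text \<open>A positive mean excludes inter-arrival times that vanish almost surely.\<close>

lemma expectation_truncated_gap_pos: "0 < (LINT x|G. 1 - exp (- max 0 x))"
proof -
  interpret G: real_distribution G by (rule G_distribution)
  let ?f = "\<lambda>x::real. 1 - exp (- max 0 x)"
  have int: "integrable G ?f"
    by (rule G.integrable_bounded[where B=1]) auto
  have nn: "0 \<le> (LINT x|G. ?f x)" by (rule integral_nonneg_AE) simp
  have "(LINT x|G. ?f x) \<noteq> 0"
  proof
    assume "(LINT x|G. ?f x) = 0"
    then have "AE x in G. ?f x = 0"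
      by (subst (asm) integral_nonneg_eq_0_iff_AE[OF int]) auto
    then have "AE x in G. x = 0"
      using G_nonneg by eventually_elim (auto simp: max_def split: if_splits)
    then have "(LINT x|G. x) = (LINT x|G. 0)"
      by (intro integral_cong_AE) auto
    then show False using G_mean lam_pos by simp
  qed
  then show ?thesis using nn by linarith
qed

lemma gap_nonneg: "AE w in M. \<forall>k. 0 \<le> gap k w"
  unfolding AE_all_countable
proof
  fix k
  have "AE x in distr M borel (gap k). 0 \<le> x"
    unfolding gap_law by (rule G_nonneg)
  then show "AE w in M. 0 \<le> gap k w"
    by (rule AE_distrD[rotated]) simp
qed

lemma T_sum_gap: "T k w = T 0 w + (\<Sum>j<k. gap j w)"
  unfolding gap_def by (rule T_sum)

text \<open>All requirements except monotone arrival times and their divergence are among the assumptions on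
  the queue. Divergence follows from \<open>gap_average\<close> for \<open>1 - exp (- x) \<le> x\<close>, whose mean is positive.\<close>

lemma path_AE: "AE w in M. queue_path N0 T Dep w"
proof -
  let ?f = "\<lambda>x::real. 1 - exp (- max 0 x)" and ?c = "LINT x|G. 1 - exp (- max 0 x)"
  have "AE w in M. (\<lambda>m. (\<Sum>k<m\<^sup>2. ?f (gap k w) - ?c) / (real m)\<^sup>2) \<longlonglongrightarrow> 0"
    by (rule gap_average) auto
  then show ?thesis
    using gap_nonneg first_arrival Dep_le no_coincidence AE_space
  proof eventually_elim
    case (elim w)
    have step: "T k w \<le> T (Suc k) w" for k
      using elim(2) unfolding gap_def by (auto simp: algebra_simps)
    have mono: "i \<le> j \<Longrightarrow> T i w \<le> T j w" for i j
      using step by (rule lift_Suc_mono_le)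
    have c0: "0 < ?c" by (rule expectation_truncated_gap_pos)
    have "filterlim (\<lambda>k. T k w) at_top sequentially"
      unfolding filterlim_at_top
    proof
      fix Z :: real
      have "\<forall>\<^sub>F m in sequentially. - (?c / 2) < (\<Sum>k<m\<^sup>2. ?f (gap k w) - ?c) / (real m)\<^sup>2"
        using elim(1) by (rule order_tendstoD) (use c0 in simp)
      moreover have "\<forall>\<^sub>F m in sequentially. max 1 (2 * Z / ?c) \<le> real m"
        using filterlim_real_sequentially unfolding filterlim_at_top by blast
      ultimately have "\<forall>\<^sub>F m in sequentially. - (?c / 2) < (\<Sum>k<m\<^sup>2. ?f (gap k w) - ?c) / (real m)\<^sup>2 \<and> max 1 (2 * Z / ?c) \<le> real m"
        by (rule eventually_conj)
      then obtain m where m: "- (?c / 2) < (\<Sum>k<m\<^sup>2. ?f (gap k w) - ?c) / (real m)\<^sup>2" "1 \<le> real m" "2 * Z / ?c \<le> real m"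
        unfolding eventually_sequentially by auto
      have m2: "0 < (real m)\<^sup>2" using m(2) by simp
      have "- (?c / 2) * (real m)\<^sup>2 < (\<Sum>k<m\<^sup>2. ?f (gap k w)) - (real m)\<^sup>2 * ?c"
        using m(1) m2 by (simp add: pos_less_divide_eq sum_subtractf)
      moreover have "(\<Sum>k<m\<^sup>2. ?f (gap k w)) \<le> (\<Sum>k<m\<^sup>2. gap k w)"
        using elim(2) exp_ge_add_one_self[of "- gap _ w"]
        by (intro sum_mono) (smt (verit, best) max_def exp_ge_add_one_self)
      ultimately have "?c / 2 * (real m)\<^sup>2 \<le> T (m\<^sup>2) w"
        using elim(3) unfolding T_sum_gap[of "m\<^sup>2"] by (simp add: algebra_simps)
      moreover have "Z \<le> ?c / 2 * (real m)\<^sup>2"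
      proof -
        have "Z \<le> ?c / 2 * real m" using m(3) c0 by (simp add: field_simps)
        also have "\<dots> \<le> ?c / 2 * (real m)\<^sup>2"
          by (rule mult_left_mono) (use m(2) c0 in \<open>auto simp: power2_eq_square\<close>)
        finally show ?thesis .
      qed
      ultimately have "Z \<le> T k w" if "m\<^sup>2 \<le> k" for k using mono[OF that] by linarith
      then show "\<forall>\<^sub>F k in sequentially. Z \<le> T k w"
        unfolding eventually_sequentially by blast
    qed
    then show ?case
      using elim step Dep_0 Dep_mono Dep_right_continuous by unfold_locales auto
  qed
qed

end

text \<open>Fixes a witness \<open>q\<close> for the existential statement in \<open>service_rates\<close>.\<close>

locale GMn1_service = GMn1_queue M G lam mu N0 T Dep
  for M :: "'w measure" and G :: "real measure" and lam :: real and mu :: "nat \<Rightarrow> real"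
    and N0 :: "'w \<Rightarrow> nat" and T :: "nat \<Rightarrow> 'w \<Rightarrow> real" and Dep :: "real \<Rightarrow> 'w \<Rightarrow> nat" +
  fixes q :: "nat \<Rightarrow> real \<Rightarrow> nat pmf"
  assumes service: "\<And>n t h B i. 1 \<le> n \<Longrightarrow> 0 \<le> t \<Longrightarrow> 0 < h \<Longrightarrow> B \<in> past M N0 T Dep t \<Longrightarrow>
      B \<subseteq> {w \<in> space M. qlen t w = n \<and> (\<forall>k. \<not> (t < T k w \<and> T k w \<le> t + h))} \<Longrightarrow>
      prob (B \<inter> {w \<in> space M. Dep (t + h) w - Dep t w = i}) = prob B * pmf (q n h) i"
    and service_single: "\<And>n. 1 \<le> n \<Longrightarrow> (\<lambda>h. pmf (q n h) 1 - mu n * h) \<in> o[at_right 0](\<lambda>h. h)"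
    and service_multiple: "\<And>n. 1 \<le> n \<Longrightarrow> (\<lambda>h. measure_pmf.prob (q n h) {2..}) \<in> o[at_right 0](\<lambda>h. h)"
begin

lemma mesh_tendsto: "filterlim (\<lambda>R. 1 / real R) (at_right 0) sequentially"
  unfolding filterlim_at using lim_1_over_n
  by (auto simp: eventually_sequentially intro!: exI[of _ 1])

lemma single_rate:
  assumes "1 \<le> n"
  shows "(\<lambda>R. real R * pmf (q n (1 / real R)) 1) \<longlonglongrightarrow> mu n"
proof -
  have "((\<lambda>h. (pmf (q n h) 1 - mu n * h) / h) \<longlongrightarrow> 0) (at_right 0)"
    using service_single[OF assms] by (rule smalloD_tendsto)
  then have "(\<lambda>R. (pmf (q n (1 / real R)) 1 - mu n * (1 / real R)) / (1 / real R)) \<longlonglongrightarrow> 0"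
    by (rule filterlim_compose[OF _ mesh_tendsto])
  then have "(\<lambda>R. (pmf (q n (1 / real R)) 1 - mu n * (1 / real R)) / (1 / real R) + mu n) \<longlonglongrightarrow> 0 + mu n"
    by (intro tendsto_add tendsto_const)
  moreover have "\<forall>\<^sub>F R in sequentially. (pmf (q n (1 / real R)) 1 - mu n * (1 / real R)) / (1 / real R) + mu n
      = real R * pmf (q n (1 / real R)) 1"
    by (auto simp: eventually_sequentially field_simps intro!: exI[of _ 1])
  ultimately have "(\<lambda>R. real R * pmf (q n (1 / real R)) 1) \<longlonglongrightarrow> 0 + mu n"
    by (rule Lim_transform_eventually)
  then show ?thesis by simp
qed

lemma multiple_rate:
  assumes "1 \<le> n"
  shows "(\<lambda>R. real R * measure_pmf.prob (q n (1 / real R)) {2..}) \<longlonglongrightarrow> 0"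
proof -
  have "((\<lambda>h. measure_pmf.prob (q n h) {2..} / h) \<longlongrightarrow> 0) (at_right 0)"
    using service_multiple[OF assms] by (rule smalloD_tendsto)
  then have "(\<lambda>R. measure_pmf.prob (q n (1 / real R)) {2..} / (1 / real R)) \<longlonglongrightarrow> 0"
    by (rule filterlim_compose[OF _ mesh_tendsto])
  then show ?thesis by (simp add: mult.commute)
qed

lemma Dep_M[measurable]: "0 \<le> u \<Longrightarrow> Dep u \<in> M \<rightarrow>\<^sub>M count_space UNIV"
  by (rule Dep_measurable)

lemma queue_length_M[measurable]: "0 \<le> u \<Longrightarrow> qlen u \<in> M \<rightarrow>\<^sub>M count_space UNIV"
  by (rule measurable_Past_M[OF queue_length_Past[of u u]]) auto

lemma service_quiet:
  assumes "1 \<le> n" "0 \<le> t" "0 < h" "A \<in> sets (Past t)"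
  shows "prob {w \<in> A. quiet T t h w \<and> qlen t w = n \<and> Dep (t + h) w - Dep t w = i}
    = prob {w \<in> A. quiet T t h w \<and> qlen t w = n} * pmf (q n h) i"
proof -
  let ?B = "{w \<in> A. quiet T t h w \<and> qlen t w = n}"
  have [measurable]: "qlen t \<in> Past t \<rightarrow>\<^sub>M count_space UNIV"
    by (rule queue_length_Past) (use assms in auto)
  have A: "A \<subseteq> space M" using sets.sets_into_space[OF assms(4)] by simp
  have "{w \<in> space (Past t). quiet T t h w \<and> qlen t w = n} \<in> sets (Past t)"
    by measurable
  then have "A \<inter> {w \<in> space (Past t). quiet T t h w \<and> qlen t w = n} \<in> sets (Past t)"
    using assms(4) by blast
  moreover have "A \<inter> {w \<in> space (Past t). quiet T t h w \<and> qlen t w = n} = ?B"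
    using A by auto
  ultimately have B: "?B \<in> past M N0 T Dep t" by (simp add: sets_Past)
  have "prob (?B \<inter> {w \<in> space M. Dep (t + h) w - Dep t w = i}) = prob ?B * pmf (q n h) i"
    by (rule service[OF assms(1-3) B]) (use A in \<open>auto simp: quiet_def\<close>)
  moreover have "?B \<inter> {w \<in> space M. Dep (t + h) w - Dep t w = i}
      = {w \<in> A. quiet T t h w \<and> qlen t w = n \<and> Dep (t + h) w - Dep t w = i}"
    using A by auto
  ultimately show ?thesis by simp
qed

text \<open>The law \<open>q 0 h\<close> is arbitrary. With the point mass at \<open>0\<close> in its place the window property holds for
  all queue lengths, since \<open>Dep\<close> never exceeds the number of customers so far.\<close>

definition service_law :: "nat \<Rightarrow> real \<Rightarrow> nat pmf" where
  "service_law n h = (if n = 0 then return_pmf 0 else q n h)"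

lemma service_law_quiet:
  assumes "0 \<le> t" "0 < h" "A \<in> sets (Past t)"
  shows "prob {w \<in> A. quiet T t h w \<and> qlen t w = n \<and> Dep (t + h) w - Dep t w = i}
    = prob {w \<in> A. quiet T t h w \<and> qlen t w = n} * pmf (service_law n h) i"
proof (cases "n = 0")
  case False
  then show ?thesis using service_quiet[OF _ assms, of n i] by (simp add: service_law_def)
next
  case True
  have [measurable]: "A \<in> sets M" using assms Past_sub by blast
  have [measurable]: "Dep t \<in> M \<rightarrow>\<^sub>M count_space UNIV" "Dep (t + h) \<in> M \<rightarrow>\<^sub>M count_space UNIV"
    "qlen t \<in> M \<rightarrow>\<^sub>M count_space UNIV"
    using assms by auto
  have "AE w in M. quiet T t h w \<and> qlen t w = 0 \<longrightarrow> Dep (t + h) w - Dep t w = 0"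
    using path_AE
  proof eventually_elim
    case (elim w)
    interpret queue_path N0 T Dep w by (rule elim)
    show ?case
      using quiet_iff[of h t] D_le[of "t + h"] assms by (auto simp: queue_length_def)
  qed
  then have "AE w in M. (w \<in> {w \<in> A. quiet T t h w \<and> qlen t w = n \<and> Dep (t + h) w - Dep t w = i}) =
     (w \<in> (if i = 0 then {w \<in> A. quiet T t h w \<and> qlen t w = n} else {}))"
    by eventually_elim (use True in auto)
  then have "prob {w \<in> A. quiet T t h w \<and> qlen t w = n \<and> Dep (t + h) w - Dep t w = i}
    = prob (if i = 0 then {w \<in> A. quiet T t h w \<and> qlen t w = n} else {})"
  proof (rule measure_eq_AE)
    show "{w \<in> A. quiet T t h w \<and> qlen t w = n \<and> Dep (t + h) w - Dep t w = i} \<in> sets M"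
      by measurable
    have "{w \<in> A. quiet T t h w \<and> qlen t w = n} \<in> sets M"
      by measurable
    then show "(if i = 0 then {w \<in> A. quiet T t h w \<and> qlen t w = n} else {}) \<in> sets M"
      by simp
  qed
  then show ?thesis using True by (simp add: service_law_def)
qed

lemma Past_subalgebra: "0 \<le> t \<Longrightarrow> finite_measure_subalgebra M (Past t)"
  by unfold_locales (auto simp: subalgebra_def Past_sub)

text \<open>The window property for events of the past, restated as the conditional expectation of the number
  of completions given the past. It allows random factors \<open>\<zeta>\<close> that depend on the past, in particular
  on the whole arrival stream.\<close>

lemma service_expectation:
  fixes \<zeta> :: "'w \<Rightarrow> real"
  assumes t: "0 \<le> t" and h: "0 < h" and \<zeta>[measurable]: "\<zeta> \<in> borel_measurable (Past t)" and bd: "\<And>w. \<bar>\<zeta> w\<bar> \<le> B"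
  shows "expectation (\<lambda>w. if quiet T t h w \<and> Dep (t + h) w - Dep t w = i then \<zeta> w else 0)
    = expectation (\<lambda>w. if quiet T t h w then \<zeta> w * pmf (service_law (qlen t w) h) i else 0)"
proof -
  interpret F: finite_measure_subalgebra M "Past t" by (rule Past_subalgebra[OF t])
  have Q[measurable]: "qlen t \<in> Past t \<rightarrow>\<^sub>M count_space UNIV"
    by (rule queue_length_Past) (use t in auto)
  have [measurable]: "Dep t \<in> M \<rightarrow>\<^sub>M count_space UNIV" "Dep (t + h) \<in> M \<rightarrow>\<^sub>M count_space UNIV"
    "qlen t \<in> M \<rightarrow>\<^sub>M count_space UNIV" "\<zeta> \<in> borel_measurable M"
    using t h measurable_Past_M[OF \<zeta> t] by auto
  define f where "f w = (if quiet T t h w \<and> Dep (t + h) w - Dep t w = i then 1 else 0 :: real)" for w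
  define g where "g w = (if quiet T t h w then pmf (service_law (qlen t w) h) i else 0)" for w
  have [measurable]: "f \<in> borel_measurable M" unfolding f_def by measurable
  have [measurable]: "g \<in> borel_measurable (Past t)" unfolding g_def by measurable
  have [measurable]: "g \<in> borel_measurable M" unfolding g_def by measurable
  have fg1: "\<bar>f w\<bar> \<le> 1" "\<bar>g w\<bar> \<le> 1" for w by (auto simp: f_def g_def pmf_le_1)
  have intf: "integrable M f" and intg: "integrable M g"
    using fg1 by (auto intro!: integrable_bounded[where B=1])
  have "AE w in M. real_cond_exp M (Past t) f w = g w"
  proof (rule F.real_cond_exp_charact[OF _ intf intg])
    fix A assume A: "A \<in> sets (Past t)"
    then have [measurable]: "A \<in> sets M" using Past_sub[OF t] by blast
    have "expectation (\<lambda>w. indicator A w *\<^sub>R f w) = expectation (\<lambda>w. indicator A w *\<^sub>R g w)"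
    proof (rule expectation_cong_pieces[where X="qlen t"])
      show "integrable M (\<lambda>w. indicator A w *\<^sub>R f w)" "integrable M (\<lambda>w. indicator A w *\<^sub>R g w)"
        using intf intg by (auto intro!: integrable_mult_indicator simp del: real_scaleR_def)
      fix n
      let ?B = "{w \<in> A. quiet T t h w \<and> qlen t w = n}"
      have B: "?B \<in> sets M" "{w \<in> A. quiet T t h w \<and> qlen t w = n \<and> Dep (t + h) w - Dep t w = i} \<in> sets M"
        by measurable
      have "expectation (\<lambda>w. if qlen t w = n then indicator A w *\<^sub>R f w else 0)
        = expectation (indicator {w \<in> A. quiet T t h w \<and> qlen t w = n \<and> Dep (t + h) w - Dep t w = i})"
        by (rule Bochner_Integration.integral_cong) (auto simp: f_def indicator_def)
      also have "\<dots> = prob ?B * pmf (service_law n h) i"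
        using B service_law_quiet[OF t h A] by simp
      also have "\<dots> = expectation (\<lambda>w. indicator ?B w * pmf (service_law n h) i)"
        using B by simp
      also have "\<dots> = expectation (\<lambda>w. if qlen t w = n then indicator A w *\<^sub>R g w else 0)"
        by (rule Bochner_Integration.integral_cong) (auto simp: g_def indicator_def)
      finally show "expectation (\<lambda>w. if qlen t w = n then indicator A w *\<^sub>R f w else 0)
        = expectation (\<lambda>w. if qlen t w = n then indicator A w *\<^sub>R g w else 0)" .
    qed measurable
    then show "(LINT w:A|M. f w) = (LINT w:A|M. g w)"
      unfolding set_lebesgue_integral_def .
  qed simp
  then have ce: "AE w in M. \<zeta> w * real_cond_exp M (Past t) f w = \<zeta> w * g w"
    by eventually_elim simp
  have "integrable M (\<lambda>w. \<zeta> w * f w)"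
    using mult_mono[OF bd fg1(1)] by (intro integrable_bounded[where B="B * 1"]) (auto simp: abs_mult intro: order_trans[OF abs_ge_zero bd])
  then have "expectation (\<lambda>w. \<zeta> w * f w) = expectation (\<lambda>w. \<zeta> w * real_cond_exp M (Past t) f w)"
    by (rule F.real_cond_exp_intg(2)[symmetric]) auto
  also have "\<dots> = expectation (\<lambda>w. \<zeta> w * g w)"
    using ce by (intro integral_cong_AE) auto
  finally show ?thesis
    unfolding f_def g_def by (simp add: if_distrib[of "\<lambda>x. _ * x"] cong: if_cong)
qed

text \<open>Over \<open>m * R\<close> windows of length \<open>1 / R\<close>, each with two or more completions with probability
  \<open>o(1 / R)\<close>, the union bound tends to zero.\<close>

lemma no_double_jumps:
  assumes n: "1 \<le> n"
  shows "AE w in M. \<not> (\<exists>R0. \<forall>R\<ge>R0. \<exists>i<m * R. quiet T (real i / real R) (1 / real R) w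
    \<and> qlen (real i / real R) w = n
    \<and> 2 \<le> Dep (real (Suc i) / real R) w - Dep (real i / real R) w)"
proof -
  define W where "W R i = {w \<in> space M. quiet T (real i / real R) (1 / real R) w
    \<and> qlen (real i / real R) w = n
    \<and> 2 \<le> Dep (real (Suc i) / real R) w - Dep (real i / real R) w}" for R i
  define E where "E R = (\<Union>i<m * R. W R i)" for R
  have [measurable]: "W R i \<in> sets M" for R i
    unfolding W_def by measurable
  have [measurable]: "E R \<in> sets M" for R unfolding E_def by measurable
  have W: "prob (W R i) \<le> measure_pmf.prob (q n (1 / real R)) {2..}" if R: "0 < R" for R i
  proof -
    let ?t = "real i / real R" and ?h = "1 / real R"
    let ?B = "{w \<in> space M. quiet T ?t ?h w \<and> qlen ?t w = n}"
    let ?C = "\<lambda>i. {w \<in> space M. quiet T ?t ?h w \<and> qlen ?t w = n \<and> Dep (?t + ?h) w - Dep ?t w = i}"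
    have th: "0 \<le> ?t" "0 < ?h" using R by auto
    have [measurable]: "Dep (?t + ?h) \<in> M \<rightarrow>\<^sub>M count_space UNIV" using th by (intro Dep_M) linarith
    have m: "?B \<in> events" "?C i \<in> events" for i by measurable
    have C: "prob (?C i) = prob ?B * pmf (q n ?h) i" for i
      using service_quiet[OF n th, of "space M" i] sets.top[of "Past ?t"] by simp
    have "?B = W R i \<union> (?C 0 \<union> ?C 1)" unfolding W_def grid_Suc by auto
    moreover have "prob (W R i \<union> (?C 0 \<union> ?C 1)) = prob (W R i) + (prob (?C 0) + prob (?C 1))"
    proof -
      have "prob (W R i \<union> (?C 0 \<union> ?C 1)) = prob (W R i) + prob (?C 0 \<union> ?C 1)"
      proof (rule finite_measure_Union)
        show "?C 0 \<union> ?C 1 \<in> events" by (intro sets.Un m)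
        show "W R i \<inter> (?C 0 \<union> ?C 1) = {}" unfolding W_def grid_Suc by auto
      qed simp
      also have "prob (?C 0 \<union> ?C 1) = prob (?C 0) + prob (?C 1)"
        by (rule finite_measure_Union[OF m(2) m(2)]) auto
      finally show ?thesis .
    qed
    ultimately have "prob (W R i) = prob ?B * (1 - pmf (q n ?h) 0 - pmf (q n ?h) 1)"
      using C[of 0] C[of 1] by (simp add: algebra_simps)
    also have "1 - pmf (q n ?h) 0 - pmf (q n ?h) 1 = measure_pmf.prob (q n ?h) {2..}"
    proof -
      have "measure_pmf.prob (q n ?h) (UNIV - {0, 1}) = 1 - measure_pmf.prob (q n ?h) {0, 1}"
        using measure_pmf.prob_compl[of "{0, 1}" "q n ?h"] by simp
      moreover have "measure_pmf.prob (q n ?h) {0, 1} = pmf (q n ?h) 0 + pmf (q n ?h) 1"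
        by (simp add: measure_measure_pmf_finite)
      moreover have "UNIV - {0, 1} = {2::nat..}" by auto
      ultimately show ?thesis by simp
    qed
    also have "prob ?B * \<dots> \<le> 1 * \<dots>" by (rule mult_right_mono) auto
    finally show ?thesis by simp
  qed
  have E: "prob (E R) \<le> real m * (real R * measure_pmf.prob (q n (1 / real R)) {2..})" if R: "0 < R" for R
  proof -
    have "prob (E R) \<le> (\<Sum>i<m * R. prob (W R i))"
      unfolding E_def by (rule finite_measure_subadditive_finite) auto
    also have "\<dots> \<le> (\<Sum>i<m * R. measure_pmf.prob (q n (1 / real R)) {2..})"
      by (rule sum_mono) (rule W[OF R])
    finally show ?thesis by simp
  qed
  have lim: "(\<lambda>R. real m * (real R * measure_pmf.prob (q n (1 / real R)) {2..})) \<longlonglongrightarrow> real m * 0"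
    by (intro tendsto_mult tendsto_const multiple_rate n)
  have "AE w in M. \<not> (\<forall>R\<ge>R0. w \<in> E R)" for R0
  proof -
    have le: "prob (\<Inter>R\<in>{R0..}. E R) \<le> prob (E R)" if "R0 \<le> R" for R
      by (rule finite_measure_mono) (use that in auto)
    have "prob (\<Inter>R\<in>{R0..}. E R) \<le> real m * 0"
    proof (rule LIMSEQ_le_const[OF lim], intro exI allI impI)
      fix R assume "max 1 R0 \<le> R"
      then show "prob (\<Inter>R\<in>{R0..}. E R) \<le> real m * (real R * measure_pmf.prob (q n (1 / real R)) {2..})"
        using le[of R] E[of R] by simp
    qed
    then have "prob (\<Inter>R\<in>{R0..}. E R) = 0" using measure_nonneg[of M] by (simp add: antisym)
    then have "AE w in M. w \<notin> (\<Inter>R\<in>{R0..}. E R)"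
      by (subst (asm) prob_eq_0) auto
    then show ?thesis by eventually_elim auto
  qed
  then have "AE w in M. \<forall>R0. \<not> (\<forall>R\<ge>R0. w \<in> E R)"
    by (simp add: AE_all_countable)
  then show ?thesis
    using AE_space
  proof eventually_elim
    case (elim w)
    have "w \<in> E R \<longleftrightarrow> (\<exists>i<m * R. quiet T (real i / real R) (1 / real R) w
      \<and> qlen (real i / real R) w = n
      \<and> 2 \<le> Dep (real (Suc i) / real R) w - Dep (real i / real R) w)" for R
      unfolding E_def W_def using elim(2) by blast
    then show ?case using elim(1) by simp
  qed
qed

lemma simple_path_AE: "AE w in M. simple_queue_path N0 T Dep w"
proof -
  have "AE w in M. \<forall>n m. 1 \<le> n \<longrightarrow> \<not> (\<exists>R0. \<forall>R\<ge>R0. \<exists>i<m * R. quiet T (real i / real R) (1 / real R) w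
    \<and> qlen (real i / real R) w = n
    \<and> 2 \<le> Dep (real (Suc i) / real R) w - Dep (real i / real R) w)"
    unfolding AE_all_countable
  proof (intro allI)
    fix n m
    show "AE w in M. 1 \<le> n \<longrightarrow> \<not> (\<exists>R0. \<forall>R\<ge>R0. \<exists>i<m * R. quiet T (real i / real R) (1 / real R) w
      \<and> qlen (real i / real R) w = n
      \<and> 2 \<le> Dep (real (Suc i) / real R) w - Dep (real i / real R) w)"
      using no_double_jumps[of n m] by (cases "1 \<le> n") auto
  qed
  then show ?thesis
    using path_AE
  proof eventually_elim
    case (elim w)
    interpret queue_path N0 T Dep w by (rule elim)
    show ?case
      by unfold_locales (use double_jump_windows elim(1) in blast)
  qed
qed

end

section \<open>Departures and their compensator\<close>

lemma tendsto_of_error_bound: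
  fixes f :: "nat \<Rightarrow> real"
  assumes "\<And>R. R0 \<le> R \<Longrightarrow> \<bar>l - f R\<bar> \<le> c / real R"
  shows "f \<longlonglongrightarrow> l"
proof (rule LIM_zero_cancel, rule Lim_null_comparison)
  show "\<forall>\<^sub>F R in sequentially. norm (f R - l) \<le> c * (1 / real R)"
    unfolding eventually_sequentially using assms by (auto simp: abs_minus_commute intro!: exI[of _ R0])
  have "(\<lambda>R. c * (1 / real R)) \<longlonglongrightarrow> c * 0"
    by (intro tendsto_mult tendsto_const lim_1_over_n)
  then show "(\<lambda>R. c * (1 / real R)) \<longlonglongrightarrow> 0" by simp
qed

lemma compensated_indicator_bound: "\<bar>(if P then 1 else 0) - pmf N i\<bar> \<le> 1"
proof (cases P)
  case True
  then show ?thesis using pmf_nonneg[of N i] pmf_le_1[of N i] unfolding if_P[OF True] by linarith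
next
  case False
  then show ?thesis using pmf_nonneg[of N i] pmf_le_1[of N i] unfolding if_not_P[OF False] by linarith
qed

context GMn1_service
begin

text \<open>The completions in a window, centred by their conditional probability, are orthogonal to
  everything in the past.\<close>

lemma compensated_service:
  fixes \<zeta> :: "'w \<Rightarrow> real"
  assumes t: "0 \<le> t" and h: "0 < h" and \<zeta>[measurable]: "\<zeta> \<in> borel_measurable (Past t)" and bd: "\<And>w. \<bar>\<zeta> w\<bar> \<le> B"
  shows "expectation (\<lambda>w. if quiet T t h w \<and> qlen t w = Suc n
      then \<zeta> w * ((if Dep (t + h) w - Dep t w = 1 then 1 else 0) - pmf (q (Suc n) h) 1) else 0) = 0"
proof -
  have [measurable]: "qlen t \<in> Past t \<rightarrow>\<^sub>M count_space UNIV"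
    by (rule queue_length_Past) (use t in auto)
  have [measurable]: "Dep t \<in> M \<rightarrow>\<^sub>M count_space UNIV" "Dep (t + h) \<in> M \<rightarrow>\<^sub>M count_space UNIV"
    "qlen t \<in> M \<rightarrow>\<^sub>M count_space UNIV" "\<zeta> \<in> borel_measurable M"
    using t h measurable_Past_M[OF \<zeta> t] by auto
  let ?p = "pmf (q (Suc n) h) 1"
  define \<eta> where "\<eta> w = (if qlen t w = Suc n then \<zeta> w else 0)" for w
  have B: "0 \<le> B" using order_trans[OF abs_ge_zero bd] by blast
  have \<eta>[measurable]: "\<eta> \<in> borel_measurable (Past t)" unfolding \<eta>_def by measurable
  have [measurable]: "\<eta> \<in> borel_measurable M" unfolding \<eta>_def by measurable
  have bd': "\<bar>\<eta> w\<bar> \<le> B" for w using bd[of w] B by (simp add: \<eta>_def)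
  have bp: "\<bar>\<eta> w * ?p\<bar> \<le> B" for w
    unfolding abs_mult using mult_mono[OF bd'[of w], of "\<bar>?p\<bar>" 1] B by (simp add: pmf_le_1)
  define f1 where "f1 w = (if quiet T t h w \<and> Dep (t + h) w - Dep t w = 1 then \<eta> w else 0)" for w
  define f2 where "f2 w = (if quiet T t h w then \<eta> w * ?p else 0)" for w
  have [measurable]: "f1 \<in> borel_measurable M" unfolding f1_def by measurable
  have [measurable]: "f2 \<in> borel_measurable M" unfolding f2_def by measurable
  have i: "integrable M f1" "integrable M f2"
    using bp bd' B by (auto intro!: integrable_bounded[where B=B] simp: f1_def f2_def)
  have "expectation f1 = expectation (\<lambda>w. if quiet T t h w then \<eta> w * pmf (service_law (qlen t w) h) 1 else 0)"
    unfolding f1_def by (rule service_expectation[OF t h \<eta> bd'])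
  also have "\<dots> = expectation f2"
    by (rule Bochner_Integration.integral_cong) (auto simp: f2_def \<eta>_def service_law_def)
  finally have "expectation (\<lambda>w. f1 w - f2 w) = 0" using i by simp
  moreover have "(\<lambda>w. f1 w - f2 w) = (\<lambda>w. if quiet T t h w \<and> qlen t w = Suc n
      then \<zeta> w * ((if Dep (t + h) w - Dep t w = 1 then 1 else 0) - ?p) else 0)"
    by (auto simp: fun_eq_iff f1_def f2_def \<eta>_def algebra_simps)
  ultimately show ?thesis by simp
qed

text \<open>The martingale differences of the number of departures leaving \<open>n\<close>, weighted by \<open>g\<close>.\<close>

definition service_deviation :: "nat \<Rightarrow> (real \<Rightarrow> real) \<Rightarrow> nat \<Rightarrow> nat \<Rightarrow> 'w \<Rightarrow> real" where
  "service_deviation n g R i w =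
    (if quiet T (real i / real R) (1 / real R) w \<and> qlen (real i / real R) w = Suc n
     then g (residual T (real i / real R) w) *
       ((if Dep (real (Suc i) / real R) w - Dep (real i / real R) w = 1 then 1 else 0) - pmf (q (Suc n) (1 / real R)) 1)
     else 0)"

lemma service_deviation_Past:
  assumes [measurable]: "g \<in> borel_measurable borel" and "real (Suc i) / real R \<le> t"
  shows "service_deviation n g R i \<in> borel_measurable (Past t)"
proof -
  have le: "0 \<le> real i / real R" "real i / real R \<le> t" "0 \<le> real (Suc i) / real R"
    using assms(2) by (auto simp: add_divide_distrib intro: order_trans[rotated])
  have [measurable]: "Dep (real i / real R) \<in> Past t \<rightarrow>\<^sub>M count_space UNIV"
    "Dep (real (Suc i) / real R) \<in> Past t \<rightarrow>\<^sub>M count_space UNIV"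
    "qlen (real i / real R) \<in> Past t \<rightarrow>\<^sub>M count_space UNIV"
    using Dep_Past queue_length_Past le assms(2) by blast+
  show ?thesis unfolding service_deviation_def by measurable
qed

lemma service_deviation_bound:
  assumes "\<And>x. \<bar>g x\<bar> \<le> 1"
  shows "\<bar>service_deviation n g R i w\<bar> \<le> 1"
proof -
  let ?p = "pmf (q (Suc n) (1 / real R)) 1"
  have "\<bar>g (residual T (real i / real R) w) * ((if P then 1 else 0) - ?p)\<bar> \<le> 1 * 1" for P
    unfolding abs_mult by (intro mult_mono assms compensated_indicator_bound) auto
  then show ?thesis unfolding service_deviation_def by auto
qed

lemma service_deviation_orthogonal:
  assumes g[measurable]: "g \<in> borel_measurable borel" and gb: "\<And>x. \<bar>g x\<bar> \<le> 1" and R: "0 < R" and ij: "i < j"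
  shows "expectation (\<lambda>w. service_deviation n g R i w * service_deviation n g R j w) = 0"
proof -
  let ?t = "real j / real R"
  have "real (Suc i) / real R \<le> ?t" using ij by (intro divide_right_mono) auto
  then have [measurable]: "service_deviation n g R i \<in> borel_measurable (Past ?t)"
    by (intro service_deviation_Past g)
  have "expectation (\<lambda>w. if quiet T ?t (1 / real R) w \<and> qlen ?t w = Suc n
      then (service_deviation n g R i w * g (residual T ?t w)) *
        ((if Dep (?t + 1 / real R) w - Dep ?t w = 1 then 1 else 0) - pmf (q (Suc n) (1 / real R)) 1) else 0) = 0"
  proof (rule compensated_service)
    show "\<bar>service_deviation n g R i w * g (residual T ?t w)\<bar> \<le> 1 * 1" for w
      unfolding abs_mult by (intro mult_mono service_deviation_bound gb) auto
  qed (use R in auto)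
  moreover have "(\<lambda>w. service_deviation n g R i w * service_deviation n g R j w) =
    (\<lambda>w. if quiet T ?t (1 / real R) w \<and> qlen ?t w = Suc n
      then (service_deviation n g R i w * g (residual T ?t w)) *
        ((if Dep (?t + 1 / real R) w - Dep ?t w = 1 then 1 else 0) - pmf (q (Suc n) (1 / real R)) 1) else 0)"
    unfolding service_deviation_def[of n g R j] grid_Suc by (auto simp: fun_eq_iff)
  ultimately show ?thesis by simp
qed

text \<open>With \<open>x\<close> the indicator of one completion and \<open>p\<close> its probability,
  \<open>(x - p)\<^sup>2 = (1 - 2 * p) * (x - p) + (p - p\<^sup>2)\<close>; the first summand has mean zero by
  \<open>compensated_service\<close>.\<close>

lemma service_deviation_square:
  assumes g[measurable]: "g \<in> borel_measurable borel" and gb: "\<And>x. \<bar>g x\<bar> \<le> 1" and R: "0 < R"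
  shows "expectation (\<lambda>w. (service_deviation n g R i w)\<^sup>2) \<le> pmf (q (Suc n) (1 / real R)) 1"
proof -
  let ?t = "real i / real R" and ?p = "pmf (q (Suc n) (1 / real R)) 1"
  have p: "0 \<le> ?p" "?p \<le> 1" by (auto simp: pmf_le_1)
  have t0: "0 \<le> ?t" "0 < 1 / real R" using R by auto
  have [measurable]: "Dep ?t \<in> M \<rightarrow>\<^sub>M count_space UNIV" "Dep (?t + 1 / real R) \<in> M \<rightarrow>\<^sub>M count_space UNIV"
    "qlen ?t \<in> M \<rightarrow>\<^sub>M count_space UNIV"
    using t0 by (auto intro!: Dep_M queue_length_M add_nonneg_nonneg)
  have dm: "service_deviation n g R i \<in> borel_measurable M"
    by (rule measurable_Past_M[OF service_deviation_Past[OF g order_refl]]) simp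
  have gs: "(g x)\<^sup>2 \<le> 1" for x using gb[of x] by (simp add: abs_square_le_1)
  define h where "h w = (if quiet T ?t (1 / real R) w \<and> qlen ?t w = Suc n
      then ((g (residual T ?t w))\<^sup>2 * (1 - 2 * ?p)) *
        ((if Dep (?t + 1 / real R) w - Dep ?t w = 1 then 1 else 0) - ?p) else 0)" for w
  have c1: "\<bar>(g x)\<^sup>2 * (1 - 2 * ?p)\<bar> \<le> 1 * 1" for x
  proof -
    have "\<bar>1 - 2 * ?p\<bar> \<le> 1" using p by linarith
    then show ?thesis unfolding abs_mult using gs[of x] by (intro mult_mono) auto
  qed
  have h0: "expectation h = 0"
    unfolding h_def by (rule compensated_service[where B="1 * 1"]) (use t0 c1 in auto)
  have [measurable]: "h \<in> borel_measurable M" unfolding h_def by measurable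
  have hb: "\<bar>h w\<bar> \<le> 1" for w
  proof -
    have "\<bar>((g x)\<^sup>2 * (1 - 2 * ?p)) * ((if P then 1 else 0) - ?p)\<bar> \<le> (1 * 1) * 1" for P x
      unfolding abs_mult[of _ "_ - ?p"] by (intro mult_mono c1 compensated_indicator_bound) auto
    then show ?thesis unfolding h_def by auto
  qed
  have le: "(service_deviation n g R i w)\<^sup>2 \<le> h w + ?p" for w
  proof -
    define a where "a = (g (residual T ?t w))\<^sup>2"
    have a: "0 \<le> a" "a \<le> 1" using gs by (auto simp: a_def)
    have "a * (?p - ?p\<^sup>2) \<le> 1 * ?p"
      using a p by (intro mult_mono) (auto simp: power2_eq_square mult_left_le)
    moreover have "a * (x - ?p)\<^sup>2 = a * (1 - 2 * ?p) * (x - ?p) + a * (?p - ?p\<^sup>2)" if "x = 0 \<or> x = 1" for x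
      using that by (auto simp: power2_eq_square algebra_simps)
    ultimately have "a * (x - ?p)\<^sup>2 \<le> a * (1 - 2 * ?p) * (x - ?p) + ?p" if "x = 0 \<or> x = 1" for x
      using that by (smt (verit))
    from this[of 1] this[of 0] show ?thesis
      unfolding service_deviation_def h_def grid_Suc using p by (auto simp: power_mult_distrib a_def)
  qed
  have "expectation (\<lambda>w. (service_deviation n g R i w)\<^sup>2) \<le> expectation (\<lambda>w. h w + ?p)"
  proof (rule integral_mono)
    show "integrable M (\<lambda>w. (service_deviation n g R i w)\<^sup>2)"
      using dm service_deviation_bound[OF gb] by (intro integrable_bounded[where B=1]) (auto simp: abs_square_le_1)
    show "integrable M (\<lambda>w. h w + ?p)"
    proof (rule integrable_bounded)
      show "\<bar>h w + ?p\<bar> \<le> 2" for w using hb[of w] p by linarith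
    qed simp
  qed (rule le)
  also have "\<dots> = ?p"
    using h0 hb by (subst Bochner_Integration.integral_add) (auto intro!: integrable_bounded[where B=1] simp: prob_space)
  finally show ?thesis .
qed

definition grid_departures :: "nat \<Rightarrow> (real \<Rightarrow> real) \<Rightarrow> nat \<Rightarrow> nat \<Rightarrow> 'w \<Rightarrow> real" where
  "grid_departures n g m R w = (\<Sum>i<m * R. if quiet T (real i / real R) (1 / real R) w \<and> qlen (real i / real R) w = Suc n
        \<and> Dep (real (Suc i) / real R) w - Dep (real i / real R) w = 1
        then g (residual T (real i / real R) w) else 0)"

lemma grid_departures_tendsto:
  assumes "simple_queue_path N0 T Dep w" and "\<And>x y. 0 \<le> x \<Longrightarrow> 0 \<le> y \<Longrightarrow> \<bar>g x - g y\<bar> \<le> L * \<bar>x - y\<bar>"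
  shows "(\<lambda>R. grid_departures n g m R w) \<longlonglongrightarrow> dep_sum n g (real m) w"
proof -
  interpret simple_queue_path N0 T Dep w by (rule assms)
  obtain R0 where R0: "\<And>R. R0 \<le> R \<Longrightarrow> \<bar>dep_sum n g (real m) w - grid_departures n g m R w\<bar> \<le> L / real R * real (Dep (real m) w)"
    using grid_departure_sum[where g=g and L=L and n=n and m=m, OF assms(2)] unfolding grid_departures_def[symmetric]
    by blast
  show ?thesis
    by (rule tendsto_of_error_bound[of R0 _ _ "L * real (Dep (real m) w)"]) (use R0 in simp)
qed

text \<open>Departures leaving \<open>n\<close> occur at rate \<open>mu (Suc n)\<close> during the time spent with \<open>n + 1\<close> customers,
  and this remains true after weighting with the residual inter-arrival time, as services do not
  depend on future arrivals. On a grid, the deviations are orthogonal, and their variances add up to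
  about \<open>mu (Suc n)\<close> per unit of time. As the mesh tends to zero the grid sums converge on almost
  every path to the difference of departure sum and compensator.\<close>

lemma departure_martingale:
  fixes g :: "real \<Rightarrow> real"
  assumes g[measurable]: "g \<in> borel_measurable borel" and gb: "\<And>x. \<bar>g x\<bar> \<le> 1"
    and lip: "\<And>x y. 0 \<le> x \<Longrightarrow> 0 \<le> y \<Longrightarrow> \<bar>g x - g y\<bar> \<le> L * \<bar>x - y\<bar>"
  shows "AE w in M. (\<lambda>m. (dep_sum n g (real (m\<^sup>2)) w
      - mu (Suc n) * occ_integral (Suc n) g (real (m\<^sup>2)) w) / (real m)\<^sup>2) \<longlonglongrightarrow> 0"
proof (rule AE_tendsto_0_squares[where U="\<lambda>m R w. \<Sum>i<m\<^sup>2 * R. service_deviation n g R i w" and C="mu (Suc n) + 1"])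
  let ?p = "\<lambda>R. pmf (q (Suc n) (1 / real R)) 1"
  have dm[measurable]: "service_deviation n g R i \<in> borel_measurable M" for R i
    by (rule measurable_Past_M[OF service_deviation_Past[OF g order_refl]]) simp
  show "(\<lambda>w. \<Sum>i<m\<^sup>2 * R. service_deviation n g R i w) \<in> borel_measurable M" for m R by measurable
  have rate: "(\<lambda>R. real R * ?p R) \<longlonglongrightarrow> mu (Suc n)" by (rule single_rate) simp
  have sq: "(\<integral>\<^sup>+ w. ennreal ((\<Sum>i<K. service_deviation n g R i w)\<^sup>2) \<partial>M) \<le> ennreal (real K * ?p R)" if R: "0 < R" for K R
  proof -
    have bS: "\<bar>\<Sum>i<K. service_deviation n g R i w\<bar> \<le> real K" for w
      using sum_norm_le[of "{..<K}" "\<lambda>i. service_deviation n g R i w" "\<lambda>_. 1"] service_deviation_bound[OF gb] by simp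
    have "integrable M (\<lambda>w. (\<Sum>i<K. service_deviation n g R i w)\<^sup>2)"
    proof (rule integrable_bounded)
      show "\<bar>(\<Sum>i<K. service_deviation n g R i w)\<^sup>2\<bar> \<le> (real K)\<^sup>2" for w
        using power_mono[OF bS[of w] abs_ge_zero, of 2] by simp
    qed simp
    then have "(\<integral>\<^sup>+ w. ennreal ((\<Sum>i<K. service_deviation n g R i w)\<^sup>2) \<partial>M)
      = ennreal (expectation (\<lambda>w. (\<Sum>i<K. service_deviation n g R i w)\<^sup>2))"
      by (rule nn_integral_eq_integral) simp
    also have "expectation (\<lambda>w. (\<Sum>i<K. service_deviation n g R i w)\<^sup>2) = (\<Sum>i<K. expectation (\<lambda>w. (service_deviation n g R i w)\<^sup>2))"
      by (rule orthogonal_sum_square[where B=1])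
         (use service_deviation_bound[OF gb] service_deviation_orthogonal[OF g gb R] in auto)
    also have "ennreal \<dots> \<le> ennreal (\<Sum>i<K. ?p R)"
      by (intro ennreal_leI sum_mono service_deviation_square g gb R)
    finally show ?thesis by simp
  qed
  show "\<forall>\<^sub>F R in sequentially. (\<integral>\<^sup>+ w. ennreal ((\<Sum>i<m\<^sup>2 * R. service_deviation n g R i w)\<^sup>2) \<partial>M) \<le> ennreal ((mu (Suc n) + 1) * (real m)\<^sup>2)" for m
  proof -
    have "\<forall>\<^sub>F R in sequentially. real R * ?p R < mu (Suc n) + 1"
      by (rule order_tendstoD(2)[OF rate]) simp
    then show ?thesis
      using eventually_gt_at_top[of "0::nat"]
  proof eventually_elim
    case (elim R)
    have "(real R * ?p R) * (real m)\<^sup>2 \<le> (mu (Suc n) + 1) * (real m)\<^sup>2"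
      by (rule mult_right_mono) (use elim in auto)
    then have "ennreal (real (m\<^sup>2 * R) * ?p R) \<le> ennreal ((mu (Suc n) + 1) * (real m)\<^sup>2)"
      by (intro ennreal_leI) (simp add: mult_ac)
    then show ?case using order_trans[OF sq[of R "m\<^sup>2 * R"]] elim by blast
  qed
  qed
  show "AE w in M. \<forall>m. (\<lambda>R. \<Sum>i<m\<^sup>2 * R. service_deviation n g R i w) \<longlonglongrightarrow>
    dep_sum n g (real (m\<^sup>2)) w - mu (Suc n) * occ_integral (Suc n) g (real (m\<^sup>2)) w"
  proof (rule AE_mp[OF simple_path_AE], rule AE_I2, intro impI allI)
    fix w and m :: nat assume path: "simple_queue_path N0 T Dep w"
    interpret simple_queue_path N0 T Dep w by (rule path)
    let ?m = "m\<^sup>2"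
    define S where "S R = (\<Sum>j<?m * R. if quiet T (real j / real R) (1 / real R) w \<and> qlen (real j / real R) w = Suc n
               then g (residual T (real j / real R) w) else 0)" for R
    have S: "(\<lambda>R. S R / real R) \<longlonglongrightarrow> occ_integral (Suc n) g (real ?m) w"
    proof (rule tendsto_of_error_bound)
      fix R :: nat assume R: "1 \<le> R"
      have e: "real (?m * R) / real R = real ?m" using R by simp
      have "\<bar>occ_integral (Suc n) g (real ?m) w - S R / real R\<bar>
        \<le> real (?m * R) * L / (real R)\<^sup>2 + 2 / real R * (real (Dep (real ?m) w) + real (arrivals T (real ?m) w))"
        using riemann_state[OF g, of L R "Suc n" "?m * R"] gb lip R unfolding e S_def by simp
      also have "\<dots> = (real ?m * L + 2 * (real (Dep (real ?m) w) + real (arrivals T (real ?m) w))) / real R"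
        using R by (simp add: add_divide_distrib power2_eq_square)
      finally show "\<bar>occ_integral (Suc n) g (real ?m) w - S R / real R\<bar> \<le>
        (real ?m * L + 2 * (real (Dep (real ?m) w) + real (arrivals T (real ?m) w))) / real R" .
    qed
    have "(\<lambda>R. grid_departures n g ?m R w - (real R * ?p R) * (S R / real R)) \<longlonglongrightarrow>
      dep_sum n g (real ?m) w - mu (Suc n) * occ_integral (Suc n) g (real ?m) w"
      by (intro tendsto_diff tendsto_mult rate S grid_departures_tendsto[OF path lip])
    moreover have "\<forall>\<^sub>F R in sequentially. grid_departures n g ?m R w - (real R * ?p R) * (S R / real R)
       = (\<Sum>i<?m * R. service_deviation n g R i w)"
      using eventually_gt_at_top[of "0::nat"]
    proof eventually_elim
      case (elim R)
      have "(real R * ?p R) * (S R / real R) = ?p R * S R" using elim by simp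
      also have "grid_departures n g ?m R w - \<dots> = (\<Sum>i<?m * R. service_deviation n g R i w)"
        unfolding grid_departures_def S_def sum_distrib_left sum_subtractf[symmetric]
        by (rule sum.cong) (auto simp: service_deviation_def algebra_simps)
      finally show ?case .
    qed
    ultimately show "(\<lambda>R. \<Sum>i<?m * R. service_deviation n g R i w) \<longlonglongrightarrow>
      dep_sum n g (real ?m) w - mu (Suc n) * occ_integral (Suc n) g (real ?m) w"
      by (rule Lim_transform_eventually)
  qed
qed

text \<open>The expected number of departures leaving \<open>n\<close> is at most \<open>mu (Suc n)\<close> per unit of time, here in the
  form in which it is applied: \<open>f\<close> may be any count dominated by this number.\<close>

lemma departure_count_bound:
  fixes f :: "'w \<Rightarrow> ennreal" and c :: ennreal
  assumes le: "AE w in M. f w \<le> ennreal (dep_sum n (\<lambda>_. 1) (real m) w) + c"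
  shows "(\<integral>\<^sup>+ w. f w \<partial>M) \<le> ennreal (mu (Suc n) * real m) + c"
proof -
  let ?p = "\<lambda>R. pmf (q (Suc n) (1 / real R)) 1" and ?S = "grid_departures n (\<lambda>_. 1) m"
  have [measurable]: "?S R \<in> borel_measurable M" for R
    unfolding grid_departures_def by measurable
  have S: "(\<integral>\<^sup>+ w. ennreal (?S R w) \<partial>M) \<le> ennreal (real m * (real R * ?p R))" if R: "0 < R" for R
  proof -
    let ?x = "\<lambda>i w. if quiet T (real i / real R) (1 / real R) w \<and> qlen (real i / real R) w = Suc n
        \<and> Dep (real (Suc i) / real R) w - Dep (real i / real R) w = 1 then 1 else 0 :: real"
    have x: "expectation (?x i) \<le> ?p R" for i
    proof -
      have "expectation (service_deviation n (\<lambda>_. 1) R i) = 0"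
        using compensated_service[of "real i / real R" "1 / real R" "\<lambda>_. 1" 1 n] R
        unfolding service_deviation_def[abs_def] grid_Suc by simp
      moreover have "?x i w \<le> service_deviation n (\<lambda>_. 1) R i w + ?p R" for w
        unfolding service_deviation_def by simp
      then have "expectation (?x i) \<le> expectation (\<lambda>w. service_deviation n (\<lambda>_. 1) R i w + ?p R)"
      proof (intro integral_mono)
        show "integrable M (?x i)" by (rule integrable_bounded[where B=1]) auto
      next
        have "service_deviation n (\<lambda>_. 1) R i \<in> borel_measurable M"
          by (rule measurable_Past_M[OF service_deviation_Past[OF _ order_refl]]) auto
        then show "integrable M (\<lambda>w. service_deviation n (\<lambda>_. 1) R i w + ?p R)"
          by (intro Bochner_Integration.integrable_add integrable_bounded[where B=1] service_deviation_bound) (auto simp: pmf_le_1)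
      qed
      moreover have "expectation (\<lambda>w. service_deviation n (\<lambda>_. 1) R i w + ?p R) = expectation (service_deviation n (\<lambda>_. 1) R i) + ?p R"
      proof -
        have "service_deviation n (\<lambda>_. 1) R i \<in> borel_measurable M"
          by (rule measurable_Past_M[OF service_deviation_Past[OF _ order_refl]]) auto
        then have "integrable M (service_deviation n (\<lambda>_. 1) R i)"
          by (intro integrable_bounded[where B=1] service_deviation_bound) auto
        then show ?thesis by (simp add: prob_space)
      qed
      ultimately show ?thesis by simp
    qed
    have i: "integrable M (?x i)" for i by (rule integrable_bounded[where B=1]) auto
    have "(\<integral>\<^sup>+ w. ennreal (?S R w) \<partial>M) = ennreal (expectation (?S R))"
      unfolding grid_departures_def by (rule nn_integral_eq_integral) (use i in \<open>auto intro!: sum_nonneg\<close>)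
    also have "expectation (?S R) = (\<Sum>i<m * R. expectation (?x i))"
      unfolding grid_departures_def by (rule Bochner_Integration.integral_sum) (rule i)
    also have "ennreal \<dots> \<le> ennreal (\<Sum>i<m * R. ?p R)"
      by (intro ennreal_leI sum_mono x)
    finally show ?thesis by (simp add: mult_ac)
  qed
  have "(\<integral>\<^sup>+ w. f w \<partial>M) \<le> (\<integral>\<^sup>+ w. liminf (\<lambda>R. ennreal (?S R w)) + c \<partial>M)"
  proof (rule nn_integral_mono_AE)
    show "AE w in M. f w \<le> liminf (\<lambda>R. ennreal (?S R w)) + c"
      using le simple_path_AE
    proof eventually_elim
      case (elim w)
      have "(\<lambda>R. ennreal (?S R w)) \<longlonglongrightarrow> ennreal (dep_sum n (\<lambda>_. 1) (real m) w)"
        by (intro tendsto_ennrealI grid_departures_tendsto[OF elim(2), of _ 0]) simp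
      then have "liminf (\<lambda>R. ennreal (?S R w)) = ennreal (dep_sum n (\<lambda>_. 1) (real m) w)"
        by (intro lim_imp_Liminf) auto
      then show ?case using elim(1) by simp
    qed
  qed
  also have "\<dots> = (\<integral>\<^sup>+ w. liminf (\<lambda>R. ennreal (?S R w)) \<partial>M) + c"
    by (subst nn_integral_add) (auto simp: emeasure_space_1)
  also have "(\<integral>\<^sup>+ w. liminf (\<lambda>R. ennreal (?S R w)) \<partial>M) \<le> liminf (\<lambda>R. \<integral>\<^sup>+ w. ennreal (?S R w) \<partial>M)"
    by (rule nn_integral_liminf) measurable
  also have "\<dots> \<le> liminf (\<lambda>R. ennreal (real m * (real R * ?p R)))"
    by (rule Liminf_mono, rule eventually_mono[OF eventually_gt_at_top[of "0::nat"]]) (rule S)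
  also have "\<dots> = ennreal (real m * mu (Suc n))"
    by (intro lim_imp_Liminf tendsto_ennrealI tendsto_mult tendsto_const single_rate) auto
  finally show ?thesis by (simp add: mult.commute add_right_mono)
qed

end

section \<open>Services do not anticipate arrivals\<close>

lemma ceiling_grid:
  assumes "0 < R" "0 \<le> x"
  shows "x \<le> real (nat \<lceil>real R * x\<rceil>) / real R" "real (nat \<lceil>real R * x\<rceil>) / real R < x + 1 / real R"
proof -
  have R: "0 < real R" using assms by simp
  have "0 \<le> real R * x" using assms by simp
  then have c: "real (nat \<lceil>real R * x\<rceil>) = of_int \<lceil>real R * x\<rceil>" by simp
  show "x \<le> real (nat \<lceil>real R * x\<rceil>) / real R"
    unfolding c using R by (simp add: pos_le_divide_eq mult.commute)
  have "of_int \<lceil>real R * x\<rceil> < real R * x + 1" by linarith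
  then show "real (nat \<lceil>real R * x\<rceil>) / real R < x + 1 / real R"
    unfolding c using R by (simp add: pos_divide_less_eq distrib_right mult.commute[of x])
qed

lemma floor_grid:
  assumes "0 < R" "0 < x"
  shows "real (nat \<lceil>real R * x\<rceil> - 1) / real R < x" "x - 1 / real R \<le> real (nat \<lceil>real R * x\<rceil> - 1) / real R"
proof -
  have R: "0 < real R" using assms by simp
  have "0 < real R * x" using assms by simp
  then have "0 < \<lceil>real R * x\<rceil>" by simp
  then have c: "real (nat \<lceil>real R * x\<rceil> - 1) = of_int \<lceil>real R * x\<rceil> - 1" by linarith
  have "of_int \<lceil>real R * x\<rceil> < real R * x + 1" "real R * x \<le> of_int \<lceil>real R * x\<rceil>" by linarith+
  then show "real (nat \<lceil>real R * x\<rceil> - 1) / real R < x" "x - 1 / real R \<le> real (nat \<lceil>real R * x\<rceil> - 1) / real R"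
    unfolding c using R by (auto simp: pos_divide_less_eq pos_le_divide_eq left_diff_distrib mult.commute[of x])
qed

lemma eventually_mesh_less: "0 < e \<Longrightarrow> \<forall>\<^sub>F R in sequentially. 0 < R \<and> 1 / real R < e"
  by (rule eventually_conj[OF eventually_gt_at_top order_tendstoD(2)[OF lim_1_over_n]])

lemma right_continuous_grid:
  fixes f :: "real \<Rightarrow> nat"
  assumes f: "continuous (at_right x) f" and x: "0 \<le> x"
  shows "\<forall>\<^sub>F R in sequentially. f (real (nat \<lceil>real R * x\<rceil>) / real R) = f x"
    and "x \<le> u \<Longrightarrow> \<forall>\<^sub>F R in sequentially. f (min u (real (nat \<lceil>real R * x\<rceil>) / real R)) = f x"
proof -
  obtain v where v: "x < v" "\<And>u. x \<le> u \<Longrightarrow> u < v \<Longrightarrow> f u = f x"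
    using right_continuous_nat[OF f] by blast
  then have "0 < v - x" by simp
  then have ev: "\<forall>\<^sub>F R in sequentially. 0 < R \<and> 1 / real R < v - x" by (rule eventually_mesh_less)
  then show "\<forall>\<^sub>F R in sequentially. f (real (nat \<lceil>real R * x\<rceil>) / real R) = f x"
  proof eventually_elim
    case (elim R)
    then show ?case using ceiling_grid[of R x] x by (intro v(2)) auto
  qed
  assume "x \<le> u"
  from ev show "\<forall>\<^sub>F R in sequentially. f (min u (real (nat \<lceil>real R * x\<rceil>) / real R)) = f x"
  proof eventually_elim
    case (elim R)
    then show ?case using ceiling_grid[of R x] x \<open>x \<le> u\<close> by (intro v(2)) auto
  qed
qed

text \<open>Stage \<open>k\<close> lasts from arrival \<open>k - 1\<close> to arrival \<open>k\<close>; stage \<open>0\<close> starts at time \<open>0\<close>, which need not be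
  an arrival epoch. During stage \<open>k\<close> exactly \<open>k\<close> customers have arrived.\<close>

definition stage_start :: "(nat \<Rightarrow> 'w \<Rightarrow> real) \<Rightarrow> nat \<Rightarrow> 'w \<Rightarrow> real" where
  "stage_start T k w = (if k = 0 then 0 else T (k - 1) w)"

lemma stage_start_simps[simp]: "stage_start T 0 w = 0" "stage_start T (Suc k) w = T k w"
  by (auto simp: stage_start_def)

context queue_path
begin

lemma stage_nonneg: "0 \<le> stage_start T k w"
  using T_nonneg by (cases k) auto

lemma stage_mono: "j \<le> k \<Longrightarrow> stage_start T j w \<le> stage_start T k w"
  using T_mono T_nonneg by (cases j; cases k) auto

lemma stage_arrivals:
  assumes "stage_start T k w \<le> a" "a < T k w"
  shows "arrivals T a w = k"
proof (rule antisym)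
  show "arrivals T a w \<le> k" using assms(2) less_T_iff by simp
  show "k \<le> arrivals T a w" using assms(1) T_le_iff[of "k - 1" a] by (cases k) auto
qed

lemma stage_quiet:
  assumes "stage_start T k w \<le> a" "a \<le> b" "b < T k w"
  shows "quiet T a (b - a) w"
proof -
  have "arrivals T b w = k" "arrivals T a w = k"
    using assms by (auto intro!: stage_arrivals)
  then show ?thesis using quiet_iff[of "b - a" a] assms(2) by simp
qed

lemma Dep_floor_grid:
  assumes "0 < T k w"
  shows "\<forall>\<^sub>F R in sequentially. Dep (real (nat \<lceil>real R * T k w\<rceil> - 1) / real R) w = Dep (T k w) w"
proof -
  obtain v where v: "v < T k w" "\<And>u. v \<le> u \<Longrightarrow> u \<le> T k w \<Longrightarrow> Dep u w = Dep v w"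
    using D_arrival_left[OF assms] by metis
  then have "0 < T k w - v" by simp
  from eventually_mesh_less[OF this] show ?thesis
  proof eventually_elim
    case (elim R)
    have "Dep (real (nat \<lceil>real R * T k w\<rceil> - 1) / real R) w = Dep v w"
      using floor_grid[of R "T k w"] assms elim by (intro v(2)) auto
    moreover have "Dep (T k w) w = Dep v w" using v(1) by (intro v(2)) auto
    ultimately show ?case by simp
  qed
qed

end

context GMn1_service
begin

text \<open>The assumptions on \<open>Dep\<close> concern fixed times. At a random time, \<open>Dep\<close> is the limit of its values at
  the next grid points, of which there are countably many. The map \<open>c\<close> keeps these grid points inside
  the time interval on which \<open>Dep\<close> is measurable with respect to \<open>F\<close>.\<close>

lemma Dep_random_time:
  assumes \<sigma>[measurable]: "\<sigma> \<in> borel_measurable F"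
    and c: "\<And>x. 0 \<le> x \<Longrightarrow> Dep (c x) \<in> F \<rightarrow>\<^sub>M count_space UNIV"
    and lim: "\<And>w. w \<in> space F \<Longrightarrow>
      \<forall>\<^sub>F R in sequentially. Dep (c (real (nat \<lceil>real R * \<sigma> w\<rceil>) / real R)) w = Dep (\<sigma> w) w"
  shows "(\<lambda>w. Dep (\<sigma> w) w) \<in> F \<rightarrow>\<^sub>M count_space UNIV"
proof -
  have "(\<lambda>w. real (Dep (\<sigma> w) w)) \<in> borel_measurable F"
  proof (rule borel_measurable_LIMSEQ_real)
    fix R :: nat
    have i: "(\<lambda>w. nat \<lceil>real R * \<sigma> w\<rceil>) \<in> F \<rightarrow>\<^sub>M count_space UNIV" by measurable
    have "(\<lambda>w. Dep (c (real (nat \<lceil>real R * \<sigma> w\<rceil>) / real R)) w) \<in> F \<rightarrow>\<^sub>M count_space UNIV"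
      by (rule measurable_compose_countable[OF _ i]) (simp add: c)
    then show "(\<lambda>w. real (Dep (c (real (nat \<lceil>real R * \<sigma> w\<rceil>) / real R)) w)) \<in> borel_measurable F"
      by (rule measurable_compose) simp
  next
    fix w assume "w \<in> space F"
    from lim[OF this] have "\<forall>\<^sub>F R in sequentially.
        real (Dep (c (real (nat \<lceil>real R * \<sigma> w\<rceil>) / real R)) w) = real (Dep (\<sigma> w) w)"
      by eventually_elim simp
    then show "(\<lambda>R. real (Dep (c (real (nat \<lceil>real R * \<sigma> w\<rceil>) / real R)) w)) \<longlonglongrightarrow> real (Dep (\<sigma> w) w)"
      by (rule tendsto_eventually)
  qed
  then have "{w \<in> space F. real (Dep (\<sigma> w) w) = real i} \<in> sets F" for i by measurable
  moreover have "{w \<in> space F. real (Dep (\<sigma> w) w) = real i} = (\<lambda>w. Dep (\<sigma> w) w) -` {i} \<inter> space F" for i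
    by auto
  ultimately show ?thesis by (intro measurable_natI) simp
qed

lemma Dep_random_time_Past:
  assumes \<sigma>: "\<sigma> \<in> borel_measurable (Past u)" and u: "\<And>w. 0 \<le> \<sigma> w" "\<And>w. \<sigma> w \<le> u"
  shows "(\<lambda>w. Dep (\<sigma> w) w) \<in> Past u \<rightarrow>\<^sub>M count_space UNIV"
proof (rule Dep_random_time[OF \<sigma>, where c="min u"])
  have u0: "0 \<le> u" using u order_trans by blast
  show "Dep (min u x) \<in> Past u \<rightarrow>\<^sub>M count_space UNIV" if "0 \<le> x" for x
    by (rule Dep_Past) (use u0 that in auto)
  show "\<forall>\<^sub>F R in sequentially. Dep (min u (real (nat \<lceil>real R * \<sigma> w\<rceil>) / real R)) w = Dep (\<sigma> w) w"
    if "w \<in> space (Past u)" for w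
    using that by (intro right_continuous_grid(2) Dep_right_continuous u) simp
qed

lemma Dep_random_time_M:
  assumes \<sigma>: "\<sigma> \<in> borel_measurable M" and u: "\<And>w. 0 \<le> \<sigma> w"
  shows "(\<lambda>w. Dep (\<sigma> w) w) \<in> M \<rightarrow>\<^sub>M count_space UNIV"
  by (rule Dep_random_time[OF \<sigma>, where c="\<lambda>x. x"])
     (use right_continuous_grid(1)[OF Dep_right_continuous[OF _ u] u] in auto)

text \<open>Departures before the start of stage \<open>k\<close>. The maximum guards the null set on which arrival times may be
  negative, where nothing is assumed about \<open>Dep\<close>.\<close>

definition dep_at :: "nat \<Rightarrow> 'w \<Rightarrow> nat" where
  "dep_at k w = Dep (max 0 (stage_start T k w)) w"

lemma stage_hist: "k \<le> Suc l \<Longrightarrow> stage_start T k \<in> borel_measurable (hist l)"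
  unfolding stage_start_def[abs_def] by (cases k) (auto intro!: T_hist)

lemma stage_Past[measurable]: "stage_start T k \<in> borel_measurable (Past u)"
  by (rule measurable_hist_Past[OF stage_hist[of k k]]) simp

lemma stage_M[measurable]: "stage_start T k \<in> borel_measurable M"
  by (rule measurable_Past_M[OF stage_Past order_refl])

lemma dep_at_M[measurable]: "dep_at k \<in> M \<rightarrow>\<^sub>M count_space UNIV"
  unfolding dep_at_def by (rule Dep_random_time_M) auto

lemma gap_Past[measurable]: "gap k \<in> borel_measurable (Past u)"
  unfolding gap_def by (rule borel_measurable_diff) (rule T_Past)+

text \<open>For \<open>f\<close> with mean zero under the inter-arrival law this says: given \<open>A\<close>, the number of departures
  before stage \<open>k\<close> reveals nothing about inter-arrival time \<open>l\<close> beyond what the earlier arrivals do.\<close>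

definition blind :: "nat \<Rightarrow> (real \<Rightarrow> real) \<Rightarrow> nat \<Rightarrow> ('w \<Rightarrow> bool) \<Rightarrow> bool" where
  "blind l f k A \<longleftrightarrow> (\<forall>\<zeta> d. \<zeta> \<in> borel_measurable (hist l) \<longrightarrow> (\<forall>w. \<bar>\<zeta> w\<bar> \<le> 1) \<longrightarrow>
     expectation (\<lambda>w. if A w \<and> dep_at k w = d then \<zeta> w * f (gap l w) else 0) = 0)"

lemma blindD:
  "blind l f k A \<Longrightarrow> \<zeta> \<in> borel_measurable (hist l) \<Longrightarrow> (\<And>w. \<bar>\<zeta> w\<bar> \<le> 1) \<Longrightarrow>
     expectation (\<lambda>w. if A w \<and> dep_at k w = d then \<zeta> w * f (gap l w) else 0) = 0"
  unfolding blind_def by blast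

text \<open>The service assumption conditions on the whole arrival stream, so that departures might a priori
  anticipate later arrivals. Inside stage \<open>k\<close>, however, their law depends on the arrivals only through
  the length of the stage and the current number of customers. The stage is approximated from inside
  by the window from the first grid point after its start (index \<open>I\<close>) to the last grid point before its end (index \<open>J\<close>).
  This window is free of arrivals, and conditioning on its past replaces the indicator of \<open>e - d\<close> departures by a
  probability that is measurable with respect to \<open>hist l\<close>. As the mesh tends to zero, \<open>dep_at k\<close> and \<open>dep_at (Suc k)\<close> are
  recovered, and the hypothesis for stage \<open>k\<close> applies.\<close>

lemma blind_step:
  assumes f[measurable]: "f \<in> borel_measurable borel" and fb: "\<And>x. \<bar>f x\<bar> \<le> C"
    and k: "k \<le> l" and A: "\<And>u. 0 \<le> u \<Longrightarrow> Measurable.pred (Past u) (\<lambda>w. A w \<and> stage_start T k w \<le> u)"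
    and AM[measurable]: "Measurable.pred M A" and IH: "blind l f k A"
  shows "blind l f (Suc k) A"
  unfolding blind_def
proof (intro allI impI)
  fix \<zeta> :: "'w \<Rightarrow> real" and e :: nat
  assume \<zeta>: "\<zeta> \<in> borel_measurable (hist l)" and \<zeta>b: "\<forall>w. \<bar>\<zeta> w\<bar> \<le> 1"
  have [measurable]: "\<zeta> \<in> borel_measurable M" by (rule measurable_hist_M[OF \<zeta>])
  have \<zeta>P: "\<zeta> \<in> borel_measurable (Past u)" for u by (rule measurable_hist_Past[OF \<zeta>])
  let ?S = "stage_start T k" and ?T = "T k"
  have C0: "0 \<le> C" using order_trans[OF abs_ge_zero fb] .
  have prod_bound: "\<bar>z * f x\<bar> \<le> C" if "\<bar>z\<bar> \<le> 1" for z x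
    unfolding abs_mult using mult_mono[OF that fb[of x]] by simp
  define I where "I R w = nat \<lceil>real R * ?S w\<rceil>" for R w
  define J where "J R w = nat \<lceil>real R * ?T w\<rceil> - 1" for R w
  have S_hist: "?S \<in> borel_measurable (hist l)" and T_hist': "?T \<in> borel_measurable (hist l)"
    using k by (auto intro!: stage_hist T_hist)
  have I_hist: "I R \<in> hist l \<rightarrow>\<^sub>M count_space UNIV" for R using S_hist unfolding I_def by measurable
  have J_hist: "J R \<in> hist l \<rightarrow>\<^sub>M count_space UNIV" for R using T_hist' unfolding J_def by measurable
  have [measurable]: "I R \<in> M \<rightarrow>\<^sub>M count_space UNIV" for R by (rule measurable_hist_M[OF I_hist])
  have [measurable]: "J R \<in> M \<rightarrow>\<^sub>M count_space UNIV" for R by (rule measurable_hist_M[OF J_hist])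
  define DI where "DI R w = Dep (real (I R w) / real R) w" for R w
  define DJ where "DJ R w = Dep (real (J R w) / real R) w" for R w
  define QT where "QT R w = quiet T (real (I R w) / real R) ((real (J R w) - real (I R w)) / real R) w" for R w
  have [measurable]: "DI R \<in> M \<rightarrow>\<^sub>M count_space UNIV" "DJ R \<in> M \<rightarrow>\<^sub>M count_space UNIV" for R
    unfolding DI_def DJ_def by (rule Dep_random_time_M; simp)+
  have [measurable]: "Measurable.pred M (QT R)" for R
    unfolding QT_def quiet_def by measurable
  have one: "expectation (\<lambda>w. if A w \<and> dep_at k w = d \<and> dep_at (Suc k) w = e then \<zeta> w * f (gap l w) else 0) = 0"
    if de: "d \<le> e" for d
  proof -
    define Z where "Z w = (if A w \<and> dep_at k w = d \<and> dep_at (Suc k) w = e then \<zeta> w * f (gap l w) else 0)" for w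
    have [measurable]: "Z \<in> borel_measurable M" unfolding Z_def by measurable
    have Zb: "\<bar>Z w\<bar> \<le> C" for w using \<zeta>b C0 by (auto simp: Z_def prod_bound)
    define F where "F R w = (if A w \<and> I R w < J R w \<and> QT R w \<and> DI R w = d \<and> DJ R w - DI R w = e - d
       then \<zeta> w * f (gap l w) else 0)" for R w
    define \<zeta>R where "\<zeta>R R w = (if I R w < J R w
       then \<zeta> w * pmf (service_law (N0 w + k - d) ((real (J R w) - real (I R w)) / real R)) (e - d) else 0)" for R w
    define H where "H R w = (if A w \<and> DI R w = d then \<zeta>R R w * f (gap l w) else 0)" for R w
    have "Measurable.pred M (\<lambda>w. real (I R w) < real (J R w))" for R by measurable
    then have [measurable]: "Measurable.pred M (\<lambda>w. I R w < J R w)" for R by simp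
    have [measurable]: "Measurable.pred M (\<lambda>w. DI R w = d)" for R by measurable
    have [measurable]: "Measurable.pred M (\<lambda>w. DJ R w - DI R w = e - d)" for R by measurable
    have [measurable]: "Measurable.pred M (\<lambda>w. QT R w)" for R by measurable
    have F[measurable]: "F R \<in> borel_measurable M" for R unfolding F_def by measurable
    have pm: "(\<lambda>w. pmf (service_law (N0 w + k - d) ((real (J R w) - real (I R w)) / real R)) (e - d)) \<in> borel_measurable (hist l)" for R
    proof -
      have "(\<lambda>w. prod_encode (N0 w, prod_encode (I R w, J R w))) \<in> hist l \<rightarrow>\<^sub>M count_space UNIV"
        using I_hist[of R] J_hist[of R] by measurable
      from measurable_compose[OF this, of "\<lambda>x. case prod_decode x of (n, y) \<Rightarrow> case prod_decode y of (i, j) \<Rightarrow>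
          pmf (service_law (n + k - d) ((real j - real i) / real R)) (e - d)" borel]
      show ?thesis by simp
    qed
    have \<zeta>R: "\<zeta>R R \<in> borel_measurable (hist l)" for R
    proof -
      have [measurable]: "I R \<in> hist l \<rightarrow>\<^sub>M count_space UNIV" "J R \<in> hist l \<rightarrow>\<^sub>M count_space UNIV"
        by (rule I_hist, rule J_hist)
      have "Measurable.pred (hist l) (\<lambda>w. real (I R w) < real (J R w))" by measurable
      then have "Measurable.pred (hist l) (\<lambda>w. I R w < J R w)" by simp
      then show ?thesis unfolding \<zeta>R_def using pm[of R] \<zeta> by measurable
    qed
    have [measurable]: "\<zeta>R R \<in> borel_measurable M" for R by (rule measurable_hist_M[OF \<zeta>R])
    have \<zeta>Rb: "\<bar>\<zeta>R R w\<bar> \<le> 1" for R w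
    proof -
      have "\<bar>\<zeta> w * pmf N i\<bar> \<le> 1 * 1" for N :: "nat pmf" and i
        unfolding abs_mult using \<zeta>b by (intro mult_mono) (auto simp: pmf_le_1)
      then show ?thesis by (simp add: \<zeta>R_def)
    qed
    have H[measurable]: "H R \<in> borel_measurable M" for R unfolding H_def by measurable
    have Fb: "\<bar>F R w\<bar> \<le> C" and Hb: "\<bar>H R w\<bar> \<le> C" for R w
      using \<zeta>b C0 \<zeta>Rb by (auto simp: F_def H_def prod_bound)
    \<comment> \<open>The window property, applied separately for each pair of grid points.\<close>
    have EFH: "expectation (F R) = expectation (H R)" if R: "0 < R" for R
    proof (rule expectation_cong_pieces[where X="\<lambda>w. prod_encode (I R w, J R w)"])
      show "(\<lambda>w. prod_encode (I R w, J R w)) \<in> M \<rightarrow>\<^sub>M count_space UNIV" by measurable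
      show "integrable M (F R)" "integrable M (H R)" using Fb Hb by (auto intro!: integrable_bounded[where B=C])
      fix p
      obtain i j where p: "p = prod_encode (i, j)" by (metis prod_decode_inverse surj_pair)
      let ?t = "real i / real R" and ?h = "(real j - real i) / real R"
      show "expectation (\<lambda>w. if prod_encode (I R w, J R w) = p then F R w else 0)
          = expectation (\<lambda>w. if prod_encode (I R w, J R w) = p then H R w else 0)"
      proof (cases "i < j")
        case False
        then show ?thesis unfolding p
          by (intro Bochner_Integration.integral_cong) (auto simp: F_def H_def \<zeta>R_def)
      next
        case True
        have th: "0 \<le> ?t" "0 < ?h" "?t + ?h = real j / real R"
          using True R by (auto simp: field_simps)
        define \<eta> where "\<eta> w = (if A w \<and> I R w = i \<and> J R w = j \<and> Dep ?t w = d then \<zeta> w * f (gap l w) else 0)" for w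
        have IS: "I R w = i \<Longrightarrow> ?S w \<le> ?t" for w
        proof -
          assume "I R w = i"
          then have "real R * ?S w \<le> real i" unfolding I_def by linarith
          then show ?thesis using R by (simp add: pos_le_divide_eq mult.commute)
        qed
        have \<eta>: "\<eta> \<in> borel_measurable (Past ?t)"
        proof -
          have [measurable]: "Measurable.pred (Past ?t) (\<lambda>w. A w \<and> ?S w \<le> ?t)" by (rule A[OF th(1)])
          have [measurable]: "I R \<in> Past ?t \<rightarrow>\<^sub>M count_space UNIV" "J R \<in> Past ?t \<rightarrow>\<^sub>M count_space UNIV"
            by (rule measurable_hist_Past[OF I_hist], rule measurable_hist_Past[OF J_hist])
          have [measurable]: "Dep ?t \<in> Past ?t \<rightarrow>\<^sub>M count_space UNIV" by (rule Dep_Past) (use th in auto)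
          have [measurable]: "\<zeta> \<in> borel_measurable (Past ?t)" by (rule \<zeta>P)
          have "\<eta> = (\<lambda>w. if (A w \<and> ?S w \<le> ?t) \<and> I R w = i \<and> J R w = j \<and> Dep ?t w = d then \<zeta> w * f (gap l w) else 0)"
            unfolding \<eta>_def using IS by (auto simp: fun_eq_iff)
          also have "\<dots> \<in> borel_measurable (Past ?t)" by measurable
          finally show ?thesis .
        qed
        have \<eta>b: "\<bar>\<eta> w\<bar> \<le> C" for w using \<zeta>b C0 by (auto simp: \<eta>_def prod_bound)
        have [measurable]: "\<eta> \<in> borel_measurable M" by (rule measurable_Past_M[OF \<eta> th(1)])
        have [measurable]: "qlen ?t \<in> M \<rightarrow>\<^sub>M count_space UNIV" by (rule queue_length_M[OF th(1)])
        have "expectation (\<lambda>w. if prod_encode (I R w, J R w) = p then F R w else 0)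
          = expectation (\<lambda>w. if quiet T ?t ?h w \<and> Dep (?t + ?h) w - Dep ?t w = e - d then \<eta> w else 0)"
          unfolding p th(3) by (intro Bochner_Integration.integral_cong) (use True in \<open>auto simp: F_def \<eta>_def DI_def DJ_def QT_def\<close>)
        also have "\<dots> = expectation (\<lambda>w. if quiet T ?t ?h w then \<eta> w * pmf (service_law (qlen ?t w) ?h) (e - d) else 0)"
          by (rule service_expectation[OF th(1,2) \<eta> \<eta>b])
        also have "\<dots> = expectation (\<lambda>w. if prod_encode (I R w, J R w) = p then H R w else 0)"
        proof (rule integral_cong_AE)
          show "AE w in M. (if quiet T ?t ?h w then \<eta> w * pmf (service_law (qlen ?t w) ?h) (e - d) else 0)
             = (if prod_encode (I R w, J R w) = p then H R w else 0)"
            using path_AE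
          proof eventually_elim
            case (elim w)
            interpret queue_path N0 T Dep w by (rule elim)
            show ?case
            proof (cases "I R w = i \<and> J R w = j")
              case False
              then show ?thesis by (auto simp: \<eta>_def p)
            next
              case IJ: True
              have Sa: "?S w \<le> ?t" using IS IJ by blast
              have "0 < ?T w"
              proof (rule ccontr)
                assume "\<not> ?thesis"
                then have "?T w = 0" using T_nonneg[of k] by simp
                then show False using IJ True by (simp add: J_def)
              qed
              then have Tb: "real j / real R < ?T w"
                using floor_grid(1)[OF R, of "?T w"] IJ by (simp add: J_def)
              have tj: "?t < real j / real R" using True R by (simp add: divide_strict_right_mono)
              have qt: "quiet T ?t ?h w"
                using stage_quiet[OF Sa less_imp_le[OF tj] Tb] by (simp add: diff_divide_distrib)
              have ar: "arrivals T ?t w = k"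
                by (rule stage_arrivals[OF Sa]) (use tj Tb in simp)
              show ?thesis
                using qt ar IJ True by (auto simp: p \<eta>_def H_def \<zeta>R_def queue_length_def DI_def)
            qed
          qed
        qed measurable
        finally show ?thesis .
      qed
    qed
    \<comment> \<open>In the limit \<open>DI R\<close> may be replaced by \<open>dep_at k\<close>, to which the hypothesis on \<open>A\<close> applies.\<close>
    have EH: "(\<lambda>R. expectation (H R)) \<longlonglongrightarrow> 0"
    proof -
      define H' where "H' R w = (if A w \<and> dep_at k w = d then \<zeta>R R w * f (gap l w) else 0)" for R w
      have [measurable]: "H' R \<in> borel_measurable M" for R unfolding H'_def by measurable
      have H'b: "\<bar>H' R w\<bar> \<le> C" for R w using C0 \<zeta>Rb by (auto simp: H'_def prod_bound)
      have H'0: "expectation (H' R) = 0" for R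
        unfolding H'_def by (rule blindD[OF IH \<zeta>R \<zeta>Rb])
      have "(\<lambda>R. expectation (\<lambda>w. H R w - H' R w)) \<longlonglongrightarrow> expectation (\<lambda>w. 0)"
      proof (rule integral_dominated_convergence[where w="\<lambda>_. 2 * C"])
        show "AE w in M. (\<lambda>R. H R w - H' R w) \<longlonglongrightarrow> 0"
          using path_AE
        proof eventually_elim
          case (elim w)
          interpret queue_path N0 T Dep w by (rule elim)
          have "\<forall>\<^sub>F R in sequentially. H R w - H' R w = 0"
            using right_continuous_grid(1)[OF D_right[OF stage_nonneg[of k]] stage_nonneg[of k]]
            by eventually_elim (use stage_nonneg[of k] in \<open>auto simp: H_def H'_def DI_def I_def dep_at_def max_absorb2\<close>)
          then show ?case by (rule tendsto_eventually)
        qed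
        show "AE w in M. norm (H R w - H' R w) \<le> 2 * C" for R
          using Hb[of R] H'b[of R] by (intro AE_I2) (smt (verit) real_norm_def)
      qed auto
      moreover have "expectation (\<lambda>w. H R w - H' R w) = expectation (H R)" for R
        using Hb H'b H'0 by (subst Bochner_Integration.integral_diff) (auto intro!: integrable_bounded[where B=C])
      ultimately show ?thesis by simp
    qed
    \<comment> \<open>A stage of length zero contains no window; it is treated separately below.\<close>
    define Zm where "Zm w = (if ?S w < ?T w then Z w else 0)" for w
    have [measurable]: "Zm \<in> borel_measurable M" unfolding Zm_def by measurable
    have "(\<lambda>R. expectation (F R)) \<longlonglongrightarrow> expectation Zm"
    proof (rule integral_dominated_convergence[where w="\<lambda>_. C"])
      show "AE w in M. (\<lambda>R. F R w) \<longlonglongrightarrow> Zm w"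
        using path_AE
      proof eventually_elim
        case (elim w)
        interpret queue_path N0 T Dep w by (rule elim)
        have S0: "0 \<le> ?S w" by (rule stage_nonneg)
        have ST: "?S w \<le> ?T w" using stage_mono[of k "Suc k"] by simp
        show ?case
        proof (cases "?S w < ?T w")
          case False
          then have eq: "?S w = ?T w" using ST by simp
          have "\<not> I R w < J R w" for R unfolding I_def J_def eq by linarith
          then have "F R w = 0" for R by (simp add: F_def)
          then show ?thesis using False by (simp add: Zm_def)
        next
          case True
          then have T0: "0 < ?T w" using S0 by simp
          have "0 < (?T w - ?S w) / 2" using True by simp
          note small = eventually_mesh_less[OF this]
          have "\<forall>\<^sub>F R in sequentially. F R w = Zm w"
            using small right_continuous_grid(1)[OF D_right[OF S0] S0] Dep_floor_grid[OF T0]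
          proof eventually_elim
            case (elim R)
            then have R: "0 < R" by simp
            have a: "?S w \<le> real (I R w) / real R" "real (I R w) / real R < ?S w + 1 / real R"
              using ceiling_grid[OF R S0] by (auto simp: I_def)
            have b: "real (J R w) / real R < ?T w" "?T w - 1 / real R \<le> real (J R w) / real R"
              using floor_grid[OF R T0] by (auto simp: J_def)
            have lt: "real (I R w) / real R < real (J R w) / real R" using a b conjunct2[OF elim(1)] by (simp only: less_divide_eq_numeral1)
            then have IJ: "I R w < J R w" using R by (simp add: divide_less_cancel)
            have qt: "quiet T (real (I R w) / real R) ((real (J R w) - real (I R w)) / real R) w"
              using stage_quiet[OF a(1) less_imp_le[OF lt] b(1)] by (simp add: diff_divide_distrib)
            have dk: "dep_at k w = Dep (real (I R w) / real R) w" "dep_at (Suc k) w = Dep (real (J R w) / real R) w"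
              using elim(2,3) S0 T0 by (auto simp: dep_at_def I_def J_def max_absorb2)
            have "Dep (real (I R w) / real R) w \<le> Dep (real (J R w) / real R) w"
              by (rule D_mono) (use lt in auto)
            then show ?case
              using qt IJ dk True de by (auto simp: F_def Zm_def Z_def DI_def DJ_def QT_def)
          qed
          then show ?thesis by (rule tendsto_eventually)
        qed
      qed
    qed (use Fb in auto)
    moreover have "(\<lambda>R. expectation (F R)) \<longlonglongrightarrow> 0"
    proof (rule Lim_transform_eventually[OF EH])
      show "\<forall>\<^sub>F R in sequentially. expectation (H R) = expectation (F R)"
        using eventually_gt_at_top[of "0::nat"] by eventually_elim (rule EFH[symmetric])
    qed
    ultimately have Zm0: "expectation Zm = 0" by (rule LIMSEQ_unique)
    \<comment> \<open>If the stage has length zero, no departure falls into it.\<close>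
    define \<zeta>0 where "\<zeta>0 w = (if ?S w < ?T w \<or> d \<noteq> e then 0 else \<zeta> w)" for w
    have \<zeta>0: "\<zeta>0 \<in> borel_measurable (hist l)" unfolding \<zeta>0_def using \<zeta> S_hist T_hist' by measurable
    have [measurable]: "\<zeta>0 \<in> borel_measurable M" by (rule measurable_hist_M[OF \<zeta>0])
    define Z0 where "Z0 w = (if A w \<and> dep_at k w = d then \<zeta>0 w * f (gap l w) else 0)" for w
    have [measurable]: "Z0 \<in> borel_measurable M" unfolding Z0_def by measurable
    have \<zeta>0b: "\<bar>\<zeta>0 w\<bar> \<le> 1" for w using \<zeta>b by (simp add: \<zeta>0_def)
    have Z00: "expectation Z0 = 0"
      unfolding Z0_def by (rule blindD[OF IH \<zeta>0 \<zeta>0b])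
    have "expectation Z = expectation (\<lambda>w. Zm w + Z0 w)"
    proof (rule integral_cong_AE)
      show "AE w in M. Z w = Zm w + Z0 w"
        using path_AE
      proof eventually_elim
        case (elim w)
        interpret queue_path N0 T Dep w by (rule elim)
        have ST: "?S w \<le> ?T w" using stage_mono[of k "Suc k"] by simp
        show ?case
        proof (cases "?S w < ?T w")
          case True then show ?thesis by (simp add: Zm_def Z0_def \<zeta>0_def)
        next
          case False
          then have "?S w = ?T w" using ST by simp
          then have "dep_at k w = dep_at (Suc k) w" by (simp add: dep_at_def)
          then show ?thesis using False by (auto simp: Zm_def Z0_def \<zeta>0_def Z_def)
        qed
      qed
    qed measurable
    also have "\<dots> = expectation Zm + expectation Z0"
      using Zb \<zeta>0b C0 by (intro Bochner_Integration.integral_add integrable_bounded[where B=C]) (auto simp: Zm_def Z0_def prod_bound)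
    finally show ?thesis using Zm0 Z00 unfolding Z_def by simp
  qed
  define Y where "Y w = (\<Sum>d\<le>e. if A w \<and> dep_at k w = d \<and> dep_at (Suc k) w = e then \<zeta> w * f (gap l w) else 0)" for w
  have [measurable]: "Y \<in> borel_measurable M" unfolding Y_def by measurable
  have "expectation (\<lambda>w. if A w \<and> dep_at (Suc k) w = e then \<zeta> w * f (gap l w) else 0) = expectation Y"
  proof (rule integral_cong_AE)
    show "AE w in M. (if A w \<and> dep_at (Suc k) w = e then \<zeta> w * f (gap l w) else 0) = Y w"
      using path_AE
    proof eventually_elim
      case (elim w)
      interpret queue_path N0 T Dep w by (rule elim)
      have "dep_at k w \<le> dep_at (Suc k) w"
        unfolding dep_at_def using stage_mono[of k "Suc k"] stage_nonneg by (intro D_mono) (auto simp: max_def)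
      then have "(\<Sum>d\<le>e. if dep_at k w = d then (if A w \<and> dep_at (Suc k) w = e then \<zeta> w * f (gap l w) else 0) else 0)
        = (if A w \<and> dep_at (Suc k) w = e then \<zeta> w * f (gap l w) else 0)"
        by (subst sum.delta') auto
      moreover have "Y w = (\<Sum>d\<le>e. if dep_at k w = d then (if A w \<and> dep_at (Suc k) w = e then \<zeta> w * f (gap l w) else 0) else 0)"
        unfolding Y_def by (rule sum.cong) auto
      ultimately show ?case by simp
    qed
  qed measurable
  also have "expectation Y = (\<Sum>d\<le>e. expectation (\<lambda>w. if A w \<and> dep_at k w = d \<and> dep_at (Suc k) w = e then \<zeta> w * f (gap l w) else 0))"
    unfolding Y_def using \<zeta>b C0
    by (intro Bochner_Integration.integral_sum integrable_bounded[where B=C]) (auto simp: prod_bound)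
  also have "\<dots> = 0" using one by simp
  finally show "expectation (\<lambda>w. if A w \<and> dep_at (Suc k) w = e then \<zeta> w * f (gap l w) else 0) = 0" .
qed

end

context GMn1_service
begin

lemma blind_cong_AE:
  assumes [measurable]: "f \<in> borel_measurable borel" "Measurable.pred M A" "Measurable.pred M B"
    and AB: "AE w in M. A w \<longleftrightarrow> B w" and "blind l f k A"
  shows "blind l f k B"
  unfolding blind_def
proof (intro allI impI)
  fix \<zeta> :: "'w \<Rightarrow> real" and d
  assume \<zeta>: "\<zeta> \<in> borel_measurable (hist l)" and b: "\<forall>w. \<bar>\<zeta> w\<bar> \<le> 1"
  have [measurable]: "\<zeta> \<in> borel_measurable M" by (rule measurable_hist_M[OF \<zeta>])
  have "expectation (\<lambda>w. if B w \<and> dep_at k w = d then \<zeta> w * f (gap l w) else 0)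
    = expectation (\<lambda>w. if A w \<and> dep_at k w = d then \<zeta> w * f (gap l w) else 0)"
    by (rule integral_cong_AE) (use AB in \<open>auto elim: eventually_mono\<close>)
  also have "\<dots> = 0" using blindD[OF assms(5) \<zeta>] b by blast
  finally show "expectation (\<lambda>w. if B w \<and> dep_at k w = d then \<zeta> w * f (gap l w) else 0) = 0" .
qed

lemma gap_blind:
  assumes f[measurable]: "f \<in> borel_measurable borel" and fb: "\<And>x. \<bar>f x\<bar> \<le> C" and f0: "(LINT x|G. f x) = 0"
    and "k \<le> Suc l"
  shows "blind l f k (\<lambda>_. True)"
  using \<open>k \<le> Suc l\<close>
proof (induction k)
  case 0
  show ?case
    unfolding blind_def
  proof (intro allI impI)
    fix \<zeta> :: "'w \<Rightarrow> real" and d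
    assume \<zeta>: "\<zeta> \<in> borel_measurable (hist l)" and b: "\<forall>w. \<bar>\<zeta> w\<bar> \<le> 1"
    have "expectation (\<lambda>w. \<zeta> w * f (gap l w)) = expectation \<zeta> * (LINT x|G. f x)"
      by (rule expectation_gap[OF \<zeta> _ f fb]) (use b in blast)
    then have E: "expectation (\<lambda>w. \<zeta> w * f (gap l w)) = 0" using f0 by simp
    have "expectation (\<lambda>w. if True \<and> dep_at 0 w = d then \<zeta> w * f (gap l w) else 0)
      = expectation (\<lambda>w. if d = 0 then \<zeta> w * f (gap l w) else 0)"
      by (rule Bochner_Integration.integral_cong) (auto simp: dep_at_def Dep_0)
    also have "\<dots> = 0" using E by (cases "d = 0") auto
    finally show "expectation (\<lambda>w. if True \<and> dep_at 0 w = d then \<zeta> w * f (gap l w) else 0) = 0" .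
  qed
next
  case (Suc k)
  show ?case
    by (rule blind_step[OF f fb]) (use Suc in \<open>auto\<close>)
qed

text \<open>A second moment involves the queue lengths found by two arrivals. The number of departures before
  stage \<open>j\<close> is fixed as an event \<open>A\<close>, and the remaining stages are added by \<open>blind_step\<close>. \<open>A\<close> also
  requires the stages to be in order, which holds almost surely; on the paths whose stage \<open>k\<close> has started by
  time \<open>u\<close>, this makes \<open>A\<close> an event of the past at \<open>u\<close>.\<close>

lemma gap_blind_pair:
  assumes f[measurable]: "f \<in> borel_measurable borel" and fb: "\<And>x. \<bar>f x\<bar> \<le> C" and f0: "(LINT x|G. f x) = 0"
    and j: "j \<le> k" and k: "k \<le> Suc l"
  shows "blind l f k (\<lambda>w. dep_at j w = e)"
proof -
  define A where "A w \<longleftrightarrow> dep_at j w = e \<and> (\<forall>i. stage_start T i w \<le> stage_start T (Suc i) w)" for w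
  have [measurable]: "Measurable.pred M A" unfolding A_def by measurable
  have AE: "AE w in M. A w \<longleftrightarrow> dep_at j w = e"
    using path_AE
  proof eventually_elim
    case (elim w)
    interpret queue_path N0 T Dep w by (rule elim)
    have "stage_start T i w \<le> stage_start T (Suc i) w" for i by (rule stage_mono) simp
    then show ?case unfolding A_def by blast
  qed
  have "blind l f k A"
    using j k
  proof (induction k rule: dec_induct)
    case base
    have "blind l f j (\<lambda>w. dep_at j w = e)"
      unfolding blind_def
    proof (intro allI impI)
      fix \<zeta> :: "'w \<Rightarrow> real" and d
      assume \<zeta>: "\<zeta> \<in> borel_measurable (hist l)" and b: "\<forall>w. \<bar>\<zeta> w\<bar> \<le> 1"
      have "expectation (\<lambda>w. if True \<and> dep_at j w = d then \<zeta> w * f (gap l w) else 0) = 0"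
        using blindD[OF gap_blind[OF f fb f0 base] \<zeta>] b by blast
      then show "expectation (\<lambda>w. if dep_at j w = e \<and> dep_at j w = d then \<zeta> w * f (gap l w) else 0) = 0"
        by (cases "d = e") (auto cong: conj_cong)
    qed
    then show ?case
      by (rule blind_cong_AE[rotated 4]) (use AE in \<open>auto elim: eventually_mono\<close>)
  next
    case (step k)
    show ?case
    proof (rule blind_step[OF f fb])
      show "blind l f k A" "k \<le> l" using step by auto
      fix u :: real assume u: "0 \<le> u"
      have D: "(\<lambda>w. Dep (min u (max 0 (stage_start T j w))) w) \<in> Past u \<rightarrow>\<^sub>M count_space UNIV"
        by (rule Dep_random_time_Past) (use u in auto)
      have eq: "(\<lambda>w. A w \<and> stage_start T k w \<le> u) = (\<lambda>w. Dep (min u (max 0 (stage_start T j w))) w = e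
        \<and> (\<forall>i. stage_start T i w \<le> stage_start T (Suc i) w) \<and> stage_start T k w \<le> u)"
      proof (rule ext, rule iffI)
        fix w assume a: "A w \<and> stage_start T k w \<le> u"
        then have "stage_start T j w \<le> stage_start T k w"
          using lift_Suc_mono_le[of "\<lambda>i. stage_start T i w" j k] step(1) by (auto simp: A_def)
        then show "Dep (min u (max 0 (stage_start T j w))) w = e
          \<and> (\<forall>i. stage_start T i w \<le> stage_start T (Suc i) w) \<and> stage_start T k w \<le> u"
          using a u by (auto simp: A_def dep_at_def min_absorb2)
      next
        fix w assume a: "Dep (min u (max 0 (stage_start T j w))) w = e
          \<and> (\<forall>i. stage_start T i w \<le> stage_start T (Suc i) w) \<and> stage_start T k w \<le> u"
        then have "stage_start T j w \<le> stage_start T k w"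
          using lift_Suc_mono_le[of "\<lambda>i. stage_start T i w" j k] step(1) by auto
        then show "A w \<and> stage_start T k w \<le> u"
          using a u by (auto simp: A_def dep_at_def min_absorb2)
      qed
      show "Measurable.pred (Past u) (\<lambda>w. A w \<and> stage_start T k w \<le> u)"
        unfolding eq using D by measurable
    qed auto
  qed
  then show ?thesis
    by (rule blind_cong_AE[rotated 4]) (use AE in auto)
qed

text \<open>The terms of \<open>arrival_sum\<close>, written so that they are measurable and make sense for all \<open>k\<close>.\<close>

definition arrival_term :: "nat \<Rightarrow> (real \<Rightarrow> real) \<Rightarrow> real \<Rightarrow> nat \<Rightarrow> 'w \<Rightarrow> real" where
  "arrival_term n f t k w = (if T k w \<le> t \<and> N0 w + k - dep_at (Suc k) w = n then f (gap k w) else 0)"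

lemma arrival_term_M[measurable]: "f \<in> borel_measurable borel \<Longrightarrow> arrival_term n f t k \<in> borel_measurable M"
proof -
  assume [measurable]: "f \<in> borel_measurable borel"
  have "(\<lambda>w. N0 w + k - dep_at (Suc k) w) \<in> M \<rightarrow>\<^sub>M count_space UNIV" by measurable
  from measurable_compose[OF this, of "\<lambda>i. i = n" "count_space UNIV"]
  have [measurable]: "Measurable.pred M (\<lambda>w. N0 w + k - dep_at (Suc k) w = n)" by simp
  show ?thesis unfolding arrival_term_def by measurable
qed

lemma arrival_terms_orthogonal:
  assumes f[measurable]: "f \<in> borel_measurable borel" and fb: "\<And>x. \<bar>f x\<bar> \<le> 1" and f0: "(LINT x|G. f x) = 0"
    and jl: "j < l"
  shows "expectation (\<lambda>w. arrival_term n f t j w * arrival_term n f t l w) = 0"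
proof -
  have "expectation (\<lambda>w. arrival_term n f t j w * arrival_term n f t l w) = expectation (\<lambda>w. 0)"
  proof (rule expectation_cong_pieces[where X="\<lambda>w. prod_encode (dep_at (Suc j) w, dep_at (Suc l) w)"])
    show "(\<lambda>w. prod_encode (dep_at (Suc j) w, dep_at (Suc l) w)) \<in> M \<rightarrow>\<^sub>M count_space UNIV" by measurable
    have "\<bar>arrival_term n f t j w * arrival_term n f t l w\<bar> \<le> 1 * 1" for w
      unfolding abs_mult by (intro mult_mono) (auto simp: arrival_term_def fb)
    then show "integrable M (\<lambda>w. arrival_term n f t j w * arrival_term n f t l w)"
      by (intro integrable_bounded[where B=1]) auto
    fix p
    obtain e d where p: "p = prod_encode (e, d)" by (metis prod_decode_inverse surj_pair)
    define \<zeta> where "\<zeta> w = (if T j w \<le> t \<and> T l w \<le> t \<and> N0 w + j - e = n \<and> N0 w + l - d = n then f (gap j w) else 0)" for w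
    have \<zeta>: "\<zeta> \<in> borel_measurable (hist l)"
    proof -
      have [measurable]: "T j \<in> borel_measurable (hist l)" "T l \<in> borel_measurable (hist l)" "T (Suc j) \<in> borel_measurable (hist l)"
        using jl by (auto intro: T_hist)
      then show ?thesis unfolding \<zeta>_def gap_def by measurable
    qed
    have "expectation (\<lambda>w. if dep_at (Suc j) w = e \<and> dep_at (Suc l) w = d then \<zeta> w * f (gap l w) else 0) = 0"
    proof (rule blindD[OF gap_blind_pair[OF f fb f0] \<zeta>])
      show "\<bar>\<zeta> w\<bar> \<le> 1" for w by (simp add: \<zeta>_def fb)
    qed (use jl in auto)
    moreover have "(\<lambda>w. if prod_encode (dep_at (Suc j) w, dep_at (Suc l) w) = p then arrival_term n f t j w * arrival_term n f t l w else 0)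
      = (\<lambda>w. if dep_at (Suc j) w = e \<and> dep_at (Suc l) w = d then \<zeta> w * f (gap l w) else 0)"
      unfolding p arrival_term_def \<zeta>_def by (auto simp: fun_eq_iff)
    ultimately show "expectation (\<lambda>w. if prod_encode (dep_at (Suc j) w, dep_at (Suc l) w) = p then arrival_term n f t j w * arrival_term n f t l w else 0)
      = expectation (\<lambda>w. if prod_encode (dep_at (Suc j) w, dep_at (Suc l) w) = p then 0 else 0)"
      by simp
  qed simp
  then show ?thesis by simp
qed

lemma arrival_terms_eq:
  assumes "queue_path N0 T Dep w" and K: "arrivals T t w \<le> K"
  shows "(\<Sum>k<K. arrival_term n f t k w) = arr_sum n f t w"
proof -
  interpret queue_path N0 T Dep w by (rule assms)
  have "(\<Sum>k<K. arrival_term n f t k w) = (\<Sum>k<arrivals T t w. arrival_term n f t k w)"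
    using K by (intro sum.mono_neutral_right) (auto simp: arrival_term_def T_le_iff)
  also have "\<dots> = arr_sum n f t w"
    unfolding arrival_sum_def
  proof (rule sum.cong[OF refl])
    fix k assume "k \<in> {..<arrivals T t w}"
    then have "T k w \<le> t" using T_le_iff by simp
    then show "arrival_term n f t k w = (if seen k w = n then f (T (Suc k) w - T k w) else 0)"
      using T_nonneg[of k] by (simp add: arrival_term_def seen_by_def dep_at_def gap_def max_absorb2)
  qed
  finally show ?thesis .
qed

lemma arrival_departure_count:
  assumes "simple_queue_path N0 T Dep w" "0 \<le> t"
  shows "\<bar>arr_sum n (\<lambda>_. 1 :: real) t w - dep_sum n (\<lambda>_. 1) t w\<bar> \<le> 1"
proof -
  interpret simple_queue_path N0 T Dep w by (rule assms)
  have a: "arr_sum n (\<lambda>_. 1 :: complex) t w = of_real (arr_sum n (\<lambda>_. 1) t w)"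
    unfolding arrival_sum_def of_real_sum by (rule sum.cong) auto
  have d: "dep_sum n (\<lambda>_. 1 :: complex) t w = of_real (dep_sum n (\<lambda>_. 1) t w)"
    unfolding departure_sum_def of_real_sum by (rule sum.cong) auto
  show ?thesis
    using level_crossing[OF assms(2), of n] unfolding a d of_real_diff[symmetric] norm_of_real .
qed

text \<open>The terms are orthogonal, and the number of nonzero terms is that of arrivals finding \<open>n\<close>. It
  exceeds the number of departures leaving \<open>n\<close> by at most one, so its mean grows linearly by
  \<open>departure_count_bound\<close>.\<close>

lemma arrival_martingale_centred:
  fixes f :: "real \<Rightarrow> real"
  assumes f[measurable]: "f \<in> borel_measurable borel" and fb: "\<And>x. \<bar>f x\<bar> \<le> 1" and f0: "(LINT x|G. f x) = 0"
  shows "AE w in M. (\<lambda>m. arr_sum n f (real (m\<^sup>2)) w / (real m)\<^sup>2) \<longlonglongrightarrow> 0"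
proof -
  \<comment> \<open>The time \<open>0\<close> is excluded, as a batch of arrivals at time \<open>0\<close> is not bounded by a multiple of the time.\<close>
  define U where "U m K w = (if m = 0 then 0 else \<Sum>k<K. arrival_term n f (real (m\<^sup>2)) k w)" for m K :: nat and w
  define Y where "Y m w = (if m = 0 then 0 else arr_sum n f (real (m\<^sup>2)) w)" for m :: nat and w
  have mu: "0 < mu (Suc n)" by (rule mu_pos) simp
  have "AE w in M. (\<lambda>m. Y m w / (real m)\<^sup>2) \<longlonglongrightarrow> 0"
  proof (rule AE_tendsto_0_squares[where U=U and C="mu (Suc n) + 1"])
    show "U m K \<in> borel_measurable M" for m K unfolding U_def by measurable
    show "AE w in M. \<forall>m. (\<lambda>K. U m K w) \<longlonglongrightarrow> Y m w"
      using path_AE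
    proof (eventually_elim, intro allI)
      fix w m assume path: "queue_path N0 T Dep w"
      have "\<forall>\<^sub>F K in sequentially. U m K w = Y m w"
        using eventually_ge_at_top[of "arrivals T (real (m\<^sup>2)) w"]
        by eventually_elim (auto simp: U_def Y_def arrival_terms_eq[OF path])
      then show "(\<lambda>K. U m K w) \<longlonglongrightarrow> Y m w" by (rule tendsto_eventually)
    qed
    have b: "\<bar>arrival_term n f t k w\<bar> \<le> 1" for t k w by (simp add: arrival_term_def fb)
    have "(\<integral>\<^sup>+ w. ennreal ((U m K w)\<^sup>2) \<partial>M) \<le> ennreal ((mu (Suc n) + 1) * (real m)\<^sup>2)" for m K
    proof (cases "m = 0")
      case True
      then show ?thesis by (simp add: U_def)
    next
      case False
      let ?t = "real (m\<^sup>2)"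
      have bS: "\<bar>\<Sum>k<K. arrival_term n f ?t k w\<bar> \<le> real K" for w
        using sum_norm_le[of "{..<K}" "\<lambda>k. arrival_term n f ?t k w" "\<lambda>_. 1"] b by simp
      have "integrable M (\<lambda>w. (\<Sum>k<K. arrival_term n f ?t k w)\<^sup>2)"
      proof (rule integrable_bounded)
        show "\<bar>(\<Sum>k<K. arrival_term n f ?t k w)\<^sup>2\<bar> \<le> (real K)\<^sup>2" for w
          using power_mono[OF bS[of w] abs_ge_zero, of 2] by simp
      qed simp
      then have "(\<integral>\<^sup>+ w. ennreal ((\<Sum>k<K. arrival_term n f ?t k w)\<^sup>2) \<partial>M)
        = ennreal (expectation (\<lambda>w. (\<Sum>k<K. arrival_term n f ?t k w)\<^sup>2))"
        by (rule nn_integral_eq_integral) simp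
      also have "expectation (\<lambda>w. (\<Sum>k<K. arrival_term n f ?t k w)\<^sup>2) = (\<Sum>k<K. expectation (\<lambda>w. (arrival_term n f ?t k w)\<^sup>2))"
        by (rule orthogonal_sum_square[where B=1]) (use b arrival_terms_orthogonal[OF f fb f0] in auto)
      also have "\<dots> = expectation (\<lambda>w. \<Sum>k<K. (arrival_term n f ?t k w)\<^sup>2)"
        using b by (intro Bochner_Integration.integral_sum[symmetric] integrable_bounded[where B=1]) (auto simp: abs_square_le_1)
      also have "ennreal \<dots> = (\<integral>\<^sup>+ w. ennreal (\<Sum>k<K. (arrival_term n f ?t k w)\<^sup>2) \<partial>M)"
        using b by (intro nn_integral_eq_integral[symmetric] Bochner_Integration.integrable_sum integrable_bounded[where B=1])
          (auto simp: abs_square_le_1 intro!: sum_nonneg)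
      also have "\<dots> \<le> ennreal (mu (Suc n) * real (m\<^sup>2)) + 1"
      proof (rule departure_count_bound)
        show "AE w in M. ennreal (\<Sum>k<K. (arrival_term n f ?t k w)\<^sup>2) \<le> ennreal (dep_sum n (\<lambda>_. 1) ?t w) + 1"
          using simple_path_AE
        proof eventually_elim
          case (elim w)
          interpret simple_queue_path N0 T Dep w by (rule elim)
          have "(\<Sum>k<K. (arrival_term n f ?t k w)\<^sup>2) \<le> (\<Sum>k<K. arrival_term n (\<lambda>_. 1) ?t k w)"
            by (rule sum_mono) (auto simp: arrival_term_def abs_square_le_1 fb)
          also have "\<dots> \<le> (\<Sum>k<max K (arrivals T ?t w). arrival_term n (\<lambda>_. 1) ?t k w)"
            by (rule sum_mono2) (auto simp: arrival_term_def)
          also have "\<dots> = arr_sum n (\<lambda>_. 1) ?t w"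
            by (rule arrival_terms_eq) (auto intro: queue_path_axioms)
          also have "\<dots> \<le> dep_sum n (\<lambda>_. 1) ?t w + 1"
            using arrival_departure_count[OF elim, of ?t n] by simp
          finally have "ennreal (\<Sum>k<K. (arrival_term n f ?t k w)\<^sup>2) \<le> ennreal (dep_sum n (\<lambda>_. 1) ?t w + 1)"
            by (rule ennreal_leI)
          also have "\<dots> = ennreal (dep_sum n (\<lambda>_. 1) ?t w) + 1"
            by (subst ennreal_plus) (auto simp: departure_sum_def intro!: sum_nonneg)
          finally show ?case .
        qed
      qed
      also have "\<dots> = ennreal (mu (Suc n) * real (m\<^sup>2) + 1)"
        using mu by (subst ennreal_plus) auto
      also have "\<dots> \<le> ennreal ((mu (Suc n) + 1) * (real m)\<^sup>2)"
        using False by (intro ennreal_leI) (simp add: algebra_simps)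
      finally show ?thesis using False by (simp add: U_def)
    qed
    then show "\<forall>\<^sub>F K in sequentially. (\<integral>\<^sup>+ w. ennreal ((U m K w)\<^sup>2) \<partial>M) \<le> ennreal ((mu (Suc n) + 1) * (real m)\<^sup>2)" for m
      by simp
  qed
  then show ?thesis
  proof eventually_elim
    case (elim w)
    have "(\<lambda>m. Y m w / (real m)\<^sup>2) = (\<lambda>m. arr_sum n f (real (m\<^sup>2)) w / (real m)\<^sup>2)"
      by (auto simp: Y_def fun_eq_iff)
    then show ?case using elim by simp
  qed
qed

text \<open>The inter-arrival time that starts when \<open>n\<close> customers are found has, on average, the law \<open>G\<close>.\<close>

lemma arrival_martingale:
  fixes g :: "real \<Rightarrow> real"
  assumes g[measurable]: "g \<in> borel_measurable borel" and gb: "\<And>x. \<bar>g x\<bar> \<le> 1"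
  shows "AE w in M. (\<lambda>m. (arr_sum n g (real (m\<^sup>2)) w
    - (LINT x|G. g x) * arr_sum n (\<lambda>_. 1) (real (m\<^sup>2)) w) / (real m)\<^sup>2) \<longlonglongrightarrow> 0"
proof -
  interpret G: real_distribution G by (rule G_distribution)
  let ?c = "LINT x|G. g x"
  have ig: "integrable G g" by (rule G.integrable_bounded[where B=1]) (use gb in auto)
  have c: "\<bar>?c\<bar> \<le> 1"
  proof -
    have "\<bar>?c\<bar> \<le> (LINT x|G. \<bar>g x\<bar>)" by (rule integral_abs_bound)
    also have "\<dots> \<le> (LINT x|G. 1)"
      using gb ig by (intro integral_mono) auto
    finally show ?thesis using G.prob_space by simp
  qed
  let ?f = "\<lambda>x. (g x - ?c) / 2"
  have "AE w in M. (\<lambda>m. arr_sum n ?f (real (m\<^sup>2)) w / (real m)\<^sup>2) \<longlonglongrightarrow> 0"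
  proof (rule arrival_martingale_centred)
    show "\<bar>?f x\<bar> \<le> 1" for x using gb[of x] c by (simp add: abs_le_iff)
    show "(LINT x|G. ?f x) = 0" using ig G.prob_space by simp
  qed measurable
  then show ?thesis
  proof eventually_elim
    case (elim w)
    have "arr_sum n g t w - ?c * arr_sum n (\<lambda>_. 1) t w = 2 * arr_sum n ?f t w" for t
      unfolding arrival_sum_def sum_distrib_left sum_subtractf[symmetric] by (rule sum.cong) auto
    then have "(\<lambda>m. (arr_sum n g (real (m\<^sup>2)) w
      - ?c * arr_sum n (\<lambda>_. 1) (real (m\<^sup>2)) w) / (real m)\<^sup>2)
      = (\<lambda>m. 2 * (arr_sum n ?f (real (m\<^sup>2)) w / (real m)\<^sup>2))"
      by simp
    then show ?case using tendsto_mult_right_zero[OF elim, of 2] by simp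
  qed
qed

end

section \<open>Transforms and overshoots\<close>

text \<open>Weak convergence and the laws of large numbers are applied to functions on the whole line; the
  discount is therefore made constant on the negative axis, where it need not be bounded.\<close>

definition cdiscount :: "complex \<Rightarrow> real \<Rightarrow> complex" where
  "cdiscount s x = discount s (max 0 x)"

lemma cdiscount_eq: "0 \<le> x \<Longrightarrow> cdiscount s x = discount s x"
  by (simp add: cdiscount_def)

lemma isCont_cdiscount: "isCont (cdiscount s) x"
  unfolding cdiscount_def[abs_def] by (intro continuous_intros)

lemma cdiscount_measurable[measurable]: "cdiscount s \<in> borel_measurable borel"
  by (intro borel_measurable_continuous_onI continuous_at_imp_continuous_on) (simp add: isCont_cdiscount)

lemma norm_cdiscount: "0 \<le> Re s \<Longrightarrow> norm (cdiscount s x) \<le> 1"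
  unfolding cdiscount_def by (rule norm_exp_LST_le) auto

lemma cdiscount_lipschitz:
  assumes s: "0 \<le> Re s" and "0 \<le> x" "0 \<le> y"
  shows "norm (cdiscount s x - cdiscount s y) \<le> norm s * \<bar>x - y\<bar>"
proof -
  let ?S = "{z. Re z \<le> 0}"
  have "norm (exp (- (s * complex_of_real x)) - exp (- (s * complex_of_real y)))
      \<le> 1 * norm (- (s * complex_of_real x) - - (s * complex_of_real y))"
  proof (rule field_differentiable_bound[of ?S exp exp])
    show "convex ?S" by (rule convex_halfspace_Re_le)
    show "(exp has_field_derivative exp z) (at z within ?S)" for z :: complex
      by (rule DERIV_exp[THEN DERIV_subset]) simp
  qed (use assms in \<open>auto simp: norm_exp_eq_Re\<close>)
  also have "\<dots> = norm s * \<bar>x - y\<bar>"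
    by (simp add: right_diff_distrib[symmetric] norm_mult norm_minus_commute abs_minus_commute of_real_diff[symmetric] del: of_real_diff)
  finally show ?thesis using assms by (simp add: cdiscount_eq)
qed

text \<open>Dominated convergence; used to pass to arguments at which a closed formula has a removable
  singularity.\<close>

lemma lst_tendsto:
  assumes F: "finite_measure F" "sets F = sets borel" and s: "\<And>k. 0 \<le> Re (\<sigma> k)" and lim: "\<sigma> \<longlonglongrightarrow> s"
  shows "(\<lambda>k. lst F (\<sigma> k)) \<longlonglongrightarrow> lst F s"
  unfolding lst_def set_lebesgue_integral_def
proof (rule integral_dominated_convergence[where w="\<lambda>_. 1"])
  interpret finite_measure F by fact
  have [measurable_cong]: "sets F = sets borel" by fact
  show "(\<lambda>x. indicat_real {0..} x *\<^sub>R discount s x) \<in> borel_measurable F" by measurable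
  show "(\<lambda>x. indicat_real {0..} x *\<^sub>R discount (\<sigma> k) x) \<in> borel_measurable F" for k by measurable
  show "AE x in F. (\<lambda>k. indicat_real {0..} x *\<^sub>R discount (\<sigma> k) x) \<longlonglongrightarrow> indicat_real {0..} x *\<^sub>R discount s x"
    by (intro AE_I2 tendsto_intros lim)
  show "AE x in F. norm (indicat_real {0..} x *\<^sub>R discount (\<sigma> k) x) \<le> 1" for k
    using norm_exp_LST_le[OF s] by (auto simp: indicator_def)
  show "integrable F (\<lambda>_. 1 :: real)" by simp
qed

locale nonneg_distribution = real_distribution F for F :: "real measure" +
  assumes nonneg: "AE x in F. 0 \<le> x"
begin

lemma lst_eq: "lst F s = (LINT x|F. cdiscount s x)"
  unfolding lst_def set_lebesgue_integral_def
  by (rule integral_cong_AE) (use nonneg in \<open>auto simp: cdiscount_eq elim: eventually_mono\<close>)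

lemma integrable_cdiscount: "0 \<le> Re s \<Longrightarrow> integrable F (cdiscount s)"
  by (rule integrable_const_bound[where B=1]) (auto simp: norm_cdiscount)

text \<open>The transform at real arguments. Positivity arguments need real numbers.\<close>

definition rlst :: "real \<Rightarrow> real" where
  "rlst a = (LINT x|F. exp (- (a * max 0 x)))"

lemma integrable_rlst: "0 \<le> a \<Longrightarrow> integrable F (\<lambda>x. exp (- (a * max 0 x)))"
  by (rule integrable_const_bound[where B=1]) auto

lemma lst_of_real: "lst F (complex_of_real a) = complex_of_real (rlst a)"
proof -
  have "cdiscount (complex_of_real a) x = complex_of_real (exp (- (a * max 0 x)))" for x
    unfolding cdiscount_def of_real_mult[symmetric] of_real_minus[symmetric] by (rule exp_of_real)
  then have "cdiscount (complex_of_real a) = (\<lambda>x. complex_of_real (exp (- (a * max 0 x))))" ..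
  then have "lst F (complex_of_real a) = (LINT x|F. complex_of_real (exp (- (a * max 0 x))))"
    unfolding lst_eq by (rule arg_cong)
  also have "\<dots> = complex_of_real (rlst a)"
    unfolding rlst_def by (rule integral_complex_of_real)
  finally show ?thesis .
qed

lemma rlst_pos:
  assumes "0 \<le> a" shows "0 < rlst a"
proof -
  have "0 \<le> rlst a" unfolding rlst_def by (rule integral_nonneg_AE) simp
  moreover have "rlst a \<noteq> 0"
  proof
    assume "rlst a = 0"
    then have "AE x in F. exp (- (a * max 0 x)) = 0"
      unfolding rlst_def by (subst (asm) integral_nonneg_eq_0_iff_AE[OF integrable_rlst[OF assms]]) auto
    then have "AE x in F. False" by eventually_elim simp
    then show False by (simp add: AE_False prob_space)
  qed
  ultimately show ?thesis by simp
qed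

text \<open>Convexity of the transform at the points \<open>0\<close>, \<open>1\<close>, \<open>2\<close>, with the defect made explicit.\<close>

lemma rlst_convexity:
  "(LINT x|F. (1 - exp (- max 0 x))\<^sup>2) = 1 - 2 * rlst 1 + rlst 2"
proof -
  have "(1 - exp (- max 0 x))\<^sup>2 = 1 - 2 * exp (- (1 * max 0 x)) + exp (- (2 * max 0 x))" for x :: real
    by (simp add: exp_double[of "- max 0 x", simplified] power2_eq_square algebra_simps)
  then show ?thesis
    unfolding rlst_def using integrable_rlst[of 1] integrable_rlst[of 2] prob_space by simp
qed

lemma rlst_gap:
  assumes a: "0 < a" and nontrivial: "rlst 1 \<noteq> 1"
  shows "rlst a < 1" and "0 < 1 - 2 * rlst 1 + rlst 2"
proof -
  have i: "integrable F (\<lambda>x. (1 - exp (- max 0 x))\<^sup>2)" by (rule integrable_const_bound[where B=1]) (auto simp: abs_square_le_1)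
  have triv: "rlst 1 = 1" if "AE x in F. max 0 x = 0"
  proof -
    have "rlst 1 = (LINT x|F. 1)"
      unfolding rlst_def by (rule integral_cong_AE) (use that in \<open>auto elim: eventually_mono\<close>)
    then show ?thesis using prob_space by simp
  qed
  have "0 \<le> 1 - 2 * rlst 1 + rlst 2"
    unfolding rlst_convexity[symmetric] by (rule integral_nonneg_AE) simp
  moreover have "1 - 2 * rlst 1 + rlst 2 \<noteq> 0"
  proof
    assume "1 - 2 * rlst 1 + rlst 2 = 0"
    then have "AE x in F. (1 - exp (- max 0 x))\<^sup>2 = 0"
      unfolding rlst_convexity[symmetric] by (subst (asm) integral_nonneg_eq_0_iff_AE[OF i]) auto
    then have "AE x in F. max 0 x = 0" by eventually_elim simp
    then show False using triv nontrivial by simp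
  qed
  ultimately show "0 < 1 - 2 * rlst 1 + rlst 2" by simp
  have ia: "integrable F (\<lambda>x. 1 - exp (- (a * max 0 x)))" using integrable_rlst[of a] a by simp
  have e: "(LINT x|F. 1 - exp (- (a * max 0 x))) = 1 - rlst a"
    unfolding rlst_def using integrable_rlst[of a] a prob_space by simp
  have "0 \<le> 1 - rlst a"
    unfolding e[symmetric] by (rule integral_nonneg_AE) (use a in auto)
  moreover have "1 - rlst a \<noteq> 0"
  proof
    assume "1 - rlst a = 0"
    then have "AE x in F. 1 - exp (- (a * max 0 x)) = 0"
      unfolding e[symmetric] by (subst (asm) integral_nonneg_eq_0_iff_AE[OF ia]) (use a in auto)
    then have "AE x in F. max 0 x = 0" by eventually_elim (use a in auto)
    then show False using triv nontrivial by simp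
  qed
  ultimately show "rlst a < 1" by simp
qed

end

lemma exponential_convolution:
  assumes a: "0 < a" and s: "0 \<le> Re s" "s \<noteq> complex_of_real a" and x: "0 \<le> x"
  shows "(LINT y|density lborel (exponential_density a). indicator {..x} y *\<^sub>R discount s (x - y))
    = complex_of_real a * (discount s x - discount (complex_of_real a) x) / (complex_of_real a - s)"
proof -
  let ?a = "complex_of_real a"
  have "(LINT y|density lborel (exponential_density a). indicator {..x} y *\<^sub>R discount s (x - y))
    = (LINT y|lborel. exponential_density a y *\<^sub>R (indicator {..x} y *\<^sub>R discount s (x - y)))"
    by (rule integral_density) (auto simp: exponential_density_nonneg[OF a])
  also have "\<dots> = (LINT y|lborel. indicator {0..x} y *\<^sub>R (?a * (exp (- (s * of_real x)) * exp ((s - ?a) * of_real y))))"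
    by (rule Bochner_Integration.integral_cong)
       (auto simp: exponential_density_def indicator_def scaleR_conv_of_real exp_of_real[symmetric] exp_add[symmetric] algebra_simps)
  also have "\<dots> = ?a * (exp (- (s * of_real x)) * exp ((s - ?a) * of_real x)) / (s - ?a)
     - ?a * (exp (- (s * of_real x)) * exp ((s - ?a) * of_real 0)) / (s - ?a)"
  proof (rule integral_FTC_Icc[OF x])
    fix y
    have "((\<lambda>z. ?a * (exp (- (s * of_real x)) * exp ((s - ?a) * z)) / (s - ?a)) has_field_derivative
       ?a * (exp (- (s * of_real x)) * exp ((s - ?a) * of_real y))) (at (of_real y))"
      using s by (auto intro!: derivative_eq_intros)
    then show "((\<lambda>y. ?a * (exp (- (s * of_real x)) * exp ((s - ?a) * of_real y)) / (s - ?a)) has_vector_derivative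
       ?a * (exp (- (s * of_real x)) * exp ((s - ?a) * of_real y))) (at y within {0..x})"
      by (rule has_vector_derivative_real_field)
  qed (intro continuous_intros)
  also have "exp (- (s * of_real x)) * exp ((s - ?a) * of_real x) = discount ?a x"
    by (simp add: exp_add[symmetric] algebra_simps)
  finally have "(LINT y|density lborel (exponential_density a). indicator {..x} y *\<^sub>R discount s (x - y))
    = (?a * discount ?a x - ?a * discount s x) / (s - ?a)"
    by (simp add: diff_divide_distrib)
  also have "\<dots> = ?a * (discount s x - discount ?a x) / (?a - s)"
    unfolding minus_diff_eq[of ?a s, symmetric] divide_minus_right minus_divide_left right_diff_distrib by simp
  finally show ?thesis .
qed

context nonneg_distribution
begin

text \<open>The closed formula comes from integrating first over the exponential variable; the case \<open>s = 0\<close> of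
  the same computation gives the probability of the conditioning event. The hypothesis excludes the
  point mass at zero, for which this probability vanishes.\<close>

lemma overshoot_facts:
  assumes a: "0 < a" and nontrivial: "rlst 1 \<noteq> 1"
  shows finite_measure_overshoot: "finite_measure (exp_overshoot a F)"
    and lst_exp_overshoot: "\<And>s. 0 \<le> Re s \<Longrightarrow> s \<noteq> complex_of_real a \<Longrightarrow> lst (exp_overshoot a F) s =
      complex_of_real a * (lst F s - complex_of_real (rlst a)) / ((complex_of_real a - s) * complex_of_real (1 - rlst a))"
proof -
  let ?E = "density lborel (exponential_density a)" and ?B = "{(x, y). y \<le> x} :: (real \<times> real) set"
  interpret E: prob_space ?E by (rule prob_space_exponential_density[OF a])
  interpret P: pair_prob_space F ?E ..
  let ?P = "F \<Otimes>\<^sub>M ?E"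
  have B[measurable]: "?B \<in> sets ?P"
  proof -
    have "{p \<in> space ?P. snd p \<le> fst p} \<in> sets ?P" by measurable
    moreover have "{p \<in> space ?P. snd p \<le> fst p} = ?B" by (auto simp: space_pair_measure)
    ultimately show ?thesis by simp
  qed
  have conv: "(LINT p|?P. indicator ?B p *\<^sub>R discount s (fst p - snd p))
    = complex_of_real a * (lst F s - complex_of_real (rlst a)) / (complex_of_real a - s)"
    if s: "0 \<le> Re s" "s \<noteq> complex_of_real a" for s
  proof -
    have int: "integrable ?P (\<lambda>p. indicat_real ?B p *\<^sub>R discount s (fst p - snd p))"
      by (rule P.integrable_const_bound[where B=1])
         (auto simp: indicator_def intro!: norm_exp_LST_le[OF s(1), simplified])
    have "(LINT p|?P. indicator ?B p *\<^sub>R discount s (fst p - snd p))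
      = (LINT x|F. LINT y|?E. indicator ?B (x, y) *\<^sub>R discount s (x - y))"
      using P.integral_fst'[OF int] by simp
    also have "\<dots> = (LINT x|F. complex_of_real a * (cdiscount s x - cdiscount (complex_of_real a) x) / (complex_of_real a - s))"
    proof (rule integral_cong_AE)
      show "AE x in F. (LINT y|?E. indicator ?B (x, y) *\<^sub>R discount s (x - y))
        = complex_of_real a * (cdiscount s x - cdiscount (complex_of_real a) x) / (complex_of_real a - s)"
        using nonneg
      proof eventually_elim
        case (elim x)
        have "(LINT y|?E. indicator ?B (x, y) *\<^sub>R discount s (x - y)) = (LINT y|?E. indicator {..x} y *\<^sub>R discount s (x - y))"
          by (rule Bochner_Integration.integral_cong) (auto simp: indicator_def)
        then show ?case
          unfolding exponential_convolution[OF a s elim] by (simp add: cdiscount_eq[OF elim])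
      qed
    qed measurable
    also have "\<dots> = complex_of_real a * (lst F s - lst F (complex_of_real a)) / (complex_of_real a - s)"
      unfolding lst_eq using integrable_cdiscount[OF s(1)] integrable_cdiscount[of "complex_of_real a"] a by simp
    finally show ?thesis unfolding lst_of_real .
  qed
  have PB: "P.prob ?B = 1 - rlst a"
  proof -
    have "complex_of_real (P.prob ?B) = (LINT p|?P. complex_of_real (indicator ?B p))"
      using B by (simp add: integral_complex_of_real)
    also have "\<dots> = (LINT p|?P. indicator ?B p *\<^sub>R discount 0 (fst p - snd p))"
      by (rule Bochner_Integration.integral_cong) (auto simp: indicator_def)
    also have "\<dots> = complex_of_real (1 - rlst a)"
      using conv[of 0] lst_of_real[of 0] a prob_space by (simp add: rlst_def)
    finally show ?thesis by (simp only: of_real_eq_iff)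
  qed
  have pos: "0 < P.prob ?B" using rlst_gap(1)[OF a nontrivial] PB by simp
  let ?U = "uniform_measure ?P ?B"
  interpret U: prob_space ?U
    by (rule prob_space_uniform_measure) (use pos in \<open>auto simp: P.emeasure_eq_measure\<close>)
  have diff[measurable]: "(\<lambda>(x, y). x - y) \<in> ?U \<rightarrow>\<^sub>M (borel :: real measure)"
    by (subst measurable_cong_sets[OF sets_uniform_measure refl]) measurable
  show "finite_measure (exp_overshoot a F)"
    unfolding exp_overshoot_def by (rule U.finite_measure_distr[OF diff])
  fix s assume s: "0 \<le> Re s" "s \<noteq> complex_of_real a"
  have dens: "?U = density ?P (\<lambda>p. ennreal (indicator ?B p / P.prob ?B))"
    unfolding uniform_measure_def P.emeasure_eq_measure
    by (rule arg_cong[where f="density _"]) (auto simp: fun_eq_iff indicator_def divide_ennreal[OF zero_le_one pos, simplified])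
  have "lst (exp_overshoot a F) s = (LINT p|?U. indicator {0..} (fst p - snd p) *\<^sub>R discount s (fst p - snd p))"
    unfolding lst_def exp_overshoot_def set_lebesgue_integral_def
    by (subst integral_distr[OF diff]) (auto simp: case_prod_beta)
  also have "\<dots> = (LINT p|?P. (indicator ?B p / P.prob ?B) *\<^sub>R (indicator {0..} (fst p - snd p) *\<^sub>R discount s (fst p - snd p)))"
    unfolding dens by (rule integral_density) (use pos in auto)
  also have "\<dots> = (LINT p|?P. (indicator ?B p *\<^sub>R discount s (fst p - snd p)) / complex_of_real (P.prob ?B))"
    by (rule Bochner_Integration.integral_cong) (auto simp: indicator_def scaleR_conv_of_real)
  also have "\<dots> = complex_of_real a * (lst F s - complex_of_real (rlst a)) / (complex_of_real a - s) / complex_of_real (P.prob ?B)"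
    using conv[OF s] by simp
  finally show "lst (exp_overshoot a F) s =
      complex_of_real a * (lst F s - complex_of_real (rlst a)) / ((complex_of_real a - s) * complex_of_real (1 - rlst a))"
    unfolding PB by simp
qed

end

text \<open>Convergence of the empirical distribution function at rational points suffices for weak
  convergence, by monotonicity. Rational points are used because the convergence is only known almost
  surely for each point separately. Positivity of the limit somewhere shows that the empirical
  distributions are eventually not over the empty set.\<close>

lemma empirical_average_tendsto:
  fixes X :: "nat \<Rightarrow> real" and P :: "nat \<Rightarrow> bool" and \<phi> :: "real \<Rightarrow> complex"
  assumes F: "real_distribution F"
    and conv: "\<And>x. x \<in> \<rat> \<Longrightarrow> (\<lambda>m. real (card {j. j < m \<and> P j \<and> X j \<le> x}) / real (card {j. j < m \<and> P j})) \<longlonglongrightarrow> cdf F x"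
    and \<phi>: "\<And>x. isCont \<phi> x" "\<And>x. norm (\<phi> x) \<le> B"
  shows "(\<lambda>m. (\<Sum>j | j < m \<and> P j. \<phi> (X j)) / of_nat (card {j. j < m \<and> P j})) \<longlonglongrightarrow> (LINT x|F. \<phi> x)"
proof -
  interpret F: real_distribution F by fact
  let ?S = "\<lambda>m. {j. j < m \<and> P j}"
  have fin: "finite (?S m)" for m by simp
  have ne: "\<forall>\<^sub>F m in sequentially. ?S m \<noteq> {}"
  proof -
    have "\<forall>\<^sub>F x in at_top. 0 < cdf F x"
      using F.cdf_lim_at_top_prob by (rule order_tendstoD) simp
    then obtain N where N: "\<And>x. N \<le> x \<Longrightarrow> 0 < cdf F x" unfolding eventually_at_top_linorder by auto
    have "0 < cdf F (of_int \<lceil>N\<rceil>)" by (rule N) simp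
    then have "\<forall>\<^sub>F m in sequentially. 0 < real (card {j. j < m \<and> P j \<and> X j \<le> of_int \<lceil>N\<rceil>}) / real (card (?S m))"
      by (intro order_tendstoD(1)[OF conv]) auto
    then show ?thesis
    proof eventually_elim
      case (elim m)
      show ?case
      proof
        assume "?S m = {}"
        from elim show False unfolding \<open>?S m = {}\<close> by simp
      qed
    qed
  qed
  define \<nu> where "\<nu> m = (if ?S m = {} then F else distr (measure_pmf (pmf_of_set (?S m))) borel X)" for m
  have \<nu>: "real_distribution (\<nu> m)" for m
  proof (cases "?S m = {}")
    case True then show ?thesis by (simp add: \<nu>_def F)
  next
    case False
    have "prob_space (distr (measure_pmf (pmf_of_set (?S m))) borel X)"
      by (rule measure_pmf.prob_space_distr) simp
    then show ?thesis
      using False by (auto simp: \<nu>_def real_distribution_def real_distribution_axioms_def)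
  qed
  have cdf_\<nu>: "cdf (\<nu> m) x = real (card {j. j < m \<and> P j \<and> X j \<le> x}) / real (card (?S m))" if "?S m \<noteq> {}" for m x
  proof -
    have "cdf (\<nu> m) x = measure_pmf.prob (pmf_of_set (?S m)) {j. X j \<le> x}"
      unfolding \<nu>_def if_not_P[OF that] cdf_def by (simp add: measure_distr vimage_def)
    also have "\<dots> = real (card (?S m \<inter> {j. X j \<le> x})) / real (card (?S m))"
      by (rule measure_pmf_of_set[OF that fin])
    also have "?S m \<inter> {j. X j \<le> x} = {j. j < m \<and> P j \<and> X j \<le> x}" by auto
    finally show ?thesis .
  qed
  have convq: "(\<lambda>m. cdf (\<nu> m) x) \<longlonglongrightarrow> cdf F x" if "x \<in> \<rat>" for x
    by (rule Lim_transform_eventually[OF conv[OF that] eventually_mono[OF ne cdf_\<nu>[symmetric]]])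
  have mono: "cdf (\<nu> m) x \<le> cdf (\<nu> m) y" if "x \<le> y" for m x y
  proof -
    interpret \<nu>: real_distribution "\<nu> m" by (rule \<nu>)
    show ?thesis by (rule \<nu>.cdf_nondecreasing[OF that])
  qed
  have weak: "weak_conv_m \<nu> F"
    unfolding weak_conv_m_def weak_conv_def
  proof (intro allI impI)
    fix x assume "isCont (cdf F) x"
    then have lim: "(cdf F \<longlongrightarrow> cdf F x) (at x)" by (simp add: isCont_def)
    show "(\<lambda>m. cdf (\<nu> m) x) \<longlonglongrightarrow> cdf F x"
    proof (rule order_tendstoI)
      fix c assume "c < cdf F x"
      then have "\<forall>\<^sub>F y in at_left x. c < cdf F y"
        using order_tendstoD(1)[OF filterlim_mono[OF lim order_refl at_le]] by auto
      then obtain b where b: "b < x" "\<And>y. b < y \<Longrightarrow> y < x \<Longrightarrow> c < cdf F y" unfolding eventually_at_left_field by auto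
      obtain r where r: "r \<in> \<rat>" "b < r" "r < x" using Rats_dense_in_real[OF b(1)] by blast
      have "\<forall>\<^sub>F m in sequentially. c < cdf (\<nu> m) r"
        by (rule order_tendstoD(1)[OF convq[OF r(1)] b(2)[OF r(2,3)]])
      then show "\<forall>\<^sub>F m in sequentially. c < cdf (\<nu> m) x"
        by eventually_elim (use mono[of r x] r in \<open>auto intro: less_le_trans\<close>)
    next
      fix c assume "cdf F x < c"
      then have "\<forall>\<^sub>F y in at_right x. cdf F y < c"
        using order_tendstoD(2)[OF filterlim_mono[OF lim order_refl at_le]] by auto
      then obtain b where b: "x < b" "\<And>y. x < y \<Longrightarrow> y < b \<Longrightarrow> cdf F y < c" unfolding eventually_at_right_field by auto
      obtain r where r: "r \<in> \<rat>" "x < r" "r < b" using Rats_dense_in_real[OF b(1)] by blast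
      have "\<forall>\<^sub>F m in sequentially. cdf (\<nu> m) r < c"
        by (rule order_tendstoD(2)[OF convq[OF r(1)] b(2)[OF r(2,3)]])
      then show "\<forall>\<^sub>F m in sequentially. cdf (\<nu> m) x < c"
        by eventually_elim (use mono[of x r] r in \<open>auto intro: le_less_trans\<close>)
    qed
  qed
  have "(\<lambda>m. LINT x|\<nu> m. \<phi> x) \<longlonglongrightarrow> (LINT x|F. \<phi> x)"
    by (rule weak_conv_imp_integral_bdd_continuous_conv[OF \<nu> F weak \<phi>])
  moreover have "\<forall>\<^sub>F m in sequentially. (LINT x|\<nu> m. \<phi> x) = (\<Sum>j | j < m \<and> P j. \<phi> (X j)) / of_nat (card {j. j < m \<and> P j})"
    using ne
  proof eventually_elim
    case (elim m)
    have [measurable]: "\<phi> \<in> borel_measurable borel"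
      by (intro borel_measurable_continuous_onI continuous_at_imp_continuous_on) (simp add: \<phi>)
    have "(LINT x|\<nu> m. \<phi> x) = (LINT j|measure_pmf (pmf_of_set (?S m)). \<phi> (X j))"
      unfolding \<nu>_def if_not_P[OF elim] by (rule integral_distr) auto
    also have "\<dots> = (\<Sum>j\<in>?S m. pmf (pmf_of_set (?S m)) j *\<^sub>R \<phi> (X j))"
      by (rule integral_measure_pmf[OF fin]) (use elim in \<open>auto simp: set_pmf_of_set\<close>)
    also have "\<dots> = (\<Sum>j\<in>?S m. \<phi> (X j) / of_nat (card (?S m)))"
      by (rule sum.cong) (use pmf_of_set[OF elim fin] in \<open>auto simp: scaleR_conv_of_real\<close>)
    finally show ?case by (simp add: sum_divide_distrib)
  qed
  ultimately show ?thesis by (rule Lim_transform_eventually)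
qed

section \<open>Long-run averages\<close>

lemma over_squares_tendsto_0:
  fixes f :: "nat \<Rightarrow> 'a::real_normed_field"
  assumes "\<And>m. norm (f m) \<le> c"
  shows "(\<lambda>m. f m / of_real ((real m)\<^sup>2)) \<longlonglongrightarrow> 0"
proof (rule Lim_null_comparison)
  show "\<forall>\<^sub>F m in sequentially. norm (f m / of_real ((real m)\<^sup>2)) \<le> c * (1 / real m * (1 / real m))"
    using assms by (intro always_eventually allI) (simp add: norm_divide norm_mult power2_eq_square divide_right_mono)
  have "(\<lambda>m. c * (1 / real m * (1 / real m))) \<longlonglongrightarrow> c * (0 * 0)"
    by (intro tendsto_intros lim_1_over_n)
  then show "(\<lambda>m. c * (1 / real m * (1 / real m))) \<longlonglongrightarrow> 0" by simp
qed

lemma (in prob_space) AE_witness: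
  assumes "AE w in M. P w" obtains w where "w \<in> space M" "P w"
proof -
  have "\<not> (AE w in M. \<not> P w)" using AE_contr[OF assms] by blast
  then have "\<not> (\<forall>w\<in>space M. \<not> P w)" by (auto intro: AE_I2)
  then show ?thesis using that by blast
qed

context queue_path
begin

lemma state_integral_occupation:
  assumes t: "0 \<le> t"
  shows "state_integral N0 T Dep n (\<lambda>_. 1 :: real) t w = measure lborel {u \<in> {0..t}. queue_length N0 T Dep u w = n}"
proof -
  let ?S = "{u \<in> {0..t}. queue_length N0 T Dep u w = n}"
  note queue_length_time_measurable[measurable]
  have "{u \<in> space borel. N0 w + arrivals T u w - Dep (max 0 u) w = n} \<in> sets borel" by measurable
  then have "{0..t} \<inter> {u \<in> space borel. N0 w + arrivals T u w - Dep (max 0 u) w = n} \<in> sets borel" by auto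
  also have "{0..t} \<inter> {u \<in> space borel. N0 w + arrivals T u w - Dep (max 0 u) w = n} = ?S"
    by (auto simp: queue_length_def)
  finally have S: "?S \<in> sets borel" .
  have "emeasure lborel ?S \<le> emeasure lborel {0..t}" by (rule emeasure_mono) auto
  then have "emeasure lborel ?S < \<infinity>" using t by (simp add: le_less_trans)
  then have "((\<lambda>_. 1 :: real) has_integral measure lborel ?S) ?S"
    by (rule has_integral_measure_lborel[OF S])
  then have "((\<lambda>u. if u \<in> ?S then 1 else 0) has_integral measure lborel ?S) {0..t}"
    by (subst has_integral_restrict) auto
  then have "((\<lambda>u. if queue_length N0 T Dep u w = n then 1 else 0) has_integral measure lborel ?S) {0..t}"
    by (rule has_integral_eq[rotated]) auto
  then show ?thesis unfolding state_integral_def by (rule integral_unique)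
qed

end

context simple_queue_path
begin

lemma residual_interarrival_pos:
  assumes "j < Dep t w" "0 \<le> t" shows "0 < residual_interarrival T Dep j w"
  using residual_interarrival_eq[of j t] assms residual_pos by simp

lemma departure_sum_components:
  assumes "0 \<le> t"
  shows "Re (departure_sum N0 T Dep n (discount s) t w) = departure_sum N0 T Dep n (\<lambda>x. Re (cdiscount s x)) t w"
    and "Im (departure_sum N0 T Dep n (discount s) t w) = departure_sum N0 T Dep n (\<lambda>x. Im (cdiscount s x)) t w"
  unfolding departure_sum_def Re_sum Im_sum
  using residual_interarrival_pos[OF _ assms] by (auto intro!: sum.cong simp: cdiscount_eq less_imp_le)

lemma arrival_sum_components:
  shows "Re (arrival_sum N0 T Dep n (discount s) t w) = arrival_sum N0 T Dep n (\<lambda>x. Re (cdiscount s x)) t w"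
    and "Im (arrival_sum N0 T Dep n (discount s) t w) = arrival_sum N0 T Dep n (\<lambda>x. Im (cdiscount s x)) t w"
  unfolding arrival_sum_def Re_sum Im_sum
  using T_step by (auto intro!: sum.cong simp: cdiscount_eq)

lemma state_integral_components:
  assumes s: "0 \<le> Re s"
  shows "Re (state_integral N0 T Dep n (discount s) t w) = state_integral N0 T Dep n (\<lambda>x. Re (cdiscount s x)) t w"
    and "Im (state_integral N0 T Dep n (discount s) t w) = state_integral N0 T Dep n (\<lambda>x. Im (cdiscount s x)) t w"
proof -
  let ?f = "\<lambda>u. if queue_length N0 T Dep u w = n then discount s (residual T u w) else 0"
  have i: "?f integrable_on {0..t}"
    by (rule path_integrable[where f="\<lambda>q r. if q = n then discount s r else 0" and B=1])
       (auto simp: norm_exp_LST_le[OF s, simplified])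
  have e: "(Re \<circ> ?f) = (\<lambda>u. if queue_length N0 T Dep u w = n then Re (cdiscount s (residual T u w)) else 0)"
    "(Im \<circ> ?f) = (\<lambda>u. if queue_length N0 T Dep u w = n then Im (cdiscount s (residual T u w)) else 0)"
    using residual_pos by (auto simp: fun_eq_iff cdiscount_eq less_imp_le)
  show "Re (state_integral N0 T Dep n (discount s) t w) = state_integral N0 T Dep n (\<lambda>x. Re (cdiscount s x)) t w"
    using integral_linear[OF i bounded_linear_Re] unfolding state_integral_def e by simp
  show "Im (state_integral N0 T Dep n (discount s) t w) = state_integral N0 T Dep n (\<lambda>x. Im (cdiscount s x)) t w"
    using integral_linear[OF i bounded_linear_Im] unfolding state_integral_def e by simp
qed

lemma norm_departure_sum_le:
  assumes s: "0 \<le> Re s" and t: "0 \<le> t"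
  shows "norm (departure_sum N0 T Dep n (discount s) t w) \<le> departure_sum N0 T Dep n (\<lambda>_. 1) t w"
  unfolding departure_sum_def
  by (rule sum_norm_le) (use residual_interarrival_pos[OF _ t] norm_exp_LST_le[OF s] in \<open>auto simp: less_imp_le\<close>)

end

context GMn1_service
begin

lemma cdiscount_components:
  assumes s: "0 \<le> Re s"
  shows "\<bar>Re (cdiscount s x)\<bar> \<le> 1" "\<bar>Im (cdiscount s x)\<bar> \<le> 1"
    "0 \<le> x \<Longrightarrow> 0 \<le> y \<Longrightarrow> \<bar>Re (cdiscount s x) - Re (cdiscount s y)\<bar> \<le> norm s * \<bar>x - y\<bar>"
    "0 \<le> x \<Longrightarrow> 0 \<le> y \<Longrightarrow> \<bar>Im (cdiscount s x) - Im (cdiscount s y)\<bar> \<le> norm s * \<bar>x - y\<bar>"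
  using abs_Re_le_cmod[of "cdiscount s x"] abs_Im_le_cmod[of "cdiscount s x"] norm_cdiscount[OF s, of x]
    abs_Re_le_cmod[of "cdiscount s x - cdiscount s y"] abs_Im_le_cmod[of "cdiscount s x - cdiscount s y"]
    cdiscount_lipschitz[OF s, of x y] by auto

lemma departure_martingale_lst:
  assumes s: "0 \<le> Re s"
  shows "AE w in M. (\<lambda>m. (dep_sum n (discount s) (real (m\<^sup>2)) w
      - of_real (mu (Suc n)) * occ_integral (Suc n) (discount s) (real (m\<^sup>2)) w) / of_real ((real m)\<^sup>2)) \<longlonglongrightarrow> 0"
proof -
  have "AE w in M. (\<lambda>m. (dep_sum n (\<lambda>x. Re (cdiscount s x)) (real (m\<^sup>2)) w
      - mu (Suc n) * occ_integral (Suc n) (\<lambda>x. Re (cdiscount s x)) (real (m\<^sup>2)) w) / (real m)\<^sup>2) \<longlonglongrightarrow> 0"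
    by (rule departure_martingale[where L="norm s"]) (use cdiscount_components[OF s] in auto)
  moreover have "AE w in M. (\<lambda>m. (dep_sum n (\<lambda>x. Im (cdiscount s x)) (real (m\<^sup>2)) w
      - mu (Suc n) * occ_integral (Suc n) (\<lambda>x. Im (cdiscount s x)) (real (m\<^sup>2)) w) / (real m)\<^sup>2) \<longlonglongrightarrow> 0"
    by (rule departure_martingale[where L="norm s"]) (use cdiscount_components[OF s] in auto)
  ultimately show ?thesis
    using simple_path_AE
  proof eventually_elim
    case (elim w)
    interpret simple_queue_path N0 T Dep w by (rule elim)
    have t: "0 \<le> real (m\<^sup>2)" for m :: nat by simp
    show ?case
      unfolding tendsto_complex_iff Re_divide_of_real Im_divide_of_real minus_complex.sel Re_complex_of_real
        times_complex.sel Im_complex_of_real departure_sum_components[OF t] state_integral_components[OF s]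
      using elim(1,2) by simp
  qed
qed

lemma G_nonneg_distribution: "nonneg_distribution G"
  using G_distribution G_nonneg by (simp add: nonneg_distribution_def nonneg_distribution_axioms_def)

lemma arrival_martingale_lst:
  assumes s: "0 \<le> Re s"
  shows "AE w in M. (\<lambda>m. (arr_sum n (discount s) (real (m\<^sup>2)) w
      - lst G s * of_real (arr_sum n (\<lambda>_. 1) (real (m\<^sup>2)) w)) / of_real ((real m)\<^sup>2)) \<longlonglongrightarrow> 0"
proof -
  interpret G: nonneg_distribution G by (rule G_nonneg_distribution)
  have "AE w in M. (\<lambda>m. (arr_sum n (\<lambda>x. Re (cdiscount s x)) (real (m\<^sup>2)) w
      - (LINT x|G. Re (cdiscount s x)) * arr_sum n (\<lambda>_. 1) (real (m\<^sup>2)) w) / (real m)\<^sup>2) \<longlonglongrightarrow> 0"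
    by (rule arrival_martingale) (use cdiscount_components[OF s] in auto)
  moreover have "AE w in M. (\<lambda>m. (arr_sum n (\<lambda>x. Im (cdiscount s x)) (real (m\<^sup>2)) w
      - (LINT x|G. Im (cdiscount s x)) * arr_sum n (\<lambda>_. 1) (real (m\<^sup>2)) w) / (real m)\<^sup>2) \<longlonglongrightarrow> 0"
    by (rule arrival_martingale) (use cdiscount_components[OF s] in auto)
  ultimately show ?thesis
    using simple_path_AE
  proof eventually_elim
    case (elim w)
    interpret simple_queue_path N0 T Dep w by (rule elim)
    have "Re (lst G s) = (LINT x|G. Re (cdiscount s x))" "Im (lst G s) = (LINT x|G. Im (cdiscount s x))"
      unfolding G.lst_eq using G.integrable_cdiscount[OF s] by simp_all
    then show ?case
      unfolding tendsto_complex_iff Re_divide_of_real Im_divide_of_real minus_complex.sel Re_complex_of_real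
        times_complex.sel Im_complex_of_real arrival_sum_components
      using elim(1,2) by simp
  qed
qed

lemma gap_expectation: "integrable M (gap k)" "expectation (gap k) = 1 / lam"
proof -
  have "integrable (distr M borel (gap k)) (\<lambda>x. x)" unfolding gap_law by (rule G_integrable)
  then show "integrable M (gap k)" by (subst (asm) integrable_distr_eq) auto
  have "(LINT x|distr M borel (gap k). x) = expectation (gap k)" by (rule integral_distr) auto
  then show "expectation (gap k) = 1 / lam" unfolding gap_law G_mean by simp
qed

end

section \<open>Balance in the long run\<close>

locale stable_service = GMn1_service M G lam mu N0 T Dep q
  for M :: "'w measure" and G :: "real measure" and lam :: real and mu :: "nat \<Rightarrow> real"
    and N0 :: "'w \<Rightarrow> nat" and T :: "nat \<Rightarrow> 'w \<Rightarrow> real" and Dep :: "real \<Rightarrow> 'w \<Rightarrow> nat" and q +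
  fixes p :: "nat \<Rightarrow> real" and R :: "nat \<Rightarrow> real measure"
  assumes p_nonneg: "\<And>n. 0 \<le> p n" and p_sums: "p sums 1"
    and occupation: "\<And>n. AE w in M. ((\<lambda>t. measure lborel {u \<in> {0..t}. qlen u w = n} / t) \<longlongrightarrow> p n) at_top"
    and residual_law: "\<And>k. steady_residual_law M N0 T Dep k (R k)"
begin

text \<open>The long-run rate of departures leaving \<open>n\<close>, and of arrivals finding \<open>n\<close>.\<close>

definition throughput :: "nat \<Rightarrow> real" where
  "throughput n = mu (Suc n) * p (Suc n)"

lemma mu_Suc_pos: "0 < mu (Suc n)"
  by (rule mu_pos) simp

lemma throughput_nonneg: "0 \<le> throughput n"
  unfolding throughput_def using mu_Suc_pos[of n] p_nonneg[of "Suc n"] by simp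

lemma occupation_squares:
  "AE w in M. (\<lambda>m. occ_integral n (\<lambda>_. 1 :: real) (real (m\<^sup>2)) w / (real m)\<^sup>2) \<longlonglongrightarrow> p n"
  using occupation[of n] simple_path_AE
proof eventually_elim
  case (elim w)
  interpret simple_queue_path N0 T Dep w by (rule elim)
  have "filterlim (\<lambda>m::nat. m\<^sup>2) at_top sequentially"
    by (rule filterlim_at_top_mono[OF filterlim_ident]) (auto simp: power2_nat_le_imp_le power2_eq_square)
  then have "filterlim (\<lambda>m::nat. real (m\<^sup>2)) at_top sequentially"
    by (rule filterlim_compose[OF filterlim_real_sequentially])
  from filterlim_compose[OF elim(1) this]
  show ?case
    using state_integral_occupation[of "real (m\<^sup>2)" n for m] by simp
qed

lemma departure_rate:
  "AE w in M. (\<lambda>m. dep_sum n (\<lambda>_. 1 :: real) (real (m\<^sup>2)) w / (real m)\<^sup>2) \<longlonglongrightarrow> throughput n"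
proof -
  have "AE w in M. (\<lambda>m. (dep_sum n (\<lambda>_. 1 :: real) (real (m\<^sup>2)) w
      - mu (Suc n) * occ_integral (Suc n) (\<lambda>_. 1) (real (m\<^sup>2)) w) / (real m)\<^sup>2) \<longlonglongrightarrow> 0"
    by (rule departure_martingale[where L=0]) auto
  then show ?thesis
    using occupation_squares[of "Suc n"]
  proof eventually_elim
    case (elim w)
    from tendsto_add[OF elim(1) tendsto_mult_left[OF elim(2), of "mu (Suc n)"]]
    show ?case by (simp add: throughput_def diff_divide_distrib)
  qed
qed

lemma arrival_rate:
  "AE w in M. (\<lambda>m. arr_sum n (\<lambda>_. 1 :: real) (real (m\<^sup>2)) w / (real m)\<^sup>2) \<longlonglongrightarrow> throughput n"
  using departure_rate[of n] simple_path_AE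
proof eventually_elim
  case (elim w)
  have "(\<lambda>m. (arr_sum n (\<lambda>_. 1 :: real) (real (m\<^sup>2)) w - dep_sum n (\<lambda>_. 1) (real (m\<^sup>2)) w) / of_real ((real m)\<^sup>2)) \<longlonglongrightarrow> 0"
    by (rule over_squares_tendsto_0[where c=1]) (use arrival_departure_count[OF elim(2)] in auto)
  from tendsto_add[OF this elim(1)] show ?case by (simp add: diff_divide_distrib)
qed

text \<open>Without throughput the system would be empty almost all the time. Then \<open>empty_balance\<close> bounds the
  discounted empty time, hence the whole discounted time, by terms that are negligible on the scale \<open>t\<close>, and
  \<open>renewal_balance\<close> says the same of the sum over all arrivals.\<close>

lemma renewal_sum_vanishes:
  assumes "\<And>n. throughput n = 0"
  shows "AE w in M. (\<lambda>m. (\<Sum>k<arrivals T (real (m\<^sup>2)) w. 1 - exp (- max 0 (gap k w))) / (real m)\<^sup>2) \<longlonglongrightarrow> 0"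
proof -
  have "p (Suc n) = 0" for n
    using assms[of n] mu_Suc_pos[of n] by (simp add: throughput_def)
  then have "p n = 0" if "n \<notin> {0}" for n
    using that by (cases n) simp_all
  then have "p sums (\<Sum>n\<in>{0}. p n)"
    by (intro sums_finite) auto
  then have "p sums p 0" by simp
  then have p0: "p 0 = 1" using p_sums sums_unique2 by blast
  show ?thesis
    using occupation_squares[of 0] departure_rate[of 0] arrival_rate[of 0] simple_path_AE
  proof eventually_elim
    case (elim w)
    interpret simple_queue_path N0 T Dep w by (rule elim)
    let ?D = "\<lambda>t. dep_sum 0 (\<lambda>_. 1 :: real) t w" and ?A = "\<lambda>t. arr_sum 0 (\<lambda>_. 1 :: real) t w"
      and ?O = "\<lambda>t. occ_integral 0 (\<lambda>_. 1 :: real) t w"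
    have bound: "(\<Sum>k<arrivals T t w. 1 - exp (- max 0 (gap k w))) \<le> (t - ?O t) + ?A t + ?D t + 4" if t: "0 \<le> t" for t
    proof -
      let ?e = "\<lambda>u. discount 1 (residual T u w)" and ?f = "\<lambda>u. if qlen u w = 0 then discount 1 (residual T u w) else 0"
      have ie: "?e integrable_on {0..t}"
        by (rule path_integrable[where f="\<lambda>q r. discount 1 r" and B=1]) auto
      have if': "?f integrable_on {0..t}"
        by (rule path_integrable[where f="\<lambda>q r. if q = 0 then discount 1 r else 0" and B=1]) auto
      have i1: "(\<lambda>u. if qlen u w = 0 then 1 else 0 :: real) integrable_on {0..t}"
        by (rule path_integrable[where f="\<lambda>q r. if q = 0 then 1 else 0 :: real" and B=1]) auto
      have "norm (integral {0..t} ?e - integral {0..t} ?f) = norm (integral {0..t} (\<lambda>u. ?e u - ?f u))"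
        using ie if' by (simp add: Henstock_Kurzweil_Integration.integral_diff)
      also have "\<dots> \<le> integral {0..t} (\<lambda>u. 1 - (if qlen u w = 0 then 1 else 0))"
        by (rule integral_norm_bound_integral)
           (use ie if' i1 residual_pos in \<open>auto intro!: Henstock_Kurzweil_Integration.integrable_diff simp: norm_exp_eq_Re less_imp_le\<close>)
      also have "\<dots> = t - ?O t"
        using i1 t unfolding state_integral_def by (subst Henstock_Kurzweil_Integration.integral_diff) auto
      finally have 1: "norm (integral {0..t} ?e - occ_integral 0 (discount 1) t w) \<le> t - ?O t"
        unfolding state_integral_def .
      have 2: "norm (occ_integral 0 (discount 1) t w - (arr_sum 0 (\<lambda>_. 1) t w - dep_sum 0 (discount 1) t w)) \<le> 2"
        using empty_balance[of 1 t] t by simp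
      have 3: "norm (integral {0..t} ?e - (\<Sum>k<arrivals T t w. 1 - discount 1 (T (Suc k) w - T k w))) \<le> 2"
        using renewal_balance[of 1 t] t by simp
      have 4: "norm (dep_sum 0 (discount 1) t w) \<le> ?D t"
        using norm_departure_sum_le[of 1 t] t by simp
      have 5: "norm (arr_sum 0 (\<lambda>_. 1 :: complex) t w) \<le> ?A t"
        unfolding arrival_sum_def by (rule sum_norm_le) auto
      have 6: "(\<Sum>k<arrivals T t w. 1 - discount 1 (T (Suc k) w - T k w)) = complex_of_real (\<Sum>k<arrivals T t w. 1 - exp (- max 0 (gap k w)))"
        unfolding of_real_sum
      proof (rule sum.cong[OF refl])
        fix k
        have e: "discount 1 (T (Suc k) w - T k w) = complex_of_real (exp (- (T (Suc k) w - T k w)))"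
          unfolding mult_1_left of_real_minus[symmetric] by (rule exp_of_real)
        show "1 - discount 1 (T (Suc k) w - T k w) = complex_of_real (1 - exp (- max 0 (gap k w)))"
          using T_step[of k] unfolding e gap_def by (simp add: max_absorb2)
      qed
      have chain: "norm S \<le> norm (i - S) + norm (i - z) + norm (z - (a - d)) + (norm a + norm d)" for S i z a d :: complex
        using norm_triangle_sub[of S i] norm_triangle_sub[of i z] norm_triangle_sub[of z "a - d"] norm_triangle_ineq4[of a d]
        unfolding norm_minus_commute[of S i] by linarith
      have "norm (complex_of_real (\<Sum>k<arrivals T t w. 1 - exp (- max 0 (gap k w)))) \<le> (t - ?O t) + ?A t + ?D t + 4"
        using order_trans[OF chain add_mono[OF add_mono[OF add_mono[OF 3[unfolded 6] 1] 2] add_mono[OF 5 4]]] by simp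
      then show ?thesis unfolding norm_of_real by linarith
    qed
    have "(\<lambda>m. (real (m\<^sup>2) - ?O (real (m\<^sup>2))) / (real m)\<^sup>2 + ?A (real (m\<^sup>2)) / (real m)\<^sup>2 + ?D (real (m\<^sup>2)) / (real m)\<^sup>2 + 4 / of_real ((real m)\<^sup>2)) \<longlonglongrightarrow> (1 - p 0) + 0 + 0 + 0"
    proof (intro tendsto_add)
      show "(\<lambda>m. (real (m\<^sup>2) - ?O (real (m\<^sup>2))) / (real m)\<^sup>2) \<longlonglongrightarrow> 1 - p 0"
      proof (rule Lim_transform_eventually[OF tendsto_diff[OF tendsto_const elim(1)]])
        show "\<forall>\<^sub>F m in sequentially. 1 - ?O (real (m\<^sup>2)) / (real m)\<^sup>2 = (real (m\<^sup>2) - ?O (real (m\<^sup>2))) / (real m)\<^sup>2"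
          using eventually_gt_at_top[of "0::nat"] by eventually_elim (simp add: diff_divide_distrib)
      qed
      show "(\<lambda>m. 4 / of_real ((real m)\<^sup>2)) \<longlonglongrightarrow> (0::real)" by (rule over_squares_tendsto_0[where c=4]) simp
    qed (use elim(2,3) assms in auto)
    then have lim: "(\<lambda>m. (real (m\<^sup>2) - ?O (real (m\<^sup>2))) / (real m)\<^sup>2 + ?A (real (m\<^sup>2)) / (real m)\<^sup>2 + ?D (real (m\<^sup>2)) / (real m)\<^sup>2 + 4 / of_real ((real m)\<^sup>2)) \<longlonglongrightarrow> (0::real)"
      using p0 by simp
    show ?case
    proof (rule tendsto_sandwich[OF _ _ tendsto_const lim])
      show "\<forall>\<^sub>F m in sequentially. 0 \<le> (\<Sum>k<arrivals T (real (m\<^sup>2)) w. 1 - exp (- max 0 (gap k w))) / (real m)\<^sup>2"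
        by (intro always_eventually allI divide_nonneg_nonneg sum_nonneg) auto
      show "\<forall>\<^sub>F m in sequentially. (\<Sum>k<arrivals T (real (m\<^sup>2)) w. 1 - exp (- max 0 (gap k w))) / (real m)\<^sup>2
        \<le> (real (m\<^sup>2) - ?O (real (m\<^sup>2))) / (real m)\<^sup>2 + ?A (real (m\<^sup>2)) / (real m)\<^sup>2 + ?D (real (m\<^sup>2)) / (real m)\<^sup>2 + 4 / of_real ((real m)\<^sup>2)"
      proof (intro always_eventually allI)
        fix m :: nat
        have "(\<Sum>k<arrivals T (real (m\<^sup>2)) w. 1 - exp (- max 0 (gap k w))) / (real m)\<^sup>2
          \<le> ((real (m\<^sup>2) - ?O (real (m\<^sup>2))) + ?A (real (m\<^sup>2)) + ?D (real (m\<^sup>2)) + 4) / (real m)\<^sup>2"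
          by (rule divide_right_mono[OF bound]) simp_all
        then show "(\<Sum>k<arrivals T (real (m\<^sup>2)) w. 1 - exp (- max 0 (gap k w))) / (real m)\<^sup>2
          \<le> (real (m\<^sup>2) - ?O (real (m\<^sup>2))) / (real m)\<^sup>2 + ?A (real (m\<^sup>2)) / (real m)\<^sup>2 + ?D (real (m\<^sup>2)) / (real m)\<^sup>2 + 4 / of_real ((real m)\<^sup>2)"
          by (simp only: add_divide_distrib of_real_eq_id id_apply)
      qed
    qed
  qed
qed

text \<open>Markov's inequality: with probability at least one half the arrivals come at no less than half their
  nominal rate.\<close>

lemma arrival_delay_prob:
  assumes "0 < K"
  shows "1 / 2 \<le> prob {w \<in> space M. T K w - T 0 w < 2 * real K / lam}"
proof -
  let ?X = "\<lambda>w. T K w - T 0 w" and ?c = "2 * real K / lam"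
  have X: "?X = (\<lambda>w. \<Sum>j<K. gap j w)" using T_sum_gap[of K] by (auto simp: fun_eq_iff)
  have c: "0 < ?c" using assms lam_pos by simp
  have "prob {w \<in> space M. ?c \<le> ?X w} \<le> expectation ?X / ?c"
  proof (rule integral_Markov_inequality_measure[where A="{}"])
    show "integrable M ?X" unfolding X using gap_expectation by simp
    show "AE w in M. 0 \<le> ?X w"
      using gap_nonneg
    proof eventually_elim
      case (elim w)
      then have "0 \<le> (\<Sum>j<K. gap j w)" by (intro sum_nonneg) auto
      then show ?case using T_sum_gap[of K w] by simp
    qed
  qed (use c in auto)
  also have "expectation ?X = real K / lam"
    unfolding X using gap_expectation by simp
  also have "real K / lam / ?c = 1 / 2" using assms lam_pos by simp
  finally have "prob {w \<in> space M. ?c \<le> ?X w} \<le> 1 / 2" .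
  moreover have "prob {w \<in> space M. ?X w < ?c} = 1 - prob {w \<in> space M. ?c \<le> ?X w}"
  proof -
    have "{w \<in> space M. ?X w < ?c} = space M - {w \<in> space M. ?c \<le> ?X w}" by auto
    then show ?thesis by (simp add: prob_compl)
  qed
  ultimately show ?thesis by simp
qed

text \<open>Arrivals at a positive rate contradict \<open>renewal_sum_vanishes\<close>. The number of arrivals is only known
  to be linear in time with probability one half at each time; this suffices, because the
  contradiction forces the corresponding events to fail eventually on almost every path.\<close>

lemma some_throughput_pos: "\<exists>n. 0 < throughput n"
proof (rule ccontr)
  assume "\<nexists>n. 0 < throughput n"
  then have z: "throughput n = 0" for n using throughput_nonneg[of n] by (metis order_le_less)
  let ?f = "\<lambda>x::real. 1 - exp (- max 0 x)"
  let ?c = "LINT x|G. ?f x"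
  have c: "0 < ?c" by (rule expectation_truncated_gap_pos)
  \<comment> \<open>By time \<open>(b * K)\<^sup>2\<close> there have been \<open>K\<^sup>2\<close> arrivals on the event \<open>E K\<close>, once \<open>T 0 w \<le> K\<close>.\<close>
  obtain b :: nat where b: "2 / lam + 1 \<le> real b" using real_arch_simple by blast
  have b1: "1 \<le> real b" using b lam_pos by (smt (verit) divide_pos_pos)
  define E where "E K = {w \<in> space M. T (K\<^sup>2) w - T 0 w < 2 * real (K\<^sup>2) / lam}" for K :: nat
  have [measurable]: "E K \<in> sets M" for K unfolding E_def by measurable
  have "AE w in M. (\<lambda>K. indicat_real (E K) w) \<longlonglongrightarrow> 0"
    using renewal_sum_vanishes[OF z] gap_average[of ?f, simplified] simple_path_AE
  proof eventually_elim
    case (elim w)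
    interpret simple_queue_path N0 T Dep w by (rule elim)
    have "filterlim (\<lambda>K::nat. b * K) at_top sequentially"
      by (rule filterlim_at_top_mono[OF filterlim_ident]) (use b1 in auto)
    from filterlim_compose[OF elim(1) this]
    have "\<forall>\<^sub>F K in sequentially. (\<Sum>k<arrivals T (real ((b * K)\<^sup>2)) w. ?f (gap k w)) / (real (b * K))\<^sup>2 < ?c / 2 / (real b)\<^sup>2"
      by (rule order_tendstoD) (use c b1 in simp)
    moreover have "\<forall>\<^sub>F K in sequentially. - ?c / 2 < (\<Sum>k<K\<^sup>2. ?f (gap k w) - ?c) / (real K)\<^sup>2"
      by (rule order_tendstoD(1)[OF elim(2)]) (use c in simp)
    moreover have "\<forall>\<^sub>F K in sequentially. max 1 (T 0 w) \<le> real K"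
      using filterlim_real_sequentially unfolding filterlim_at_top by blast
    ultimately have "\<forall>\<^sub>F K in sequentially. indicat_real (E K) w = 0"
    proof eventually_elim
      case (elim K)
      have K: "1 \<le> real K" "T 0 w \<le> real K" using elim(3) by auto
      have K2: "real K \<le> (real K)\<^sup>2" using K by (simp add: power2_eq_square)
      have Kp: "0 < (real K)\<^sup>2" "0 < (real b)\<^sup>2" using K b1 by auto
      have "w \<notin> E K"
      proof
        assume "w \<in> E K"
        then have "T (K\<^sup>2) w < 2 * (real K)\<^sup>2 / lam + T 0 w" by (simp add: E_def)
        also have "\<dots> \<le> (2 / lam + 1) * (real K)\<^sup>2" using order_trans[OF K(2) K2] by (simp add: distrib_right)
        also have "\<dots> \<le> (real b)\<^sup>2 * (real K)\<^sup>2"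
          by (rule mult_right_mono) (use b b1 in \<open>auto simp: power2_eq_square intro: order_trans[OF b]\<close>)
        finally have "T (K\<^sup>2) w \<le> real ((b * K)\<^sup>2)" by (simp add: power_mult_distrib)
        then have "K\<^sup>2 \<le> arrivals T (real ((b * K)\<^sup>2)) w" using T_le_iff by (simp add: less_imp_le)
        then have "(\<Sum>k<K\<^sup>2. ?f (gap k w)) \<le> (\<Sum>k<arrivals T (real ((b * K)\<^sup>2)) w. ?f (gap k w))"
          by (intro sum_mono2) auto
        also have "\<dots> < ?c / 2 / (real b)\<^sup>2 * (real (b * K))\<^sup>2"
          using elim(1) Kp by (simp add: pos_divide_less_eq power_mult_distrib)
        also have "\<dots> = ?c / 2 * (real K)\<^sup>2" using Kp by (simp add: power_mult_distrib)
        finally have up: "(\<Sum>k<K\<^sup>2. ?f (gap k w)) < ?c / 2 * (real K)\<^sup>2" .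
        have "- ?c / 2 * (real K)\<^sup>2 < (\<Sum>k<K\<^sup>2. ?f (gap k w) - ?c)"
          using elim(2) Kp by (simp add: pos_less_divide_eq)
        also have "\<dots> = (\<Sum>k<K\<^sup>2. ?f (gap k w)) - (real K)\<^sup>2 * ?c"
          by (simp add: sum_subtractf)
        finally show False using up by (simp add: algebra_simps)
      qed
      then show ?case by simp
    qed
    then show ?case by (rule tendsto_eventually)
  qed
  then have "(\<lambda>K. expectation (indicat_real (E K))) \<longlonglongrightarrow> expectation (\<lambda>w. 0)"
    by (intro integral_dominated_convergence[where w="\<lambda>_. 1"]) (auto simp: indicator_def)
  then have "(\<lambda>K. prob (E K)) \<longlonglongrightarrow> 0" by simp
  then have "\<forall>\<^sub>F K in sequentially. prob (E K) < 1 / 2" by (rule order_tendstoD) simp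
  then have "\<forall>\<^sub>F K in sequentially. False"
    using eventually_gt_at_top[of "0::nat"]
  proof eventually_elim
    case (elim K)
    then show ?case using arrival_delay_prob[of "K\<^sup>2"] unfolding E_def by simp
  qed
  then show False by simp
qed

end

context stable_service
begin

lemma Dep_unbounded: "AE w in M. filterlim (\<lambda>m. Dep (real (m\<^sup>2)) w) at_top sequentially"
proof -
  obtain n where n: "0 < throughput n" using some_throughput_pos by blast
  show ?thesis
    using departure_rate[of n]
  proof eventually_elim
    case (elim w)
    let ?c = "throughput n / 2"
    show ?case
      unfolding filterlim_at_top
    proof
      fix Z :: nat
      have "\<forall>\<^sub>F m in sequentially. ?c < dep_sum n (\<lambda>_. 1 :: real) (real (m\<^sup>2)) w / (real m)\<^sup>2"
        by (rule order_tendstoD(1)[OF elim]) (use n in simp)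
      moreover have "\<forall>\<^sub>F m in sequentially. max 1 (real Z / ?c) \<le> real m"
        using filterlim_real_sequentially unfolding filterlim_at_top by blast
      ultimately show "\<forall>\<^sub>F m in sequentially. Z \<le> Dep (real (m\<^sup>2)) w"
      proof eventually_elim
        case (elim m)
        have m: "1 \<le> real m" "real Z / ?c \<le> real m" using elim(2) by auto
        have "real Z \<le> ?c * real m" using m(2) n by (simp add: field_simps)
        also have "\<dots> \<le> ?c * (real m)\<^sup>2"
          by (rule mult_left_mono) (use m n in \<open>auto simp: power2_eq_square\<close>)
        also have "\<dots> \<le> dep_sum n (\<lambda>_. 1 :: real) (real (m\<^sup>2)) w"
          using elim(1) m by (simp add: pos_less_divide_eq)
        also have "\<dots> \<le> (\<Sum>j<Dep (real (m\<^sup>2)) w. 1)"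
          unfolding departure_sum_def by (rule sum_mono) auto
        finally show ?case by simp
      qed
    qed
  qed
qed

text \<open>Residual times after actual departures are positive. Since \<open>Dep\<close> is unbounded, every index belongs to
  an actual departure.\<close>

lemma residual_nonneg: "nonneg_distribution (R k)"
proof -
  have R: "real_distribution (R k)" using residual_law[of k] by (simp add: steady_residual_law_def)
  interpret R: real_distribution "R k" by (rule R)
  have cdf0: "cdf (R k) x = 0" if x: "x < 0" for x
  proof -
    have "AE w in M. (\<lambda>m. real (card {j. j < m \<and> left j w = k \<and> resid j w \<le> x})
             / real (card {j. j < m \<and> left j w = k})) \<longlonglongrightarrow> cdf (R k) x"
      using residual_law[of k] by (simp add: steady_residual_law_def)
    then have "AE w in M. cdf (R k) x = 0"
      using simple_path_AE Dep_unbounded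
    proof eventually_elim
      case (elim w)
      interpret simple_queue_path N0 T Dep w by (rule elim)
      have "0 < resid j w" for j
      proof -
        have "\<forall>\<^sub>F m in sequentially. Suc j \<le> Dep (real (m\<^sup>2)) w"
          using elim(3) unfolding filterlim_at_top by blast
        then obtain m where "Suc j \<le> Dep (real (m\<^sup>2)) w" unfolding eventually_sequentially by blast
        then show ?thesis by (intro residual_interarrival_pos[of j "real (m\<^sup>2)"]) auto
      qed
      then have e: "{j. j < m \<and> left j w = k \<and> resid j w \<le> x} = {}" for m
        using x by (auto simp: not_le intro: less_trans)
      have "(\<lambda>m::nat. 0 :: real) \<longlonglongrightarrow> cdf (R k) x"
        using elim(1) unfolding e by simp
      then show ?case by (simp add: LIMSEQ_const_iff)
    qed
    then show ?thesis by (rule AE_witness)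
  qed
  have "AE x in R k. \<forall>i. - inverse (real (Suc i)) < x"
    unfolding AE_all_countable
  proof
    fix i
    have "R.prob {..- inverse (real (Suc i))} = 0"
      using cdf0[of "- inverse (real (Suc i))"] by (simp add: cdf_def)
    then have "AE x in R k. x \<notin> {..- inverse (real (Suc i))}"
      by (subst (asm) R.prob_eq_0) auto
    then show "AE x in R k. - inverse (real (Suc i)) < x" by eventually_elim auto
  qed
  then have "AE x in R k. 0 \<le> x"
  proof eventually_elim
    case (elim x)
    show ?case
    proof (rule ccontr)
      assume "\<not> 0 \<le> x"
      then obtain i where "inverse (real (Suc i)) < - x" using reals_Archimedean[of "- x"] by auto
      then show False using elim by (smt (verit))
    qed
  qed
  then show ?thesis using R by (simp add: nonneg_distribution_def nonneg_distribution_axioms_def)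
qed

text \<open>The average over the departures leaving \<open>n\<close> converges by \<open>empirical_average_tendsto\<close>, evaluated at the
  number of departures up to time \<open>m\<^sup>2\<close>, which tends to infinity; it is multiplied by the rate of these departures.\<close>

lemma departure_transform:
  assumes s: "0 \<le> Re s"
  shows "AE w in M. (\<lambda>m. dep_sum n (discount s) (real (m\<^sup>2)) w / of_real ((real m)\<^sup>2))
    \<longlonglongrightarrow> of_real (throughput n) * lst (R n) s"
proof -
  interpret R: nonneg_distribution "R n" by (rule residual_nonneg)
  have "\<forall>x\<in>\<rat>. AE w in M. (\<lambda>m. real (card {j. j < m \<and> left j w = n \<and> resid j w \<le> x})
             / real (card {j. j < m \<and> left j w = n})) \<longlonglongrightarrow> cdf (R n) x"
    using residual_law[of n] by (simp add: steady_residual_law_def)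
  then have "AE w in M. \<forall>x\<in>\<rat>. (\<lambda>m. real (card {j. j < m \<and> left j w = n \<and> resid j w \<le> x})
             / real (card {j. j < m \<and> left j w = n})) \<longlonglongrightarrow> cdf (R n) x"
    by (subst AE_ball_countable) (auto simp: countable_rat)
  then show ?thesis
    using Dep_unbounded departure_rate[of n] simple_path_AE
  proof eventually_elim
    case (elim w)
    interpret simple_queue_path N0 T Dep w by (rule elim)
    let ?S = "\<lambda>m. {j. j < m \<and> left j w = n}"
    have "(\<lambda>m. (\<Sum>j\<in>?S m. cdiscount s (resid j w)) / of_nat (card (?S m))) \<longlonglongrightarrow> lst (R n) s"
      unfolding R.lst_eq
      by (rule empirical_average_tendsto[where B=1]) (use elim(1) R.real_distribution_axioms isCont_cdiscount norm_cdiscount[OF s] in auto)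
    from filterlim_compose[OF this elim(2)]
    have "(\<lambda>m. (\<Sum>j\<in>?S (Dep (real (m\<^sup>2)) w). cdiscount s (resid j w)) / of_nat (card (?S (Dep (real (m\<^sup>2)) w)))
       * complex_of_real (dep_sum n (\<lambda>_. 1 :: real) (real (m\<^sup>2)) w / (real m)\<^sup>2))
       \<longlonglongrightarrow> lst (R n) s * complex_of_real (throughput n)"
      by (intro tendsto_mult tendsto_of_real elim(3))
    moreover have "(\<Sum>j\<in>?S (Dep t w). cdiscount s (resid j w)) / of_nat (card (?S (Dep t w)))
       * complex_of_real (dep_sum n (\<lambda>_. 1 :: real) t w / c) = dep_sum n (discount s) t w / of_real c"
      if t: "0 \<le> t" for t c
    proof -
      have filt: "?S (Dep t w) = {j \<in> {..<Dep t w}. left j w = n}" by auto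
      have a: "dep_sum n (discount s) t w = (\<Sum>j\<in>?S (Dep t w). cdiscount s (resid j w))"
        unfolding departure_sum_def filt sum.inter_filter[OF finite_lessThan]
        by (rule sum.cong) (use residual_interarrival_pos[OF _ t] in \<open>auto simp: cdiscount_eq less_imp_le\<close>)
      have b: "dep_sum n (\<lambda>_. 1 :: real) t w = real (card (?S (Dep t w)))"
        unfolding departure_sum_def filt by (simp add: sum.inter_filter[symmetric])
      show ?thesis
      proof (cases "card (?S (Dep t w)) = 0")
        case True
        moreover have "finite (?S (Dep t w))" by simp
        ultimately have e: "?S (Dep t w) = {}" by (simp only: card_0_eq)
        show ?thesis unfolding a b e by simp
      next
        case False
        then show ?thesis unfolding a b by simp
      qed
    qed
    ultimately show ?case by (simp only: of_nat_0_le_iff mult.commute)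
  qed
qed

text \<open>\<open>state_balance\<close> divided by the time, in the limit: the integral is replaced by departures through
  \<open>departure_martingale_lst\<close>, and the arrivals by \<open>arrival_martingale_lst\<close>.\<close>

lemma balance_equation:
  assumes s: "0 \<le> Re s"
  shows "s / of_real (mu (Suc n)) * (of_real (throughput n) * lst (R n) s)
    = of_real (throughput n) * lst (R n) s + of_real (throughput (Suc n))
      - of_real (throughput n) * lst G s - of_real (throughput (Suc n)) * lst (R (Suc n)) s"
proof -
  let ?m = "\<lambda>m::nat. complex_of_real ((real m)\<^sup>2)" and ?mu = "complex_of_real (mu (Suc n))"
  have "AE w in M. s / of_real (mu (Suc n)) * (of_real (throughput n) * lst (R n) s)
    = of_real (throughput n) * lst (R n) s + of_real (throughput (Suc n))
      - of_real (throughput n) * lst G s - of_real (throughput (Suc n)) * lst (R (Suc n)) s"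
    using departure_transform[OF s, of n] departure_transform[OF s, of "Suc n"] arrival_rate[of n] arrival_rate[of "Suc n"]
      arrival_martingale_lst[OF s, of n] departure_martingale_lst[OF s, of n] simple_path_AE
  proof eventually_elim
    case (elim w)
    interpret simple_queue_path N0 T Dep w by (rule elim)
    let ?D = "\<lambda>n m. dep_sum n (discount s) (real (m\<^sup>2)) w"
      and ?A = "\<lambda>n m. arr_sum n (discount s) (real (m\<^sup>2)) w"
      and ?A1 = "\<lambda>n m. arr_sum n (\<lambda>_. 1 :: real) (real (m\<^sup>2)) w"
      and ?I = "\<lambda>m. occ_integral (Suc n) (discount s) (real (m\<^sup>2)) w"
    have mu0: "?mu \<noteq> 0" using mu_Suc_pos[of n] by simp
    have A1: "arr_sum n (\<lambda>_. 1 :: complex) t w = of_real (arr_sum n (\<lambda>_. 1) t w)" for n t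
      unfolding arrival_sum_def of_real_sum by (rule sum.cong) auto
    have a1: "(\<lambda>m. complex_of_real (?A1 k m) / ?m m) \<longlonglongrightarrow> of_real (throughput k)" if "k = n \<or> k = Suc n" for k
      using tendsto_of_real[of "\<lambda>m. ?A1 k m / (real m)\<^sup>2" "throughput k" sequentially, where 'a=complex] that elim(3,4) by auto
    have A: "(\<lambda>m. ?A n m / ?m m) \<longlonglongrightarrow> lst G s * of_real (throughput n)"
      using tendsto_add[OF elim(5) tendsto_mult_left[OF a1[of n], of "lst G s"]] by (simp add: diff_divide_distrib)
    have I: "(\<lambda>m. ?I m / ?m m) \<longlonglongrightarrow> of_real (throughput n) * lst (R n) s / ?mu"
    proof -
      have "(\<lambda>m. (?D n m / ?m m - (?D n m - ?mu * ?I m) / ?m m) / ?mu) \<longlonglongrightarrow> (of_real (throughput n) * lst (R n) s - 0) / ?mu"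
        by (intro tendsto_divide tendsto_diff tendsto_const elim(1,6) mu0)
      moreover have "(?D n m / ?m m - (?D n m - ?mu * ?I m) / ?m m) / ?mu = ?I m / ?m m" for m
        using mu0 by (simp add: diff_divide_distrib)
      ultimately show ?thesis by simp
    qed
    have "(\<lambda>m. (s * ?I m - (?D n m + of_real (?A1 (Suc n) m) - ?A n m - ?D (Suc n) m)) / ?m m) \<longlonglongrightarrow> 0"
      by (rule over_squares_tendsto_0[where c=2]) (use state_balance[OF s, of "real (m\<^sup>2)" n for m] A1 in auto)
    moreover have "(\<lambda>m. s * (?I m / ?m m) - (?D n m / ?m m + of_real (?A1 (Suc n) m) / ?m m - ?A n m / ?m m - ?D (Suc n) m / ?m m))
      \<longlonglongrightarrow> s * (of_real (throughput n) * lst (R n) s / ?mu) - (of_real (throughput n) * lst (R n) s + of_real (throughput (Suc n))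
        - lst G s * of_real (throughput n) - of_real (throughput (Suc n)) * lst (R (Suc n)) s)"
      by (intro tendsto_diff tendsto_mult tendsto_add tendsto_const I A a1 elim(1,2)) auto
    moreover have "(s * i - (d + a1 - a - d')) / c = s * (i / c) - (d / c + a1 / c - a / c - d' / c)" for i d a1 a d' c :: complex
      by (simp add: diff_divide_distrib add_divide_distrib)
    ultimately have "0 = s * (of_real (throughput n) * lst (R n) s / ?mu) - (of_real (throughput n) * lst (R n) s + of_real (throughput (Suc n))
        - lst G s * of_real (throughput n) - of_real (throughput (Suc n)) * lst (R (Suc n)) s)"
      using LIMSEQ_unique by (simp only:)
    then show ?case by (simp add: mult_ac)
  qed
  then show ?thesis by (rule AE_witness)
qed

lemma G_nontrivial: "nonneg_distribution.rlst G 1 \<noteq> 1"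
proof -
  interpret G: nonneg_distribution G by (rule G_nonneg_distribution)
  have "(LINT x|G. 1 - exp (- max 0 x)) = 1 - G.rlst 1"
    unfolding G.rlst_def using G.integrable_rlst[of 1] G.prob_space by simp
  then show ?thesis using expectation_truncated_gap_pos by simp
qed

lemma real_balance:
  assumes "0 \<le> a"
  shows "a / mu (Suc n) * (throughput n * nonneg_distribution.rlst (R n) a)
    = throughput n * nonneg_distribution.rlst (R n) a + throughput (Suc n)
      - throughput n * nonneg_distribution.rlst G a - throughput (Suc n) * nonneg_distribution.rlst (R (Suc n)) a"
proof -
  interpret G: nonneg_distribution G by (rule G_nonneg_distribution)
  interpret R: nonneg_distribution "R n" by (rule residual_nonneg)
  interpret R': nonneg_distribution "R (Suc n)" by (rule residual_nonneg)
  have "complex_of_real (a / mu (Suc n) * (throughput n * R.rlst a))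
    = complex_of_real (throughput n * R.rlst a + throughput (Suc n) - throughput n * G.rlst a - throughput (Suc n) * R'.rlst a)"
    using balance_equation[of "complex_of_real a" n] assms
    unfolding G.lst_of_real R.lst_of_real R'.lst_of_real by simp
  then show ?thesis by (simp only: of_real_eq_iff)
qed

text \<open>At \<open>a = mu (Suc n)\<close> the residual law of level \<open>n\<close> cancels from the balance equation, which then
  says that the arrivals finding \<open>n\<close> after which no service is completed before the next arrival are
  compensated by departures leaving \<open>n + 1\<close> after which one is completed.\<close>

lemma throughput_up: "0 < throughput n \<Longrightarrow> 0 < throughput (Suc n)"
proof (rule ccontr)
  interpret G: nonneg_distribution G by (rule G_nonneg_distribution)
  assume n: "0 < throughput n" and "\<not> 0 < throughput (Suc n)"
  then have "throughput (Suc n) = 0" using throughput_nonneg[of "Suc n"] by simp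
  then have "throughput n * G.rlst (mu (Suc n)) = 0"
    using real_balance[of "mu (Suc n)" n] mu_Suc_pos[of n] by simp
  then show False using n G.rlst_pos[of "mu (Suc n)"] mu_Suc_pos[of n] by simp
qed

text \<open>If the throughput vanished at \<open>n\<close> but not at \<open>n + 1\<close>, the balance equation at \<open>n\<close> would make \<open>R (Suc n)\<close>
  the point mass at zero. Inserted into the equation at \<open>n + 1\<close> this leaves a linear function of \<open>a\<close> equal to a sum of terms concave
  in \<open>a\<close>, one of them strictly, as \<open>G\<close> is not concentrated at zero; the second difference at
  \<open>0\<close>, \<open>1\<close>, \<open>2\<close> exhibits the contradiction.\<close>

lemma throughput_down: "0 < throughput (Suc n) \<Longrightarrow> 0 < throughput n"
proof (rule ccontr)
  interpret G: nonneg_distribution G by (rule G_nonneg_distribution)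
  interpret R: nonneg_distribution "R (Suc n)" by (rule residual_nonneg)
  interpret R': nonneg_distribution "R (Suc (Suc n))" by (rule residual_nonneg)
  assume n: "0 < throughput (Suc n)" and "\<not> 0 < throughput n"
  then have 0: "throughput n = 0" using throughput_nonneg[of n] by simp
  have R1: "R.rlst a = 1" if "0 \<le> a" for a
    using real_balance[OF that, of n] n 0 by simp
  let ?d = "throughput (Suc n)" and ?d' = "throughput (Suc (Suc n))" and ?mu = "mu (Suc (Suc n))"
  have e: "a / ?mu * ?d = ?d + ?d' - ?d * G.rlst a - ?d' * R'.rlst a" if "0 \<le> a" for a
    using real_balance[OF that, of "Suc n"] R1[OF that] by simp
  have "?d * (1 - 2 * G.rlst 1 + G.rlst 2) + ?d' * (1 - 2 * R'.rlst 1 + R'.rlst 2) = 0"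
    using e[of 1] e[of 2] by (simp add: algebra_simps)
  moreover have "0 < ?d * (1 - 2 * G.rlst 1 + G.rlst 2)"
    using n G.rlst_gap(2)[of 1] G_nontrivial by simp
  moreover have "0 \<le> 1 - 2 * R'.rlst 1 + R'.rlst 2"
    unfolding R'.rlst_convexity[symmetric] by (rule integral_nonneg_AE) simp
  then have "0 \<le> ?d' * (1 - 2 * R'.rlst 1 + R'.rlst 2)"
    using throughput_nonneg by simp
  ultimately show False by simp
qed

lemma throughput_pos: "0 < throughput n"
proof -
  obtain k where k: "0 < throughput k" using some_throughput_pos by blast
  have "0 < throughput 0"
    using k by (induction k) (auto dest: throughput_down)
  then show ?thesis by (induction n) (auto dest: throughput_up)
qed

text \<open>The balance equation at \<open>s = mu (Suc n)\<close> expresses the ratio of the throughputs at \<open>n + 1\<close> and \<open>n\<close>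
  by the transforms at \<open>mu (Suc n)\<close>. With this ratio the general equation is the claimed recursion, as
  \<open>lst_exp_overshoot\<close> shows. At \<open>s = mu (Suc n)\<close> itself both sides are limits of their values to the
  right.\<close>

lemma residual_recursion:
  assumes s: "0 \<le> Re s"
  shows "lst (R n) s =
    (1 - lst G (complex_of_real (mu (Suc n)))) * lst (exp_overshoot (mu (Suc n)) G) s
    + lst G (complex_of_real (mu (Suc n))) * lst (exp_overshoot (mu (Suc n)) (R (Suc n))) s"
proof -
  interpret G: nonneg_distribution G by (rule G_nonneg_distribution)
  interpret R: nonneg_distribution "R n" by (rule residual_nonneg)
  interpret R': nonneg_distribution "R (Suc n)" by (rule residual_nonneg)
  let ?mu = "mu (Suc n)"
  have mu: "0 < ?mu" by (rule mu_Suc_pos)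
  have d: "0 < throughput n" "0 < throughput (Suc n)" by (rule throughput_pos)+
  have at_mu: "throughput (Suc n) * (1 - R'.rlst ?mu) = throughput n * G.rlst ?mu"
    using real_balance[of ?mu n] mu by (simp add: algebra_simps)
  have g: "0 < G.rlst ?mu" "G.rlst ?mu < 1"
    using G.rlst_pos[of ?mu] G.rlst_gap(1)[OF mu] G_nontrivial mu by auto
  \<comment> \<open>If the residual law at \<open>n + 1\<close> were concentrated at zero, the left-hand side of \<open>at_mu\<close> would vanish.\<close>
  have R'1: "R'.rlst 1 \<noteq> 1"
  proof
    assume triv: "R'.rlst 1 = 1"
    have "0 < 1 - R'.rlst ?mu" using at_mu g d by (metis mult_pos_pos zero_less_mult_pos)
    have i: "integrable (R (Suc n)) (\<lambda>x. 1 - exp (- (1 * max 0 x)))" using R'.integrable_rlst[of 1] by simp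
    have "(LINT x|R (Suc n). 1 - exp (- (1 * max 0 x))) = 0"
      using triv R'.integrable_rlst[of 1] R'.prob_space unfolding R'.rlst_def by simp
    then have "AE x in R (Suc n). 1 - exp (- (1 * max 0 x)) = 0"
      by (subst (asm) integral_nonneg_eq_0_iff_AE[OF i]) auto
    then have "AE x in R (Suc n). max 0 x = 0" by eventually_elim simp
    then have "R'.rlst ?mu = (LINT x|R (Suc n). 1)"
      unfolding R'.rlst_def by (intro integral_cong_AE) (auto elim: eventually_mono)
    then show False using \<open>0 < 1 - R'.rlst ?mu\<close> R'.prob_space by simp
  qed
  have regular: "lst (R n) z =
    (1 - lst G (complex_of_real ?mu)) * lst (exp_overshoot ?mu G) z
    + lst G (complex_of_real ?mu) * lst (exp_overshoot ?mu (R (Suc n))) z"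
    if z: "0 \<le> Re z" "z \<noteq> complex_of_real ?mu" for z
  proof -
    define x where "x = complex_of_real (throughput n)"
    define y where "y = complex_of_real (throughput (Suc n))"
    define m where "m = complex_of_real ?mu"
    define a where "a = complex_of_real (G.rlst ?mu)"
    define r where "r = complex_of_real (R'.rlst ?mu)"
    have nz: "x \<noteq> 0" "y \<noteq> 0" "m \<noteq> 0" "a \<noteq> 0" "1 - a \<noteq> 0" "m - z \<noteq> 0"
      using d mu g z(2) by (auto simp: x_def y_def m_def a_def)
    have "complex_of_real (throughput (Suc n) * (1 - R'.rlst ?mu)) = complex_of_real (throughput n * G.rlst ?mu)"
      unfolding at_mu ..
    then have yr: "y * (1 - r) = x * a"
      by (simp add: x_def y_def a_def r_def)
    then have r1: "1 - r \<noteq> 0" using nz by auto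
    have bal: "z / m * (x * lst (R n) z) = x * lst (R n) z + y - x * lst G z - y * lst (R (Suc n)) z"
      using balance_equation[OF z(1), of n] unfolding x_def y_def m_def .
    have "z * (x * lst (R n) z) = m * (x * lst (R n) z + y - x * lst G z - y * lst (R (Suc n)) z)"
      using bal nz(3) by (simp add: field_simps)
    then have e1: "x * ((m - z) * lst (R n) z) = m * (x * lst G z + y * lst (R (Suc n)) z - y)"
      by (simp add: algebra_simps)
    have q: "y * (lst (R (Suc n)) z - r) = y * lst (R (Suc n)) z - y + x * a"
      using yr by (simp add: algebra_simps)
    have "a / (1 - r) = y / x" using yr nz r1 by (simp add: field_simps)
    have "(1 - a) * (m * (lst G z - a) / ((m - z) * (1 - a))) + a * (m * (lst (R (Suc n)) z - r) / ((m - z) * (1 - r)))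
      = m * (lst G z - a) / (m - z) + (a / (1 - r)) * (m * (lst (R (Suc n)) z - r) / (m - z))"
      using nz r1 by simp
    also have "\<dots> = m * (lst G z - a) / (m - z) + (y / x) * (m * (lst (R (Suc n)) z - r) / (m - z))"
      unfolding \<open>a / (1 - r) = y / x\<close> ..
    also have "\<dots> = m * (x * (lst G z - a) + y * (lst (R (Suc n)) z - r)) / (x * (m - z))"
    proof -
      have "m * u / D + (y / x) * (m * v / D) = m * (x * u + y * v) / (x * D)" if "D \<noteq> 0" for u v D
        using nz(1) that by (simp add: field_simps)
      from this[OF nz(6)] show ?thesis .
    qed
    also have "\<dots> = m * (x * lst G z + y * lst (R (Suc n)) z - y) / (x * (m - z))"
      unfolding q by (simp add: algebra_simps)
    also have "\<dots> = lst (R n) z"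
      unfolding e1[symmetric] using nz by simp
    finally have result: "(1 - a) * (m * (lst G z - a) / ((m - z) * (1 - a))) + a * (m * (lst (R (Suc n)) z - r) / ((m - z) * (1 - r)))
      = lst (R n) z" .
    have "lst G (complex_of_real ?mu) = a"
      unfolding a_def by (rule G.lst_of_real)
    moreover have "lst (exp_overshoot ?mu G) z = m * (lst G z - a) / ((m - z) * (1 - a))"
      using G.lst_exp_overshoot[OF mu G_nontrivial z] by (simp add: m_def a_def)
    moreover have "lst (exp_overshoot ?mu (R (Suc n))) z = m * (lst (R (Suc n)) z - r) / ((m - z) * (1 - r))"
      using R'.lst_exp_overshoot[OF mu R'1 z] by (simp add: m_def r_def)
    ultimately show ?thesis using result by (simp only:)
  qed
  show ?thesis
  proof (cases "s = complex_of_real ?mu")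
    case False
    then show ?thesis by (rule regular[OF s])
  next
    case True
    \<comment> \<open>Both sides are continuous in \<open>s\<close>, so the exceptional point is approached from the right.\<close>
    define \<sigma> where "\<sigma> k = complex_of_real (?mu + 1 / real (Suc k))" for k
    have \<sigma>: "0 \<le> Re (\<sigma> k)" "\<sigma> k \<noteq> complex_of_real ?mu" for k
      using mu by (auto simp: \<sigma>_def simp del: of_real_add)
    have "(\<lambda>k. complex_of_real (?mu + 1 / real (Suc k))) \<longlonglongrightarrow> complex_of_real (?mu + 0)"
      by (intro tendsto_of_real tendsto_add tendsto_const LIMSEQ_Suc[OF lim_1_over_n])
    then have lim: "\<sigma> \<longlonglongrightarrow> s" unfolding \<sigma>_def[abs_def] True by simp
    have "(\<lambda>k. lst (R n) (\<sigma> k)) \<longlonglongrightarrow> lst (R n) s"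
      by (rule lst_tendsto) (use \<sigma> lim R.finite_measure_axioms in auto)
    moreover have "(\<lambda>k. (1 - lst G (complex_of_real ?mu)) * lst (exp_overshoot ?mu G) (\<sigma> k)
      + lst G (complex_of_real ?mu) * lst (exp_overshoot ?mu (R (Suc n))) (\<sigma> k)) \<longlonglongrightarrow>
      (1 - lst G (complex_of_real ?mu)) * lst (exp_overshoot ?mu G) s
      + lst G (complex_of_real ?mu) * lst (exp_overshoot ?mu (R (Suc n))) s"
      by (intro tendsto_add tendsto_mult tendsto_const lst_tendsto \<sigma> lim
            G.finite_measure_overshoot[OF mu G_nontrivial] R'.finite_measure_overshoot[OF mu R'1])
         (auto simp: exp_overshoot_def)
    ultimately show ?thesis
      unfolding regular[OF \<sigma>] by (rule LIMSEQ_unique)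
  qed
qed

end

theorem theorem8:
  fixes M :: "'w measure" and G :: "real measure" and lam :: real and mu :: "nat \<Rightarrow> real"
    and N0 :: "'w \<Rightarrow> nat" and T :: "nat \<Rightarrow> 'w \<Rightarrow> real" and Dep :: "real \<Rightarrow> 'w \<Rightarrow> nat"
    and R :: "nat \<Rightarrow> real measure" and n :: nat and s :: complex
  assumes "GMn1_queue M G lam mu N0 T Dep"
    and "stable_queue M N0 T Dep"
    and "\<And>k. steady_residual_law M N0 T Dep k (R k)"
    and "0 \<le> Re s"
  shows "lst (R n) s =
    (1 - lst G (complex_of_real (mu (n + 1)))) * lst (exp_overshoot (mu (n + 1)) G) s
    + lst G (complex_of_real (mu (n + 1))) * lst (exp_overshoot (mu (n + 1)) (R (n + 1))) s"
proof -
  interpret GMn1_queue M G lam mu N0 T Dep by fact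
  obtain q where q: "\<forall>n\<ge>1. \<forall>t\<ge>0. \<forall>h>0. \<forall>B\<in>past M N0 T Dep t.
            B \<subseteq> {w \<in> space M. queue_length N0 T Dep t w = n
                              \<and> (\<forall>k. \<not> (t < T k w \<and> T k w \<le> t + h))} \<longrightarrow>
            (\<forall>i. prob (B \<inter> {w \<in> space M. Dep (t + h) w - Dep t w = i})
                  = prob B * pmf (q n h) i)"
    "\<forall>n\<ge>1. (\<lambda>h. pmf (q n h) 1 - mu n * h) \<in> o[at_right 0](\<lambda>h. h)"
    "\<forall>n\<ge>1. (\<lambda>h. measure_pmf.prob (q n h) {2..}) \<in> o[at_right 0](\<lambda>h. h)"
    using service_rates by blast
  obtain p :: "nat \<Rightarrow> real" where p: "\<And>n. 0 \<le> p n" "p sums 1"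
    "\<And>n. AE w in M. ((\<lambda>t. measure lborel {u \<in> {0..t}. queue_length N0 T Dep u w = n} / t) \<longlongrightarrow> p n) at_top"
    using assms(2) unfolding stable_queue_def by blast
  interpret stable_service M G lam mu N0 T Dep q p R
    by (unfold_locales; (rule p | rule assms(3) | rule q(2)[rule_format] | rule q(3)[rule_format] | rule q(1)[rule_format]); assumption)
  show ?thesis using residual_recursion[OF assms(4), of n] by simp
qed

end
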